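(* Let $X=V(f)\subseteq \mathbb{P}_k^{n-1}$ be a reduced hypersurface of degree $d\ge 3$ with isolated singularities, and let $\Gamma=\mathrm{Sing}(X)=\{p_1,\ldots,p_r\}$ with $r<n$. Assume that $\Gamma$ consists of $r$ nodes imposing independent linear conditions on $R_1$. Set $m=T-1=n(d-2)-1$ and $I:=I(\Gamma)$. Then the following are equivalent: (a) $X$ is Veronese-Avoiding; (b) there is no nonzero linear form $\ell\in I_1$ such that $\ell^m\in (J_f)_m$; (c) the rational map \[ \phi_f:\mathbb{P}(I_1)\dashrightarrow \mathbb{P}(N(f)_m),\qquad [\ell]\longmapsto [\,\ell^m \bmod (J_f)_m\,], \] is everywhere defined. Moreover, $\dim_k I_1=\dim_k N(f)_m=n-r$, so after choosing bases, $\phi_f$ may be viewed as a rational map $\mathbb{P}^{n-r-1}\dashrightarrow \mathbb{P}^{n-r-1}$.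
   Context: $k$ is an algebraically closed field of characteristic zero, $R=k[x_1,\ldots,x_n]$ is the standard graded polynomial ring with graded pieces $R_m$ and irrelevant ideal $\mathfrak m=(x_1,\ldots,x_n)$, and $f\in R_d$ is a reduced (squarefree) homogeneous polynomial. The gradient ideal is $J_f=(\partial f/\partial x_1,\ldots,\partial f/\partial x_n)$, with degree-$m$ piece $(J_f)_m$. Set $T=n(d-2)$. $\mathbb{P}((J_f)_m)\subseteq\mathbb{P}(R_m)$ is the projective linear subspace attached to $(J_f)_m$, of codimension $\dim_k R_m-\dim_k (J_f)_m$. The Veronese variety $V_n^m\subseteq \mathbb{P}(R_m)$ is the image of $\mathbb{P}(R_1)\to\mathbb{P}(R_m)$, $[\ell]\mapsto[\ell^m]$. $X=V(f)$ is called Veronese-Avoiding if (I) $\mathrm{codim}_{\mathbb{P}(R_{T-1})}\mathbb{P}((J_f)_{T-1})=n$ and (II) $\mathbb{P}((J_f)_{T-1})\cap V_n^{T-1}=\emptyset$. $J_f^{\mathrm{sat}}=\{h\in R\mid \mathfrak m^t h\subseteq J_f \text{ for some } t\ge 0\}$ is the saturation of $J_f$, and $N(f)=J_f^{\mathrm{sat}}/J_f$ is the (graded) Jacobian module, with degree-$q$ piece $N(f)_q$. $\mathrm{Sing}(X)$ is the set of singular points of $X$. A node is an ordinary double point (nondegenerate quadratic part of a local equation). $I(\Gamma)\subseteq R$ is the homogeneous ideal of all forms vanishing at every point of $\Gamma$, and $I_1$ is its degree-one piece. The points of $\Gamma$ impose independent linear conditions on $R_1$ if $\dim_k I(\Gamma)_1=n-|\Gamma|$.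 "Everywhere defined" for $\phi_f$ means that the given formula has no base points, i.e. that the class of $\ell^m$ in $N(f)_m$ is nonzero for every $[\ell]\in\mathbb{P}(I_1)$. *)

theory Defs
  imports
    "HOL-Library.Poly_Mapping"
    "HOL-Library.Cardinality"
    "HOL-Computational_Algebra.Polynomial"
    "HOL-Computational_Algebra.Squarefree"
    "Jordan_Normal_Form.VS_Connect"
begin

section \<open>Polynomial rings\<close>

text \<open>
  Finitely supported functions on exponent vectors. For a finite type \<open>'v\<close> this is the polynomial
  ring in \<open>CARD('v)\<close> variables; its ring structure is the convolution product of
  \<^theory>\<open>HOL-Library.Poly_Mapping\<close>.
\<close>

type_synonym ('v, 'k) mpoly = "('v \<Rightarrow>\<^sub>0 nat) \<Rightarrow>\<^sub>0 'k"

definition Const :: "'k::zero \<Rightarrow> ('v, 'k) mpoly" where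
  "Const c = Poly_Mapping.single 0 c"

definition Var :: "'v \<Rightarrow> ('v, 'k::zero_neq_one) mpoly" where
  "Var i = Poly_Mapping.single (Poly_Mapping.single i 1) 1"

definition pscale :: "'k::comm_ring_1 \<Rightarrow> ('v, 'k) mpoly \<Rightarrow> ('v, 'k) mpoly" where
  "pscale c p = Const c * p"

interpretation mpoly_vs: vector_space "pscale :: 'k::field \<Rightarrow> ('v, 'k) mpoly \<Rightarrow> ('v, 'k) mpoly"
proof
  fix a b :: 'k and x y :: "('v, 'k) mpoly"
  show "pscale a (x + y) = pscale a x + pscale a y"
    by (simp add: pscale_def algebra_simps)
  show "pscale (a + b) x = pscale a x + pscale b x"
    by (simp add: pscale_def Const_def single_add algebra_simps)
  show "pscale a (pscale b x) = pscale (a * b) x"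
    by (simp add: pscale_def Const_def mult_single flip: mult.assoc)
  show "pscale 1 x = x"
    by (simp add: pscale_def Const_def)
qed

definition mdeg :: "('v \<Rightarrow>\<^sub>0 nat) \<Rightarrow> nat" where
  "mdeg \<alpha> = (\<Sum>i\<in>Poly_Mapping.keys \<alpha>. Poly_Mapping.lookup \<alpha> i)"

definition forms :: "nat \<Rightarrow> ('v, 'k::zero) mpoly set" where
  "forms m = {p. \<forall>\<alpha>\<in>Poly_Mapping.keys p. mdeg \<alpha> = m}"

definition hom_part :: "nat \<Rightarrow> ('v, 'k::comm_monoid_add) mpoly \<Rightarrow> ('v, 'k) mpoly" where
  "hom_part m p = (\<Sum>\<alpha> | \<alpha> \<in> Poly_Mapping.keys p \<and> mdeg \<alpha> = m.
     Poly_Mapping.single \<alpha> (Poly_Mapping.lookup p \<alpha>))"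

text \<open>The ring homomorphism extending \<open>h\<close> on coefficients and sending the variable \<open>i\<close> to \<open>s i\<close>.\<close>

definition insertion_via :: "('k::zero \<Rightarrow> 'a::comm_ring_1) \<Rightarrow> ('v \<Rightarrow> 'a) \<Rightarrow> ('v, 'k) mpoly \<Rightarrow> 'a" where
  "insertion_via h s p = (\<Sum>\<alpha>\<in>Poly_Mapping.keys p.
     h (Poly_Mapping.lookup p \<alpha>) * (\<Prod>i\<in>Poly_Mapping.keys \<alpha>. s i ^ Poly_Mapping.lookup \<alpha> i))"

definition eval_at :: "('v \<Rightarrow> 'k::comm_ring_1) \<Rightarrow> ('v, 'k) mpoly \<Rightarrow> 'k" where
  "eval_at v p = insertion_via (\<lambda>c. c) v p"

definition subst :: "('v \<Rightarrow> ('w, 'k) mpoly) \<Rightarrow> ('v, 'k::comm_ring_1) mpoly \<Rightarrow> ('w, 'k) mpoly" where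
  "subst s p = insertion_via Const s p"

text \<open>
  Exponents are subtracted with truncation, which is harmless: if \<open>i\<close> does not occur in \<open>\<alpha>\<close>, then
  the coefficient of the corresponding summand is \<open>0\<close>.
\<close>

definition partial :: "'v \<Rightarrow> ('v, 'k::comm_ring_1) mpoly \<Rightarrow> ('v, 'k) mpoly" where
  "partial i p = (\<Sum>\<alpha>\<in>Poly_Mapping.keys p.
     Poly_Mapping.single (\<alpha> - Poly_Mapping.single i 1)
       (of_nat (Poly_Mapping.lookup \<alpha> i) * Poly_Mapping.lookup p \<alpha>))"


section \<open>Ideals\<close>

text \<open>An ideal of a commutative ring is a submodule of the ring, acting on itself.\<close>

interpretation self_module: Modules.module "(*) :: 'a::comm_ring_1 \<Rightarrow> 'a \<Rightarrow> 'a"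
  by unfold_locales (simp_all add: algebra_simps)

definition ideal_gen :: "'a::comm_ring_1 set \<Rightarrow> 'a set" where
  "ideal_gen S = self_module.span S"

primrec ideal_power :: "'a::comm_ring_1 set \<Rightarrow> nat \<Rightarrow> 'a set" where
  "ideal_power I 0 = UNIV"
| "ideal_power I (Suc t) = ideal_gen {a * b | a b. a \<in> I \<and> b \<in> ideal_power I t}"

definition irrelevant_ideal :: "('v, 'k::comm_ring_1) mpoly set" where
  "irrelevant_ideal = ideal_gen (range Var)"

definition gradient_ideal :: "('v, 'k::comm_ring_1) mpoly \<Rightarrow> ('v, 'k) mpoly set" where
  "gradient_ideal f = ideal_gen (range (\<lambda>i. partial i f))"

definition saturation :: "('v, 'k::comm_ring_1) mpoly set \<Rightarrow> ('v, 'k) mpoly set" where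
  "saturation J = {h. \<exists>t. \<forall>g\<in>ideal_power irrelevant_ideal t. g * h \<in> J}"


section \<open>Projective spaces\<close>

text \<open>
  The point \<open>[v]\<close> is the line spanned by \<open>v\<close> (including the zero vector). The scalar multiplication
  \<open>s\<close> and the zero vector \<open>z\<close> are parameters, so that the same definition serves for coordinate
  vectors, for polynomials, and for quotient spaces given by records.
\<close>

definition proj_point :: "('k \<Rightarrow> 'b \<Rightarrow> 'b) \<Rightarrow> 'b \<Rightarrow> 'b set" where
  "proj_point s v = range (\<lambda>c. s c v)"

definition proj_space :: "('k \<Rightarrow> 'b \<Rightarrow> 'b) \<Rightarrow> 'b \<Rightarrow> 'b set \<Rightarrow> 'b set set" where
  "proj_space s z V = proj_point s ` (V - {z})"

abbreviation PP :: "('v, 'k::comm_ring_1) mpoly set \<Rightarrow> ('v, 'k) mpoly set set" where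
  "PP V \<equiv> proj_space pscale 0 V"

definition coord_points :: "('v \<Rightarrow> 'k::comm_ring_1) set set" where
  "coord_points = proj_space (\<lambda>c v i. c * v i) (\<lambda>_. 0) UNIV"

definition vanishes_at :: "('v, 'k::comm_ring_1) mpoly \<Rightarrow> ('v \<Rightarrow> 'k) set \<Rightarrow> bool" where
  "vanishes_at g p \<longleftrightarrow> (\<forall>v\<in>p. eval_at v g = 0)"

text \<open>The codimension of \<open>PP W\<close> in \<open>PP V\<close>, for finite-dimensional \<open>W \<subseteq> V\<close>.\<close>

definition proj_codim :: "('v, 'k::field) mpoly set \<Rightarrow> ('v, 'k) mpoly set \<Rightarrow> nat" where
  "proj_codim V W = mpoly_vs.dim V - mpoly_vs.dim W"

definition veronese :: "nat \<Rightarrow> ('v, 'k::field) mpoly set set" where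
  "veronese m = {proj_point pscale (l ^ m) | l. l \<in> forms 1 \<and> l \<noteq> 0}"

definition points_ideal :: "('v \<Rightarrow> 'k::comm_ring_1) set set \<Rightarrow> ('v, 'k) mpoly set" where
  "points_ideal \<Gamma> = ideal_gen {g. (\<exists>q. g \<in> forms q) \<and> (\<forall>p\<in>\<Gamma>. vanishes_at g p)}"

definition points_ideal_1 :: "('v \<Rightarrow> 'k::comm_ring_1) set set \<Rightarrow> ('v, 'k) mpoly set" where
  "points_ideal_1 \<Gamma> = points_ideal \<Gamma> \<inter> forms 1"

definition independent_conditions :: "('v::finite \<Rightarrow> 'k::field) set set \<Rightarrow> bool" where
  "independent_conditions \<Gamma> \<longleftrightarrow>
     int (mpoly_vs.dim (points_ideal_1 \<Gamma>)) = int CARD('v) - int (card \<Gamma>)"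


section \<open>Singularities\<close>

definition Sing :: "('v, 'k::comm_ring_1) mpoly \<Rightarrow> ('v \<Rightarrow> 'k) set set" where
  "Sing f = {p \<in> coord_points. vanishes_at f p \<and> (\<forall>i. vanishes_at (partial i f) p)}"

text \<open>
  For a representative \<open>v\<close> with \<open>v i = 1\<close>, dehomogenise at \<open>x_i = 1\<close> and translate \<open>v\<close> to the origin.
  The result does not involve the variable \<open>i\<close>; the others are affine coordinates at \<open>[v]\<close>.
\<close>

definition local_equation :: "('v, 'k::comm_ring_1) mpoly \<Rightarrow> ('v \<Rightarrow> 'k) \<Rightarrow> 'v \<Rightarrow> ('v, 'k) mpoly" where
  "local_equation f v i = subst (\<lambda>j. Const (v j) + (if j = i then 0 else Var j)) f"

definition nondegenerate_on :: "('v \<Rightarrow> 'k::comm_ring_1) set \<Rightarrow> ('v, 'k) mpoly \<Rightarrow> bool" where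
  "nondegenerate_on U q \<longleftrightarrow> (\<forall>u\<in>U.
     (\<forall>w\<in>U. eval_at (\<lambda>j. u j + w j) q - eval_at u q - eval_at w q = 0) \<longrightarrow> u = (\<lambda>_. 0))"

definition is_node :: "('v, 'k::comm_ring_1) mpoly \<Rightarrow> ('v \<Rightarrow> 'k) set \<Rightarrow> bool" where
  "is_node f p \<longleftrightarrow> (\<exists>v\<in>p. \<exists>i. v i = 1 \<and>
     hom_part 0 (local_equation f v i) = 0 \<and>
     hom_part 1 (local_equation f v i) = 0 \<and>
     nondegenerate_on {u. u i = 0} (hom_part 2 (local_equation f v i)))"


section \<open>Quotient spaces and the Jacobian module\<close>

definition coset :: "'b::ab_group_add set \<Rightarrow> 'b \<Rightarrow> 'b set" where
  "coset W v = {v + w | w. w \<in> W}"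

text \<open>
  The quotient \<open>V / W\<close> as a vector space record over the field \<open>class_ring\<close>. The record type extends
  that of rings; the fields \<open>mult\<close> and \<open>one\<close> play no role for modules.
\<close>

definition quotient_space ::
  "('k \<Rightarrow> 'b \<Rightarrow> 'b) \<Rightarrow> 'b::ab_group_add set \<Rightarrow> 'b set \<Rightarrow> ('k, 'b set) module" where
  "quotient_space s V W = \<lparr>
     carrier = coset W ` V,
     mult = undefined,
     one = undefined,
     zero = W,
     add = (\<lambda>A B. {a + b | a b. a \<in> A \<and> b \<in> B}),
     smult = (\<lambda>c A. {s c a + w | a w. a \<in> A \<and> w \<in> W})\<rparr>"

context vector_space
begin

lemma quotient_space_coset_add:
  assumes "subspace W"
  shows "{a + b | a b. a \<in> coset W x \<and> b \<in> coset W y} = coset W (x + y)"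
proof (intro equalityI subsetI)
  fix z assume "z \<in> {a + b | a b. a \<in> coset W x \<and> b \<in> coset W y}"
  then obtain w w' where "w \<in> W" "w' \<in> W" "z = (x + w) + (y + w')"
    by (auto simp: coset_def)
  then show "z \<in> coset W (x + y)"
    using subspace_add[OF assms] by (auto simp: coset_def algebra_simps intro!: exI[of _ "w + w'"])
next
  fix z assume "z \<in> coset W (x + y)"
  then obtain w where "w \<in> W" "z = (x + 0) + (y + w)" by (auto simp: coset_def add.assoc)
  then show "z \<in> {a + b | a b. a \<in> coset W x \<and> b \<in> coset W y}"
    using subspace_0[OF assms] by (fastforce simp: coset_def)
qed

lemma quotient_space_coset_scale:
  assumes "subspace W"
  shows "{scale c a + w | a w. a \<in> coset W x \<and> w \<in> W} = coset W (scale c x)"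
proof (intro equalityI subsetI)
  fix z assume "z \<in> {scale c a + w | a w. a \<in> coset W x \<and> w \<in> W}"
  then obtain w w' where "w \<in> W" "w' \<in> W" "z = scale c (x + w) + w'"
    by (auto simp: coset_def)
  then show "z \<in> coset W (scale c x)"
    using subspace_add[OF assms] subspace_scale[OF assms]
    by (auto simp: coset_def algebra_simps intro!: exI[of _ "scale c w + w'"])
next
  fix z assume "z \<in> coset W (scale c x)"
  then obtain w where "w \<in> W" "z = scale c (x + 0) + w" by (auto simp: coset_def)
  then show "z \<in> {scale c a + w | a w. a \<in> coset W x \<and> w \<in> W}"
    using subspace_0[OF assms] by (fastforce simp: coset_def)
qed

lemma vectorspace_quotient_space:
  assumes W: "subspace W" and V: "subspace V"
  shows "vectorspace class_ring (quotient_space scale V W)"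
proof -
  let ?Q = "quotient_space scale V W"
  note c = subspace_add[OF V] subspace_scale[OF V] subspace_neg[OF V] subspace_0[OF V]
  have carr: "carrier ?Q = coset W ` V" and zero: "\<zero>\<^bsub>?Q\<^esub> = coset W 0"
    by (auto simp: quotient_space_def coset_def)
  have add: "coset W x \<oplus>\<^bsub>?Q\<^esub> coset W y = coset W (x + y)" for x y
    using quotient_space_coset_add[OF W] by (simp add: quotient_space_def)
  have smult: "a \<odot>\<^bsub>?Q\<^esub> coset W x = coset W (scale a x)" for a x
    using quotient_space_coset_scale[OF W] by (simp add: quotient_space_def)
  have ag: "abelian_group ?Q"
  proof (rule abelian_groupI)
    fix x assume "x \<in> carrier ?Q"
    then obtain v where v: "v \<in> V" "x = coset W v" by (auto simp: carr)
    show "\<exists>y\<in>carrier ?Q. y \<oplus>\<^bsub>?Q\<^esub> x = \<zero>\<^bsub>?Q\<^esub>"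
      using v c by (auto simp: carr zero add intro!: bexI[of _ "- v"])
  qed (use c in \<open>auto simp: carr zero add add_ac\<close>)
  have fld: "field (class_ring :: 'a ring)"
    by (rule class_field)
  then have "cring (class_ring :: 'a ring)" by (simp add: field_def domain_def)
  then have "Module.module class_ring ?Q"
    using ag
    by (rule Module.moduleI)
      (use c in \<open>auto simp: carr zero add smult class_ring_simps algebra_simps\<close>)
  with fld show ?thesis by (simp add: vectorspace_def)
qed

end

definition gradient_piece :: "('v, 'k::comm_ring_1) mpoly \<Rightarrow> nat \<Rightarrow> ('v, 'k) mpoly set" where
  "gradient_piece f m = gradient_ideal f \<inter> forms m"

text \<open>The graded piece of degree \<open>q\<close> of \<open>saturation J / J\<close>, where \<open>J\<close> is the gradient ideal.\<close>

definition jacobian_piece :: "('v, 'k::comm_ring_1) mpoly \<Rightarrow> nat \<Rightarrow> ('k, ('v, 'k) mpoly set) module" where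
  "jacobian_piece f q =
     quotient_space pscale (saturation (gradient_ideal f) \<inter> forms q) (gradient_piece f q)"


section \<open>The Veronese-avoiding property and the map phi\<close>

definition veronese_avoiding :: "nat \<Rightarrow> ('v::finite, 'k::field) mpoly \<Rightarrow> bool" where
  "veronese_avoiding d f \<longleftrightarrow> (let T = CARD('v) * (d - 2) in
     proj_codim (forms (T - 1)) (gradient_piece f (T - 1)) = CARD('v) \<and>
     PP (gradient_piece f (T - 1)) \<inter> veronese (T - 1) = {})"

text \<open>
  The graph of the partial map \<open>[l] \<mapsto> [l ^ m mod J]\<close>. A point \<open>[l]\<close> has an image iff the class of
  \<open>l ^ m\<close> is a nonzero element of the target space. The image does not depend on \<open>l\<close>: replacing \<open>l\<close> by
  \<open>c l\<close> multiplies that class by \<open>c ^ m\<close>.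
\<close>

definition phi :: "('v, 'k::field) mpoly \<Rightarrow> ('v \<Rightarrow> 'k) set set \<Rightarrow> nat
    \<Rightarrow> (('v, 'k) mpoly set \<times> ('v, 'k) mpoly set set) set" where
  "phi f \<Gamma> m = (let N = jacobian_piece f m; cl = coset (gradient_piece f m) in
     {(proj_point pscale l, proj_point (smult N) (cl (l ^ m))) | l.
        l \<in> points_ideal_1 \<Gamma> \<and> l \<noteq> 0 \<and> cl (l ^ m) \<in> carrier N - {\<zero>\<^bsub>N\<^esub>}})"

definition everywhere_defined :: "('a \<times> 'b) set \<Rightarrow> 'a set \<Rightarrow> bool" where
  "everywhere_defined \<phi> P \<longleftrightarrow> Domain \<phi> = P"

definition family_basis :: "nat \<Rightarrow> (nat \<Rightarrow> ('v, 'k::field) mpoly) \<Rightarrow> ('v, 'k) mpoly set \<Rightarrow> bool" where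
  "family_basis s b V \<longleftrightarrow> inj_on b {..<s} \<and> mpoly_vs.independent (b ` {..<s}) \<and>
     mpoly_vs.span (b ` {..<s}) = V"

definition family_basis_record :: "nat \<Rightarrow> (nat \<Rightarrow> 'b) \<Rightarrow> ('k::field, 'b) module \<Rightarrow> bool" where
  "family_basis_record s c N \<longleftrightarrow> inj_on c {..<s} \<and> vectorspace.basis class_ring N (c ` {..<s})"

text \<open>
  With respect to bases \<open>b\<close> and \<open>c\<close> of the source and target spaces, the map sends \<open>t_0, \<dots>, t_(s-1)\<close> to
  \<open>F_0(t), \<dots>, F_(s-1)(t)\<close>, for forms \<open>F_j\<close> of degree \<open>m\<close> in the \<open>s\<close> variables with indices below \<open>s\<close>.
\<close>

definition phi_coordinates :: "('v, 'k::field) mpoly \<Rightarrow> nat \<Rightarrow> nat \<Rightarrow> (nat \<Rightarrow> ('v, 'k) mpoly)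
    \<Rightarrow> (nat \<Rightarrow> ('v, 'k) mpoly set) \<Rightarrow> (nat \<Rightarrow> (nat, 'k) mpoly) \<Rightarrow> bool" where
  "phi_coordinates f m s b c F \<longleftrightarrow> (let N = jacobian_piece f m in
     (\<forall>j<s. F j \<in> forms m \<and> (\<forall>\<alpha>\<in>Poly_Mapping.keys (F j). Poly_Mapping.keys \<alpha> \<subseteq> {..<s})) \<and>
     (\<forall>t. coset (gradient_piece f m) ((\<Sum>i<s. pscale (t i) (b i)) ^ m) =
        (\<Oplus>\<^bsub>N\<^esub>j\<in>{..<s}. eval_at t (F j) \<odot>\<^bsub>N\<^esub> c j)))"

end

theory Submission
  imports Defs "HOL-Analysis.Determinants"
begin

text \<open>
  Let \<open>R\<close> be the polynomial ring in \<open>n\<close> variables, \<open>J\<close> the gradient ideal of \<open>f\<close>, generated by \<open>n\<close>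
  forms of degree \<open>e = d - 1\<close>, and \<open>m = n (e - 1) - 1\<close>. If \<open>\<ell>\<^sup>m\<close> lies in \<open>J\<close>, then it vanishes at the
  singular points, hence so does \<open>\<ell>\<close>; conversely, if \<open>\<ell>\<close> vanishes at the nodes, then \<open>\<ell>\<^sup>m\<close> lies in the
  saturation of \<open>J\<close>, so its class is in the Jacobian module. The equivalence of (a), (b) and (c)
  therefore follows from the first part of the definition of Veronese-avoiding, that
  \<open>dim (R/J)\<^sub>m = n\<close>, and the dimension of the Jacobian module follows from this together with the fact
  that the saturation of \<open>J\<close> has codimension \<open>r\<close> in degree \<open>m\<close>.

  The saturation consists of the forms that vanish at the nodes (\<open>saturation_iff\<close>). For such a form
  \<open>h\<close> the ideal \<open>J : h\<close> has no zeros: at a node \<open>J\<close> is locally the ideal of the point, because the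
  Hessian is invertible (\<open>node_local_generation\<close>). The projective Nullstellensatz then says that
  \<open>J : h\<close> contains all forms of large degree. Since the nodes impose independent conditions on
  linear forms, they do so on forms of each positive degree (\<open>dim_vanishing\<close>).

  For \<open>dim (R/J)\<^sub>m = n\<close> choose a linear form \<open>x\<close> that vanishes at no node and \<open>n - 1\<close> general
  combinations \<open>g\<close> of the partial derivatives that have no common zero with \<open>x\<close>
  (\<open>parameter_system_exists\<close>); then \<open>J = (g) + (g\<^sub>0)\<close> for one more partial derivative \<open>g\<^sub>0\<close>. For large
  \<open>a\<close> the quotient \<open>C = R/(g, x\<^sup>a)\<close> is an Artinian complete intersection. It satisfies
  Poincare duality with socle degree \<open>\<sigma> + a - 1\<close>, where \<open>\<sigma> = (n - 1) (e - 1)\<close>. Duality and the fact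
  that \<open>x\<close> is a nonzerodivisor modulo \<open>(g)\<close> show that \<open>R/(g)\<close> has its stable dimension in degree
  \<open>m = \<sigma> + e - 2\<close> and \<open>n\<close> less than that in degree \<open>\<sigma> - 2\<close>. So the claim is that
  multiplication by \<open>g\<^sub>0\<close> is injective from degree \<open>\<sigma> - 2\<close> to degree \<open>m\<close> of \<open>R/(g)\<close>. (For \<open>\<sigma> < 2\<close> there is
  nothing to multiply, and the stable dimension is \<open>n\<close>.) Now
  \<open>R\<^sub>a\<^sub>+\<^sub>1 = J\<^sub>a\<^sub>+\<^sub>1 + x\<^sup>a R\<^sub>1\<close>, since linear forms interpolate all values at the nodes. An element of the
  kernel is annihilated by \<open>J\<close>, and \<open>x\<^sup>a = 0\<close> in \<open>C\<close>, so it is orthogonal to all of \<open>R\<^sub>a\<^sub>+\<^sub>1\<close>. By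
  duality it vanishes (\<open>hilbert_adjoin_below_top\<close>).

  Duality for complete intersections amounts to a one-dimensional socle. It is proved without regular
  sequences: the Bezoutian of the generators gives a linear map from the dual space of the quotient to
  the quotient that is injective on the socle, so it is bijective for reasons of dimension
  (\<open>bezoutian\<close>). That it is injective on the socle is the statement that a determinant is not in the
  ideal (\<open>det_notin_ideal\<close>), which is reduced to the ideal of the \<open>N\<close>-th powers of the variables.
\<close>

section \<open>Polynomials and forms\<close>

(* For the ring acting on itself this is associativity from right to left, which as a rewrite rule
   loops with \<open>algebra_simps\<close>. *)
declare self_module.scale_scale [simp del]

lemma poly_mapping_eq_sum_single:
  "p = (\<Sum>\<alpha>\<in>Poly_Mapping.keys p. Poly_Mapping.single \<alpha> (Poly_Mapping.lookup p \<alpha>))"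
  by (rule poly_mapping_eqI)
     (simp add: lookup_sum lookup_single when_def sum.delta' in_keys_iff)

lemma poly_mapping_additive_induct [case_names single add]:
  fixes p :: "'a \<Rightarrow>\<^sub>0 'b::comm_monoid_add"
  assumes "\<And>\<alpha> c. P (Poly_Mapping.single \<alpha> c)"
    and "\<And>p q. P p \<Longrightarrow> P q \<Longrightarrow> P (p + q)"
  shows "P p"
proof -
  have "P (\<Sum>\<alpha>\<in>A. Poly_Mapping.single \<alpha> (Poly_Mapping.lookup p \<alpha>))" if "finite A" for A
    using that
  proof induction
    case empty
    then show ?case using assms(1)[of undefined 0] by simp
  qed (simp add: assms)
  then show ?thesis
    by (subst poly_mapping_eq_sum_single) simp
qed

lemma additive_sum:
  assumes "h 0 = 0" "\<And>a b. h (a + b) = h a + h b"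
  shows "h (sum g A) = (\<Sum>a\<in>A. h (g a))"
  by (induction A rule: infinite_finite_induct) (simp_all add: assms)

subsection \<open>Constants and variables\<close>

lemma lookup_Const_times [simp]:
  "Poly_Mapping.lookup (Const c * p) \<alpha> = c * Poly_Mapping.lookup p \<alpha>"
  for c :: "'k::comm_ring_1"
proof (induction p rule: poly_mapping_additive_induct)
  case (single \<beta> a)
  then show ?case by (simp add: Const_def mult_single lookup_single when_def)
qed (simp add: algebra_simps lookup_add)

lemma lookup_pscale [simp]:
  "Poly_Mapping.lookup (pscale c p) \<alpha> = c * Poly_Mapping.lookup p \<alpha>"
  by (simp add: pscale_def)

lemma Const_0 [simp]: "Const 0 = 0" and Const_1 [simp]: "Const 1 = 1"
  by (simp_all add: Const_def)

lemma Const_add: "Const (a + b) = Const a + Const b"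
  by (simp add: Const_def single_add)

lemma Const_mult: "Const (a * b) = Const a * Const b" for a :: "'k::comm_ring_1"
  by (simp add: Const_def mult_single)

lemma Const_minus: "Const (- a) = - Const a" for a :: "'k::comm_ring_1"
  by (simp add: Const_def single_uminus)

lemma Const_power: "Const (a ^ n) = Const a ^ n" for a :: "'k::comm_ring_1"
  by (induction n) (simp_all add: Const_mult)

lemma Const_sum: "Const (sum g A) = (\<Sum>a\<in>A. Const (g a))"
  by (rule additive_sum) (simp_all add: Const_add)

lemma single_eq_Const_times:
  "Poly_Mapping.single \<alpha> c = Const c * Poly_Mapping.single \<alpha> 1" for c :: "'k::comm_ring_1"
  by (simp add: Const_def mult_single)

lemma pscale_single: "pscale c (Poly_Mapping.single \<alpha> a) = Poly_Mapping.single \<alpha> (c * a)"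
  by (simp add: pscale_def Const_def mult_single)

lemma pscale_mult_left: "pscale c p * q = pscale c (p * q)"
  and pscale_mult_right: "p * pscale c q = pscale c (p * q)"
  by (simp_all add: pscale_def algebra_simps)

lemma Var_power: "Var i ^ n = (Poly_Mapping.single (Poly_Mapping.single i n) 1 :: ('v, 'k::comm_ring_1) mpoly)"
proof (induction n)
  case (Suc n)
  have "Poly_Mapping.single i 1 + Poly_Mapping.single i n = Poly_Mapping.single i (Suc n)"
    by (simp flip: single_add)
  then show ?case by (simp only: power_Suc Suc) (simp add: Var_def mult_single)
qed simp

lemma single_eq_prod_Var:
  "Poly_Mapping.single \<alpha> 1 =
     (\<Prod>i\<in>Poly_Mapping.keys \<alpha>. Var i ^ Poly_Mapping.lookup \<alpha> i :: ('v, 'k::comm_ring_1) mpoly)"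
proof -
  have "(\<Prod>i\<in>A. Var i ^ Poly_Mapping.lookup \<alpha> i :: ('v, 'k) mpoly) =
      Poly_Mapping.single (\<Sum>i\<in>A. Poly_Mapping.single i (Poly_Mapping.lookup \<alpha> i)) 1"
    if "finite A" for A
    using that by induction (simp_all add: Var_power mult_single)
  from this[of "Poly_Mapping.keys \<alpha>"] show ?thesis
    by (simp only: finite_keys simp_thms flip: poly_mapping_eq_sum_single[of \<alpha>])
qed

lemma mpoly_ring_induct [case_names Const Var add mult]:
  fixes p :: "('v, 'k::comm_ring_1) mpoly"
  assumes "\<And>c. P (Const c)" "\<And>i. P (Var i)"
    and add: "\<And>p q. P p \<Longrightarrow> P q \<Longrightarrow> P (p + q)"
    and mult: "\<And>p q. P p \<Longrightarrow> P q \<Longrightarrow> P (p * q)"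
  shows "P p"
proof (induction p rule: poly_mapping_additive_induct)
  case (single \<alpha> c)
  have one: "P 1" using assms(1)[of 1] by simp
  have pow: "P (Var i ^ n)" for i n by (induction n) (simp_all add: one assms)
  have "P (\<Prod>i\<in>A. Var i ^ Poly_Mapping.lookup \<alpha> i)" if "finite A" for A
    using that by induction (simp_all add: one pow mult)
  then show ?case
    by (subst single_eq_Const_times, subst single_eq_prod_Var) (simp add: assms)
qed (rule add)

subsection \<open>Degrees\<close>

lemma mdeg_superset:
  assumes "finite A" "Poly_Mapping.keys \<alpha> \<subseteq> A"
  shows "mdeg \<alpha> = (\<Sum>i\<in>A. Poly_Mapping.lookup \<alpha> i)"
  unfolding mdeg_def using assms by (intro sum.mono_neutral_left) (auto simp: in_keys_iff)

lemma mdeg_add: "mdeg (\<alpha> + \<beta>) = mdeg \<alpha> + mdeg \<beta>"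
proof -
  let ?A = "Poly_Mapping.keys \<alpha> \<union> Poly_Mapping.keys \<beta>"
  have "mdeg (\<alpha> + \<beta>) = (\<Sum>i\<in>?A. Poly_Mapping.lookup (\<alpha> + \<beta>) i)"
    using keys_add[of \<alpha> \<beta>] by (intro mdeg_superset) auto
  then show ?thesis
    by (simp add: lookup_add sum.distrib flip: mdeg_superset)
qed

lemma mdeg_0 [simp]: "mdeg 0 = 0"
  by (simp add: mdeg_def)

lemma mdeg_single [simp]: "mdeg (Poly_Mapping.single i n) = n"
  by (simp add: mdeg_def)

lemma mdeg_UNIV: "mdeg \<alpha> = (\<Sum>i\<in>UNIV. Poly_Mapping.lookup \<alpha> i)" for \<alpha> :: "'v::finite \<Rightarrow>\<^sub>0 nat"
  by (rule mdeg_superset) auto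

lemma lookup_le_mdeg: "Poly_Mapping.lookup \<alpha> i \<le> mdeg \<alpha>"
proof (cases "i \<in> Poly_Mapping.keys \<alpha>")
  case True
  then show ?thesis unfolding mdeg_def by (intro member_le_sum) auto
qed (simp add: in_keys_iff)

lemma mdeg_eq_0_iff: "mdeg \<alpha> = 0 \<longleftrightarrow> \<alpha> = 0"
proof
  assume "mdeg \<alpha> = 0"
  then show "\<alpha> = 0"
    using lookup_le_mdeg[of \<alpha>] by (intro poly_mapping_eqI) (metis le_zero_eq lookup_zero)
qed simp

lemma exponent_pred:
  fixes \<alpha> :: "'v \<Rightarrow>\<^sub>0 nat"
  assumes "Poly_Mapping.lookup \<alpha> i > 0"
  obtains \<beta> where "\<alpha> = Poly_Mapping.single i 1 + \<beta>"
proof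
  show "\<alpha> = Poly_Mapping.single i 1 + (\<alpha> - Poly_Mapping.single i 1)"
    using assms
    by (intro poly_mapping_eqI) (auto simp: lookup_add lookup_minus lookup_single when_def)
qed

lemma finite_exponents_mdeg_le: "finite {\<alpha> :: 'v::finite \<Rightarrow>\<^sub>0 nat. mdeg \<alpha> \<le> m}"
proof (rule finite_imageD)
  have "Poly_Mapping.lookup ` {\<alpha> :: 'v \<Rightarrow>\<^sub>0 nat. mdeg \<alpha> \<le> m} \<subseteq> (UNIV \<rightarrow>\<^sub>E {..m})"
    by (auto simp: PiE_UNIV_domain intro: order_trans[OF lookup_le_mdeg])
  then show "finite (Poly_Mapping.lookup ` {\<alpha> :: 'v \<Rightarrow>\<^sub>0 nat. mdeg \<alpha> \<le> m})"
    by (rule finite_subset) (simp add: finite_PiE)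
qed (simp add: inj_on_def)

subsection \<open>Forms\<close>

lemma forms_iff: "p \<in> forms m \<longleftrightarrow> (\<forall>\<alpha>. Poly_Mapping.lookup p \<alpha> \<noteq> 0 \<longrightarrow> mdeg \<alpha> = m)"
  by (auto simp: forms_def in_keys_iff)

lemma zero_in_forms [simp]: "0 \<in> forms m"
  by (simp add: forms_iff)

lemma forms_add [intro]: "p \<in> forms m \<Longrightarrow> q \<in> forms m \<Longrightarrow> p + q \<in> forms m"
  for p q :: "('v, 'k::comm_ring_1) mpoly"
  unfolding forms_iff lookup_add by (metis add_0)

lemma forms_pscale [intro]: "p \<in> forms m \<Longrightarrow> pscale c p \<in> forms m"
  unfolding forms_iff lookup_pscale by (metis mult_zero_right)

lemma subspace_forms: "mpoly_vs.subspace (forms m :: ('v, 'k::field) mpoly set)"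
  by (auto simp: mpoly_vs.subspace_def)

lemma forms_uminus [intro]: "p \<in> forms m \<Longrightarrow> - p \<in> forms m"
  for p :: "('v, 'k::comm_ring_1) mpoly"
  by (auto simp: forms_iff)

lemma forms_diff [intro]: "p \<in> forms m \<Longrightarrow> q \<in> forms m \<Longrightarrow> p - q \<in> forms m"
  for p q :: "('v, 'k::comm_ring_1) mpoly"
  by (metis add_uminus_conv_diff forms_add forms_uminus)

lemma forms_sum [intro]: "(\<And>a. a \<in> A \<Longrightarrow> g a \<in> forms m) \<Longrightarrow> sum g A \<in> forms m"
  for g :: "'a \<Rightarrow> ('v, 'k::comm_ring_1) mpoly"
  by (induction A rule: infinite_finite_induct) auto

lemma forms_mult [intro]: "p \<in> forms m \<Longrightarrow> q \<in> forms m' \<Longrightarrow> p * q \<in> forms (m + m')"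
  for p q :: "('v, 'k::comm_ring_1) mpoly"
  using keys_mult[of p q] by (force simp: forms_def mdeg_add)

lemma single_in_forms [simp]: "Poly_Mapping.single \<alpha> c \<in> forms (mdeg \<alpha>)"
  by (auto simp: forms_iff lookup_single when_def)

lemma Const_in_forms [simp]: "Const c \<in> forms 0"
  unfolding Const_def by (metis mdeg_0 single_in_forms)

lemma one_in_forms [simp]: "1 \<in> forms 0"
  by (metis mdeg_0 single_in_forms single_one)

lemma Var_in_forms: "Var i \<in> forms 1"
  unfolding Var_def by (metis mdeg_single single_in_forms)

declare Var_in_forms [simp] Var_in_forms [unfolded One_nat_def, simp]

lemma forms_power [intro]: "p \<in> forms m \<Longrightarrow> p ^ n \<in> forms (n * m)"
  for p :: "('v, 'k::comm_ring_1) mpoly"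
  by (induction n) auto

lemma forms_prod: "(\<And>a. a \<in> A \<Longrightarrow> g a \<in> forms (m a)) \<Longrightarrow> prod g A \<in> forms (sum m A)"
  for g :: "'a \<Rightarrow> ('v, 'k::comm_ring_1) mpoly"
  by (induction A rule: infinite_finite_induct) auto

lemma form_eq_sum_single:
  fixes p :: "('v::finite, 'k::comm_ring_1) mpoly"
  assumes "p \<in> forms m"
  shows "p = (\<Sum>\<alpha> | mdeg \<alpha> = m. Poly_Mapping.single \<alpha> (Poly_Mapping.lookup p \<alpha>))"
proof -
  have fin: "finite {\<alpha> :: 'v \<Rightarrow>\<^sub>0 nat. mdeg \<alpha> = m}"
    by (rule finite_subset[OF _ finite_exponents_mdeg_le[of m]]) auto
  have "(\<Sum>\<alpha>\<in>Poly_Mapping.keys p. Poly_Mapping.single \<alpha> (Poly_Mapping.lookup p \<alpha>)) =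
      (\<Sum>\<alpha> | mdeg \<alpha> = m. Poly_Mapping.single \<alpha> (Poly_Mapping.lookup p \<alpha>))"
    using assms fin by (intro sum.mono_neutral_left) (auto simp: forms_def in_keys_iff)
  with poly_mapping_eq_sum_single show ?thesis by (rule trans)
qed

lemma forms_span_monomials:
  "forms m = mpoly_vs.span ((\<lambda>\<alpha>. Poly_Mapping.single \<alpha> 1) ` {\<alpha>. mdeg \<alpha> = m} :: ('v::finite, 'k::field) mpoly set)"
  (is "_ = mpoly_vs.span ?B")
proof
  show "forms m \<subseteq> mpoly_vs.span ?B"
  proof
    fix p :: "('v, 'k) mpoly" assume "p \<in> forms m"
    then have "p = (\<Sum>\<alpha> | mdeg \<alpha> = m. pscale (Poly_Mapping.lookup p \<alpha>) (Poly_Mapping.single \<alpha> 1))"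
      using form_eq_sum_single by (simp add: pscale_single)
    also have "\<dots> \<in> mpoly_vs.span ?B"
      by (intro mpoly_vs.span_sum mpoly_vs.span_scale mpoly_vs.span_base) auto
    finally show "p \<in> mpoly_vs.span ?B" .
  qed
  show "mpoly_vs.span ?B \<subseteq> forms m"
    by (rule mpoly_vs.span_minimal[OF _ subspace_forms]) auto
qed

lemma finite_exponents_mdeg: "finite {\<alpha> :: 'v::finite \<Rightarrow>\<^sub>0 nat. mdeg \<alpha> = m}"
  by (rule finite_subset[OF _ finite_exponents_mdeg_le[of m]]) auto

subsection \<open>Homogeneous components\<close>

lemma lookup_hom_part: "Poly_Mapping.lookup (hom_part m p) \<alpha> = (if mdeg \<alpha> = m then Poly_Mapping.lookup p \<alpha> else 0)"
  unfolding hom_part_def lookup_sum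
  by (simp add: lookup_single when_def sum.delta' in_keys_iff)

lemma hom_part_in_forms [simp]: "hom_part m p \<in> forms m"
  by (auto simp: forms_iff lookup_hom_part)

lemma hom_part_add: "hom_part m (p + q) = hom_part m p + hom_part m q"
  and hom_part_0 [simp]: "hom_part m 0 = 0"
  by (rule poly_mapping_eqI, simp add: lookup_hom_part lookup_add)+

lemma hom_part_diff: "hom_part m (p - q) = hom_part m p - hom_part m q" for p :: "('v, 'k::comm_ring_1) mpoly"
  by (rule poly_mapping_eqI) (simp add: lookup_hom_part lookup_minus)

lemma hom_part_pscale: "hom_part m (pscale c p) = pscale c (hom_part m p)"
  by (rule poly_mapping_eqI) (simp add: lookup_hom_part)

lemma hom_part_sum: "hom_part m (sum g A) = (\<Sum>a\<in>A. hom_part m (g a))"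
  by (rule additive_sum) (simp_all add: hom_part_add)

lemma hom_part_form: "p \<in> forms q \<Longrightarrow> hom_part m p = (if m = q then p else 0)"
  by (rule poly_mapping_eqI) (auto simp: lookup_hom_part forms_iff)

lemma hom_part_mult_form:
  fixes p h :: "('v, 'k::comm_ring_1) mpoly"
  assumes "h \<in> forms q"
  shows "hom_part m (p * h) = (if q \<le> m then hom_part (m - q) p * h else 0)"
proof (induction p rule: poly_mapping_additive_induct)
  case (single \<alpha> c)
  have "Poly_Mapping.single \<alpha> c * h \<in> forms (mdeg \<alpha> + q)"
    using assms by auto
  then show ?case
    by (auto simp: hom_part_form[where q = "mdeg \<alpha> + q"] hom_part_form[where q = "mdeg \<alpha>"])
qed (simp add: hom_part_add algebra_simps)

lemma sum_hom_part: 
  assumes "\<And>\<alpha>. \<alpha> \<in> Poly_Mapping.keys p \<Longrightarrow> mdeg \<alpha> \<le> B"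
  shows "p = (\<Sum>m\<le>B. hom_part m p)"
  using assms by (intro poly_mapping_eqI) (auto simp: lookup_sum lookup_hom_part in_keys_iff)

lemma sum_hom_part_obtain:
  obtains B where "p = (\<Sum>m\<le>B. hom_part m p)"
proof
  show "p = (\<Sum>m\<le>Max (mdeg ` Poly_Mapping.keys p). hom_part m p)"
    by (rule sum_hom_part) simp
qed

subsection \<open>Evaluation and substitution\<close>

lemma insertion_via_superset:
  assumes "h 0 = 0" "finite A" "Poly_Mapping.keys p \<subseteq> A"
  shows "insertion_via h s p =
    (\<Sum>\<alpha>\<in>A. h (Poly_Mapping.lookup p \<alpha>) * (\<Prod>i\<in>Poly_Mapping.keys \<alpha>. s i ^ Poly_Mapping.lookup \<alpha> i))"
  unfolding insertion_via_def using assms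
  by (intro sum.mono_neutral_left) (auto simp: in_keys_iff)

lemma insertion_via_add:
  assumes "h 0 = 0" "\<And>a b. h (a + b) = h a + h b"
  shows "insertion_via h s (p + q) = insertion_via h s p + insertion_via h s q"
proof -
  let ?A = "Poly_Mapping.keys p \<union> Poly_Mapping.keys q"
  have k: "Poly_Mapping.keys (p + q) \<subseteq> ?A" by (rule keys_add)
  show ?thesis
    by (subst (1 2 3) insertion_via_superset[where A = ?A])
       (use k in \<open>auto simp: assms lookup_add algebra_simps sum.distrib\<close>)
qed

lemma insertion_via_single:
  assumes "h 0 = 0"
  shows "insertion_via h s (Poly_Mapping.single \<alpha> c) =
    h c * (\<Prod>i\<in>Poly_Mapping.keys \<alpha>. s i ^ Poly_Mapping.lookup \<alpha> i)"
  by (subst insertion_via_superset[where A = "{\<alpha>}"]) (auto simp: assms split: if_splits)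

lemma exponent_power_prod_add:
  fixes s :: "'v \<Rightarrow> 'a::comm_ring_1"
  shows "(\<Prod>i\<in>Poly_Mapping.keys (\<alpha> + \<beta>). s i ^ Poly_Mapping.lookup (\<alpha> + \<beta>) i) =
    (\<Prod>i\<in>Poly_Mapping.keys \<alpha>. s i ^ Poly_Mapping.lookup \<alpha> i) *
    (\<Prod>i\<in>Poly_Mapping.keys \<beta>. s i ^ Poly_Mapping.lookup \<beta> i)"
proof -
  let ?A = "Poly_Mapping.keys \<alpha> \<union> Poly_Mapping.keys \<beta>"
  have *: "(\<Prod>i\<in>Poly_Mapping.keys \<gamma>. s i ^ Poly_Mapping.lookup \<gamma> i) =
      (\<Prod>i\<in>?A. s i ^ Poly_Mapping.lookup \<gamma> i)" if "Poly_Mapping.keys \<gamma> \<subseteq> ?A" for \<gamma>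
    using that by (intro prod.mono_neutral_left) (auto simp: in_keys_iff)
  show ?thesis
    by (subst (1 2 3) *) (use keys_add[of \<alpha> \<beta>] in \<open>auto simp: lookup_add power_add prod.distrib\<close>)
qed

lemma insertion_via_mult:
  fixes h :: "'k::comm_ring_1 \<Rightarrow> 'a::comm_ring_1"
  assumes h: "h 0 = 0" "\<And>a b. h (a + b) = h a + h b" "\<And>a b. h (a * b) = h a * h b"
  shows "insertion_via h s (p * q) = insertion_via h s p * insertion_via h s q"
proof (induction p rule: poly_mapping_additive_induct)
  case (single \<alpha> c)
  show ?case
  proof (induction q rule: poly_mapping_additive_induct)
    case (single \<beta> c')
    show ?case
      by (simp add: mult_single insertion_via_single[of h, OF h(1)] h(3) exponent_power_prod_add)
  qed (simp add: algebra_simps insertion_via_add[of h, OF h(1,2)])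
qed (simp add: algebra_simps insertion_via_add[of h, OF h(1,2)])

lemma insertion_via_Const: "h 0 = 0 \<Longrightarrow> insertion_via h s (Const c) = h c"
  by (simp add: Const_def insertion_via_single)

lemma insertion_via_Var: "h 0 = 0 \<Longrightarrow> h 1 = 1 \<Longrightarrow> insertion_via h s (Var i) = s i"
  by (simp add: Var_def insertion_via_single)

lemma eval_at_add [simp]: "eval_at v (p + q) = eval_at v p + eval_at v q"
  and eval_at_mult [simp]: "eval_at v (p * q) = eval_at v p * eval_at v q"
  and eval_at_Const [simp]: "eval_at v (Const c) = c"
  and eval_at_Var [simp]: "eval_at v (Var i) = v i"
  by (simp_all add: eval_at_def insertion_via_add insertion_via_mult insertion_via_Const insertion_via_Var)

lemma eval_at_single: "eval_at v (Poly_Mapping.single \<alpha> c) =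
    c * (\<Prod>i\<in>Poly_Mapping.keys \<alpha>. v i ^ Poly_Mapping.lookup \<alpha> i)"
  by (simp add: eval_at_def insertion_via_single)

lemma eval_at_0 [simp]: "eval_at v 0 = 0"
  using eval_at_Const[of v 0] by simp

lemma eval_at_1 [simp]: "eval_at v 1 = 1"
  using eval_at_Const[of v 1] by simp

lemma eval_at_uminus [simp]: "eval_at v (- p) = - eval_at v p"
  using eval_at_add[of v p "- p"] by (simp add: eq_neg_iff_add_eq_0 add.commute)

lemma eval_at_diff [simp]: "eval_at v (p - q) = eval_at v p - eval_at v q"
  using eval_at_add[of v p "- q"] by simp

lemma eval_at_power [simp]: "eval_at v (p ^ n) = eval_at v p ^ n"
  by (induction n) simp_all

lemma eval_at_pscale [simp]: "eval_at v (pscale c p) = c * eval_at v p"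
  by (simp add: pscale_def)

lemma eval_at_sum: "eval_at v (sum g A) = (\<Sum>a\<in>A. eval_at v (g a))"
  by (rule additive_sum) simp_all

lemma eval_at_prod: "eval_at v (prod g A) = (\<Prod>a\<in>A. eval_at v (g a))"
  by (induction A rule: infinite_finite_induct) simp_all

lemma eval_at_form_scale:
  fixes p :: "('v, 'k::comm_ring_1) mpoly"
  assumes "p \<in> forms m"
  shows "eval_at (\<lambda>i. c * v i) p = c ^ m * eval_at v p"
proof -
  have "(\<Prod>i\<in>Poly_Mapping.keys \<alpha>. (c * v i) ^ Poly_Mapping.lookup \<alpha> i) =
      c ^ m * (\<Prod>i\<in>Poly_Mapping.keys \<alpha>. v i ^ Poly_Mapping.lookup \<alpha> i)"
    if "\<alpha> \<in> Poly_Mapping.keys p" for \<alpha>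
  proof -
    have "mdeg \<alpha> = m" using that assms by (simp add: forms_def)
    then show ?thesis
      by (auto simp: power_mult_distrib prod.distrib mdeg_def simp flip: power_sum)
  qed
  then show ?thesis
    by (simp add: eval_at_def insertion_via_def sum_distrib_left algebra_simps)
qed

lemma eval_at_form_zero:
  fixes p :: "('v, 'k::comm_ring_1) mpoly"
  assumes "p \<in> forms m" "m > 0"
  shows "eval_at (\<lambda>_. 0) p = 0"
  using eval_at_form_scale[OF assms(1), of 0 "\<lambda>_. 0"] assms(2) by (simp add: zero_power)

lemma subst_add [simp]: "subst s (p + q) = subst s p + subst s q"
  and subst_mult [simp]: "subst s (p * q) = subst s p * subst s q"
  and subst_Const [simp]: "subst s (Const c) = Const c"
  and subst_Var [simp]: "subst s (Var i) = s i"
  by (simp_all add: subst_def insertion_via_add insertion_via_mult insertion_via_Const insertion_via_Var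
      Const_add Const_mult)

lemma eval_at_subst: "eval_at v (subst s p) = eval_at (\<lambda>i. eval_at v (s i)) p"
  by (induction p rule: mpoly_ring_induct) simp_all

subsection \<open>Partial derivatives\<close>

lemma partial_superset:
  assumes "finite A" "Poly_Mapping.keys p \<subseteq> A"
  shows "partial i p = (\<Sum>\<alpha>\<in>A. Poly_Mapping.single (\<alpha> - Poly_Mapping.single i 1)
       (of_nat (Poly_Mapping.lookup \<alpha> i) * Poly_Mapping.lookup p \<alpha>))"
  unfolding partial_def using assms by (intro sum.mono_neutral_left) (auto simp: in_keys_iff)

lemma partial_single: "partial i (Poly_Mapping.single \<alpha> c) =
    Poly_Mapping.single (\<alpha> - Poly_Mapping.single i 1) (of_nat (Poly_Mapping.lookup \<alpha> i) * c)"
  by (subst partial_superset[where A = "{\<alpha>}"]) (auto split: if_splits)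

lemma partial_add [simp]: "partial i (p + q) = partial i p + partial i q"
proof -
  let ?A = "Poly_Mapping.keys p \<union> Poly_Mapping.keys q"
  show ?thesis
    by (subst (1 2 3) partial_superset[where A = ?A])
      (use keys_add[of p q] in \<open>auto simp: lookup_add algebra_simps single_add sum.distrib\<close>)
qed

lemma partial_mult: "partial i (p * q) = partial i p * q + p * partial i q"
proof (induction p rule: poly_mapping_additive_induct)
  case (single \<alpha> c)
  show ?case
  proof (induction q rule: poly_mapping_additive_induct)
    case (single \<beta> c')
    let ?e = "Poly_Mapping.single i 1 :: 'a \<Rightarrow>\<^sub>0 nat"
    have A: "\<alpha> - ?e + \<beta> = \<alpha> + \<beta> - ?e" if "Poly_Mapping.lookup \<alpha> i > 0"
      using that by (intro poly_mapping_eqI) (auto simp: lookup_add lookup_minus lookup_single when_def)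
    have B: "\<alpha> + (\<beta> - ?e) = \<alpha> + \<beta> - ?e" if "Poly_Mapping.lookup \<beta> i > 0"
      using that by (intro poly_mapping_eqI) (auto simp: lookup_add lookup_minus lookup_single when_def)
    show ?case
      using A B
      by (cases "Poly_Mapping.lookup \<alpha> i = 0"; cases "Poly_Mapping.lookup \<beta> i = 0")
         (simp_all add: partial_single mult_single lookup_add algebra_simps flip: single_add)
  qed (simp add: algebra_simps)
qed (simp add: algebra_simps)

lemma partial_Const [simp]: "partial i (Const c) = 0"
  by (simp add: Const_def partial_single)

lemma partial_Var [simp]: "partial i (Var j) = (if i = j then 1 else 0)"
  by (auto simp: Var_def partial_single lookup_single when_def)

lemma partial_form:
  assumes "p \<in> forms m"
  shows "partial i p \<in> forms (m - 1)"
proof -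
  have "Poly_Mapping.single (\<alpha> - Poly_Mapping.single i 1)
       (of_nat (Poly_Mapping.lookup \<alpha> i) * Poly_Mapping.lookup p \<alpha>) \<in> forms (m - 1)"
    if "\<alpha> \<in> Poly_Mapping.keys p" for \<alpha>
  proof (cases "Poly_Mapping.lookup \<alpha> i = 0")
    case False
    then obtain \<beta> where "\<alpha> = Poly_Mapping.single i 1 + \<beta>" using exponent_pred[of \<alpha> i] by auto
    moreover from this have "mdeg \<beta> = m - 1"
      using assms that by (auto simp: forms_def mdeg_add)
    ultimately show ?thesis by (auto simp: forms_iff lookup_single when_def)
  qed simp
  then show ?thesis unfolding partial_def by (rule forms_sum)
qed

text \<open>In characteristic zero it shows that a common zero of the partial derivatives of a form of positive
  degree is a zero of the form.\<close>

lemma euler_formula: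
  fixes p :: "('v::finite, 'k::comm_ring_1) mpoly"
  assumes "p \<in> forms m"
  shows "(\<Sum>i\<in>UNIV. Var i * partial i p) = of_nat m * p"
proof -
  have single: "(\<Sum>i\<in>UNIV. Var i * partial i (Poly_Mapping.single \<alpha> c)) =
      Poly_Mapping.single \<alpha> (of_nat (mdeg \<alpha>) * c)" for \<alpha> :: "'v \<Rightarrow>\<^sub>0 nat" and c :: 'k
  proof -
    have "Var i * partial i (Poly_Mapping.single \<alpha> c) =
        Poly_Mapping.single \<alpha> (of_nat (Poly_Mapping.lookup \<alpha> i) * c)" for i
    proof (cases "Poly_Mapping.lookup \<alpha> i = 0")
      case False
      then obtain \<beta> where "\<alpha> = Poly_Mapping.single i 1 + \<beta>" using exponent_pred[of \<alpha> i] by auto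
      then show ?thesis by (simp add: partial_single Var_def mult_single)
    qed (simp add: partial_single)
    then show ?thesis
      by (simp add: mdeg_UNIV sum_distrib_right additive_sum[of "Poly_Mapping.single \<alpha>", OF _ single_add])
  qed
  have "(\<Sum>i\<in>UNIV. Var i * partial i q) = of_nat m * q" if "\<forall>\<alpha>\<in>A. mdeg \<alpha> = m" "finite A"
    "q = (\<Sum>\<alpha>\<in>A. Poly_Mapping.single \<alpha> (Poly_Mapping.lookup p \<alpha>))" for A q
    using that(2,1,3)
  proof (induction arbitrary: q)
    case (insert \<alpha> A)
    have "of_nat m * Poly_Mapping.single \<alpha> (Poly_Mapping.lookup p \<alpha>) =
       Poly_Mapping.single \<alpha> (of_nat m * Poly_Mapping.lookup p \<alpha>)"
      by (simp add: mult_single flip: single_of_nat)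
    then show ?case
      using insert by (simp add: sum.distrib algebra_simps single)
  qed (simp add: partial_def)
  from this[of "Poly_Mapping.keys p" p, OF _ _ poly_mapping_eq_sum_single] show ?thesis
    using assms by (simp add: forms_def)
qed

section \<open>Dimension counts\<close>

locale vector_space_count = vector_space
begin

definition fin_dim :: "'b set \<Rightarrow> bool" where
  "fin_dim V \<longleftrightarrow> (\<exists>B. finite B \<and> V \<subseteq> span B)"

lemma fin_dim_subset: "fin_dim W \<Longrightarrow> V \<subseteq> W \<Longrightarrow> fin_dim V"
  unfolding fin_dim_def by blast

lemma fin_dim_independent_finite:
  assumes "fin_dim V" "independent A" "A \<subseteq> V"
  shows "finite A"
  using assms independent_span_bound unfolding fin_dim_def by (meson order_trans)

lemma fin_dim_basis:
  assumes "fin_dim V"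
  obtains A where "A \<subseteq> V" "independent A" "V \<subseteq> span A" "finite A" "card A = dim V"
  using basis_exists[of V] fin_dim_independent_finite[OF assms] by metis

lemma fin_dim_card_le_dim:
  assumes "fin_dim V" "independent A" "A \<subseteq> V"
  shows "card A \<le> dim V"
proof -
  obtain B where B: "V \<subseteq> span B" "finite B" "card B = dim V"
    using fin_dim_basis[OF assms(1)] by metis
  then show ?thesis
    using independent_span_bound[OF B(2) assms(2)] assms(3) by auto
qed

lemma fin_dim_mono:
  assumes "fin_dim W" "V \<subseteq> W"
  shows "dim V \<le> dim W"
proof -
  obtain A where "A \<subseteq> V" "independent A" "card A = dim V"
    using fin_dim_basis[OF fin_dim_subset[OF assms]] by metis
  then show ?thesis
    using fin_dim_card_le_dim[OF assms(1), of A] assms(2) by auto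
qed

lemma fin_dim_subspace_eq:
  assumes "fin_dim W" "V \<subseteq> W" "subspace V" "dim W \<le> dim V"
  shows "V = W"
proof (rule ccontr)
  assume "V \<noteq> W"
  then obtain w where w: "w \<in> W" "w \<notin> V" using assms by auto
  obtain A where A: "A \<subseteq> V" "independent A" "V \<subseteq> span A" "card A = dim V" "finite A"
    using fin_dim_basis[OF fin_dim_subset[OF assms(1,2)]] by metis
  have "w \<notin> span A" using span_minimal[OF A(1) assms(3)] w by auto
  then have "independent (insert w A)" "w \<notin> A"
    using A(2) by (auto simp: independent_insert intro: span_base)
  then show False
    using fin_dim_card_le_dim[OF assms(1), of "insert w A"] A w assms(2,4) by auto
qed

text \<open>Rank and nullity of the map that \<open>\<phi>\<close> induces from \<open>V\<close> to a quotient by \<open>W\<close>.\<close>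

lemma dim_image_plus_subspace:
  assumes V: "subspace V" "fin_dim V" and W: "subspace W" "fin_dim W"
    and add: "\<And>x y. \<phi> (x + y) = \<phi> x + \<phi> y" and scale: "\<And>c x. \<phi> (scale c x) = scale c (\<phi> x)"
  shows "dim {\<phi> v + w | v w. v \<in> V \<and> w \<in> W} + dim {v \<in> V. \<phi> v \<in> W} = dim V + dim W"
proof -
  let ?K = "{v \<in> V. \<phi> v \<in> W}" and ?S = "{\<phi> v + w | v w. v \<in> V \<and> w \<in> W}"
  have phi0: "\<phi> 0 = 0" using scale[of 0 0] by simp
  have phi_sum: "\<phi> (\<Sum>x\<in>X. scale (u x) x) = (\<Sum>x\<in>X. scale (u x) (\<phi> x))" for X u
    by (induction X rule: infinite_finite_induct) (simp_all add: phi0 add scale)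
  have K: "subspace ?K" using V(1) W(1) by (auto simp: subspace_def add scale phi0)
  have "fin_dim ?K" by (rule fin_dim_subset[OF V(2)]) auto
  then obtain A where A: "A \<subseteq> ?K" "independent A" "?K \<subseteq> span A" "finite A" "card A = dim ?K"
    by (rule fin_dim_basis)
  obtain D where D: "A \<subseteq> D" "D \<subseteq> V" "independent D" "V \<subseteq> span D"
    using maximal_independent_subset_extend[of A V] A by blast
  have finD: "finite D" using fin_dim_independent_finite[OF V(2) D(3,2)] .
  have cardD: "card D = dim V" using basis_card_eq_dim D by blast
  define C where "C = D - A"
  have C: "C \<subseteq> V" "finite C" "D = A \<union> C" "A \<inter> C = {}" using D finD by (auto simp: C_def)
  obtain B where B: "B \<subseteq> W" "independent B" "W \<subseteq> span B" "finite B" "card B = dim W"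
    using W(2) by (rule fin_dim_basis)
  have Ksp: "span A = ?K" using A span_minimal[OF A(1) K] by blast
  have Wsp: "span B = W" using B span_minimal[OF B(1) W(1)] by blast
  \<comment> \<open>no nontrivial combination of the complement \<open>C\<close> is sent into \<open>W\<close>\<close>
  have C_inj: "u x = 0" if u: "\<phi> (\<Sum>x\<in>C. scale (u x) x) \<in> W" and x: "x \<in> C" for u x
  proof -
    let ?c = "\<Sum>x\<in>C. scale (u x) x"
    have "?c \<in> V" using C V(1) by (intro subspace_sum subspace_scale) auto
    then have "?c \<in> span A" using u Ksp by auto
    then obtain r where r: "?c = (\<Sum>a\<in>A. scale (r a) a)" using span_finite[OF A(4)] by auto
    define g where "g y = (if y \<in> C then u y else - r y)" for y
    have "(\<Sum>y\<in>D. scale (g y) y) = (\<Sum>y\<in>A. scale (g y) y) + (\<Sum>y\<in>C. scale (g y) y)"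
      using C A(4) by (simp add: sum.union_disjoint)
    also have "(\<Sum>y\<in>A. scale (g y) y) = (\<Sum>y\<in>A. - scale (r y) y)"
      using C by (intro sum.cong) (auto simp: g_def)
    also have "(\<Sum>y\<in>C. scale (g y) y) = ?c" by (intro sum.cong) (auto simp: g_def)
    finally have "(\<Sum>y\<in>D. scale (g y) y) = 0" by (simp add: r sum_negf)
    then have "g x = 0" using independentD[OF D(3) finD] x C by auto
    then show ?thesis using x by (simp add: g_def)
  qed
  have inj: "inj_on \<phi> C"
  proof (rule inj_onI, rule ccontr)
    fix x y assume xy: "x \<in> C" "y \<in> C" "\<phi> x = \<phi> y" "x \<noteq> y"
    define u where "u z = (if z = x then 1 else if z = y then -1 else 0 :: 'a)" for z
    have "(\<Sum>z\<in>C. scale (u z) z) = (\<Sum>z\<in>{x,y}. scale (u z) z)"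
      using xy C by (intro sum.mono_neutral_right) (auto simp: u_def)
    also have "\<dots> = x - y" using xy by (simp add: u_def)
    finally have "\<phi> (\<Sum>z\<in>C. scale (u z) z) = 0" using add[of "x - y" y] xy by simp
    then show False using C_inj[of u x] subspace_0[OF W(1)] xy by (simp add: u_def)
  qed
  have disj: "\<phi> ` C \<inter> B = {}"
  proof (rule ccontr)
    assume "\<phi> ` C \<inter> B \<noteq> {}"
    then obtain x where x: "x \<in> C" "\<phi> x \<in> W" using B by auto
    define u where "u z = (if z = x then 1 else 0 :: 'a)" for z
    have "(\<Sum>z\<in>C. scale (u z) z) = (\<Sum>z\<in>{x}. scale (u z) z)"
      using x C by (intro sum.mono_neutral_right) (auto simp: u_def)
    then have "u x = 0" using C_inj[of u x] x by (simp add: u_def)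
    then show False by (simp add: u_def)
  qed
  have ind: "independent (\<phi> ` C \<union> B)"
  proof (rule independent_if_scalars_zero)
    show "finite (\<phi> ` C \<union> B)" using C B by auto
    fix f x assume f: "(\<Sum>x\<in>\<phi> ` C \<union> B. scale (f x) x) = 0" and x: "x \<in> \<phi> ` C \<union> B"
    have "(\<Sum>x\<in>\<phi> ` C \<union> B. scale (f x) x) = (\<Sum>x\<in>\<phi> ` C. scale (f x) x) + (\<Sum>x\<in>B. scale (f x) x)"
      using C B disj by (intro sum.union_disjoint) auto
    also have "(\<Sum>x\<in>\<phi> ` C. scale (f x) x) = \<phi> (\<Sum>x\<in>C. scale (f (\<phi> x)) x)"
      using inj by (simp add: sum.reindex phi_sum)
    finally have eq: "\<phi> (\<Sum>x\<in>C. scale (f (\<phi> x)) x) + (\<Sum>x\<in>B. scale (f x) x) = 0" using f by simp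
    have "(\<Sum>x\<in>B. scale (f x) x) \<in> W" using B W(1) by (intro subspace_sum subspace_scale) auto
    then have "\<phi> (\<Sum>x\<in>C. scale (f (\<phi> x)) x) \<in> W"
      using eq subspace_neg[OF W(1)] by (metis add_eq_0_iff2)
    from C_inj[OF this] have z: "f (\<phi> x) = 0" if "x \<in> C" for x using that .
    then have "(\<Sum>x\<in>C. scale (f (\<phi> x)) x) = 0" by simp
    then have "(\<Sum>x\<in>B. scale (f x) x) = 0" using eq phi0 by simp
    then have "f x = 0" if "x \<in> B" using independentD[OF B(2,4)] that by auto
    then show "f x = 0" using x z by auto
  qed
  have "?S = span (\<phi> ` C \<union> B)"
  proof
    show "?S \<subseteq> span (\<phi> ` C \<union> B)"
    proof safe
      fix v w assume v: "v \<in> V" and w: "w \<in> W"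
      have "v \<in> span D" using D v by auto
      then obtain r where r: "v = (\<Sum>y\<in>D. scale (r y) y)" unfolding span_finite[OF finD] by auto
      then have "v = (\<Sum>y\<in>A. scale (r y) y) + (\<Sum>y\<in>C. scale (r y) y)"
        using C A(4) sum.union_disjoint[of A C "\<lambda>y. scale (r y) y"] by (simp only: r)
      then have "\<phi> v = \<phi> (\<Sum>y\<in>A. scale (r y) y) + (\<Sum>y\<in>C. scale (r y) (\<phi> y))"
        by (simp only: add phi_sum)
      moreover have "(\<Sum>y\<in>A. scale (r y) y) \<in> ?K"
        using A(1) by (intro subspace_sum[OF K] subspace_scale[OF K]) auto
      ultimately have "\<phi> v + w = (\<phi> (\<Sum>y\<in>A. scale (r y) y) + w) + (\<Sum>y\<in>C. scale (r y) (\<phi> y))"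
        and "\<phi> (\<Sum>y\<in>A. scale (r y) y) + w \<in> span B"
        using w subspace_add[OF W(1)] Wsp by (simp_all only: add_ac mem_Collect_eq)
      moreover have "span B \<subseteq> span (\<phi> ` C \<union> B)" by (rule span_mono) simp
      moreover have "(\<Sum>y\<in>C. scale (r y) (\<phi> y)) \<in> span (\<phi> ` C \<union> B)"
        by (intro span_sum span_scale span_base) auto
      ultimately show "\<phi> v + w \<in> span (\<phi> ` C \<union> B)"
        using span_add by (metis subsetD)
    qed
    show "span (\<phi> ` C \<union> B) \<subseteq> ?S"
    proof (rule span_minimal)
      show "\<phi> ` C \<union> B \<subseteq> ?S"
      proof safe
        fix x assume "x \<in> C"
        then show "\<exists>v w. \<phi> x = \<phi> v + w \<and> v \<in> V \<and> w \<in> W"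
          using C subspace_0[OF W(1)] by (intro exI[of _ x] exI[of _ 0]) auto
      next
        fix x assume "x \<in> B"
        then show "\<exists>v w. x = \<phi> v + w \<and> v \<in> V \<and> w \<in> W"
          using B subspace_0[OF V(1)] phi0 by (intro exI[of _ 0] exI[of _ x]) auto
      qed
      show "subspace ?S"
      proof (rule subspaceI)
        have "0 = \<phi> 0 + 0" by (simp add: phi0)
        then show "0 \<in> ?S" using subspace_0[OF W(1)] subspace_0[OF V(1)] by blast
        fix x y c assume x: "x \<in> ?S"
        then obtain v w where vw: "x = \<phi> v + w" "v \<in> V" "w \<in> W" by auto
        show "scale c x \<in> ?S"
          using vw subspace_scale[OF W(1)] subspace_scale[OF V(1)]
          by (intro CollectI exI[of _ "scale c v"] exI[of _ "scale c w"]) (simp add: scale scale_right_distrib)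
        assume "y \<in> ?S"
        then obtain v' w' where "y = \<phi> v' + w'" "v' \<in> V" "w' \<in> W" by auto
        then show "x + y \<in> ?S"
          using vw subspace_add[OF W(1)] subspace_add[OF V(1)]
          by (intro CollectI exI[of _ "v + v'"] exI[of _ "w + w'"]) (simp add: add algebra_simps)
      qed
    qed
  qed
  then have "dim ?S = card (\<phi> ` C \<union> B)" using dim_span_eq_card_independent[OF ind] by simp
  also have "\<dots> = card C + card B" using disj inj C B by (simp add: card_Un_disjoint card_image)
  finally show ?thesis using A(4,5) B(5) cardD C by (simp add: card_Un_disjoint)
qed

lemma complement_basis:
  assumes V: "subspace V" "fin_dim V" and W: "subspace W" "W \<subseteq> V"
  obtains C where "finite C" "C \<subseteq> V" "card C + dim W = dim V"
    "\<And>v. v \<in> V \<Longrightarrow> \<exists>r. v - (\<Sum>c\<in>C. scale (r c) c) \<in> W"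
    "\<And>r c. (\<Sum>c\<in>C. scale (r c) c) \<in> W \<Longrightarrow> c \<in> C \<Longrightarrow> r c = 0"
proof -
  obtain A where A: "A \<subseteq> W" "independent A" "W \<subseteq> span A" "finite A" "card A = dim W"
    by (rule fin_dim_basis[OF fin_dim_subset[OF V(2) W(2)]]) (rule that)
  have "A \<subseteq> V" using A(1) W(2) by blast
  then obtain B where B: "A \<subseteq> B" "B \<subseteq> V" "independent B" "V \<subseteq> span B"
    using maximal_independent_subset_extend[OF _ A(2)] by blast
  have finB: "finite B" by (rule fin_dim_independent_finite[OF V(2) B(3,2)])
  define C where "C = B - A"
  have C: "finite C" "A \<inter> C = {}" "B = A \<union> C" using finB B(1) by (auto simp: C_def)
  have split: "(\<Sum>b\<in>B. scale (g b) b) = (\<Sum>b\<in>A. scale (g b) b) + (\<Sum>b\<in>C. scale (g b) b)" for g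
    unfolding C(3) by (rule sum.union_disjoint[OF A(4) C(1,2)])
  show ?thesis
  proof (rule that[of C])
    show "finite C" by (rule C(1))
    show "C \<subseteq> V" using B(2) by (auto simp: C_def)
    have "card B = dim V" by (rule basis_card_eq_dim[OF B(2,4,3)])
    then show "card C + dim W = dim V" using C A(4,5) by (simp add: card_Un_disjoint)
  next
    fix v assume "v \<in> V"
    then have "v \<in> span B" using B(4) by auto
    then obtain r where r: "v = (\<Sum>b\<in>B. scale (r b) b)" unfolding span_finite[OF finB] by auto
    have "v - (\<Sum>c\<in>C. scale (r c) c) = (\<Sum>b\<in>A. scale (r b) b)" unfolding r split by simp
    also have "\<dots> \<in> W" using A(1) by (intro subspace_sum[OF W(1)] subspace_scale[OF W(1)]) auto
    finally show "\<exists>r. v - (\<Sum>c\<in>C. scale (r c) c) \<in> W" by (rule exI[of _ r])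
  next
    fix r c assume r: "(\<Sum>c\<in>C. scale (r c) c) \<in> W" and c: "c \<in> C"
    then have "(\<Sum>c\<in>C. scale (r c) c) \<in> span A" using A(3) by auto
    then obtain q where q: "(\<Sum>c\<in>C. scale (r c) c) = (\<Sum>a\<in>A. scale (q a) a)"
      unfolding span_finite[OF A(4)] by auto
    define g where "g b = (if b \<in> C then r b else - q b)" for b
    have "(\<Sum>b\<in>A. scale (g b) b) = (\<Sum>b\<in>A. - scale (q b) b)"
      using C(2) by (intro sum.cong) (auto simp: g_def)
    moreover have "(\<Sum>b\<in>C. scale (g b) b) = (\<Sum>b\<in>C. scale (r b) b)"
      by (intro sum.cong) (auto simp: g_def)
    ultimately have "(\<Sum>b\<in>B. scale (g b) b) = 0" by (simp add: split q sum_negf)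
    then have "g c = 0" using independentD[OF B(3) finB] c C(3) by auto
    then show "r c = 0" using c by (simp add: g_def)
  qed
qed

subsection \<open>Linear functionals\<close>

definition functional :: "('b \<Rightarrow> 'a) \<Rightarrow> bool" where
  "functional \<psi> \<longleftrightarrow> (\<forall>x y. \<psi> (x + y) = \<psi> x + \<psi> y) \<and> (\<forall>c x. \<psi> (scale c x) = c * \<psi> x)"

lemma functional_add: "functional \<psi> \<Longrightarrow> \<psi> (x + y) = \<psi> x + \<psi> y"
  and functional_scale: "functional \<psi> \<Longrightarrow> \<psi> (scale c x) = c * \<psi> x"
  by (simp_all add: functional_def)

lemma functional_0: "functional \<psi> \<Longrightarrow> \<psi> 0 = 0"
  using functional_scale[of \<psi> 0 0] by simp

lemma functional_diff: "functional \<psi> \<Longrightarrow> \<psi> (x - y) = \<psi> x - \<psi> y"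
  using functional_add[of \<psi> "x - y" y] by simp

lemma functional_sum: "functional \<psi> \<Longrightarrow> \<psi> (sum g A) = (\<Sum>a\<in>A. \<psi> (g a))"
  by (induction A rule: infinite_finite_induct) (simp_all add: functional_0 functional_add)

lemma functional_combination:
  assumes "\<And>t. t \<in> T \<Longrightarrow> functional (\<psi> t)"
  shows "functional (\<lambda>x. \<Sum>t\<in>T. a t * \<psi> t x)"
  using assms
  by (auto simp: functional_def algebra_simps sum.distrib sum_distrib_left intro!: sum.cong)

lemma subspace_kernel:
  assumes "subspace V" "functional \<psi>"
  shows "subspace {v \<in> V. \<psi> v = 0}"
  using assms functional_0[OF assms(2)] by (auto simp: subspace_def functional_def)

lemma dim_kernel_ge:
  assumes "subspace V" "fin_dim V" "functional \<psi>"
  shows "dim V \<le> dim {v \<in> V. \<psi> v = 0} + 1"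
proof (cases "\<forall>v\<in>V. \<psi> v = 0")
  case True
  then have "{v \<in> V. \<psi> v = 0} = V" by auto
  then show ?thesis by simp
next
  case False
  then obtain \<delta> where \<delta>: "\<delta> \<in> V" "\<psi> \<delta> \<noteq> 0" by auto
  let ?K = "{v \<in> V. \<psi> v = 0}"
  have "fin_dim ?K" by (rule fin_dim_subset[OF assms(2)]) auto
  then obtain A where A: "A \<subseteq> ?K" "?K \<subseteq> span A" "finite A" "card A = dim ?K"
    by (rule fin_dim_basis)
  have "v \<in> span (insert \<delta> A)" if "v \<in> V" for v
  proof -
    have "v - scale (\<psi> v / \<psi> \<delta>) \<delta> \<in> ?K"
      using that \<delta> assms(1,3) subspace_diff subspace_scale
      by (simp add: functional_diff functional_scale)
    then show ?thesis using A(2) span_breakdown_eq by blast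
  qed
  then have "dim V \<le> card (insert \<delta> A)" using A(3) by (intro dim_le_card) auto
  also have "\<dots> \<le> card A + 1" by (simp add: card_insert_if A(3))
  finally show ?thesis using A(4) by simp
qed

lemma dim_kernel_less:
  assumes "subspace V" "fin_dim V" "functional \<psi>" "\<delta> \<in> V" "\<psi> \<delta> \<noteq> 0"
  shows "dim {v \<in> V. \<psi> v = 0} < dim V"
proof (rule ccontr)
  assume "\<not> ?thesis"
  then have "{v \<in> V. \<psi> v = 0} = V"
    using assms by (intro fin_dim_subspace_eq subspace_kernel) auto
  then show False using assms by auto
qed

text \<open>Each linear condition lowers the dimension by at most one.\<close>

lemma dim_kernels_ge:
  assumes "finite T" "subspace V" "fin_dim V" "\<And>t. t \<in> T \<Longrightarrow> functional (\<psi> t)"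
  shows "dim V \<le> dim {v \<in> V. \<forall>t\<in>T. \<psi> t v = 0} + card T \<and> subspace {v \<in> V. \<forall>t\<in>T. \<psi> t v = 0}"
  using assms(1,4)
proof (induction)
  case (insert t T)
  let ?K = "{v \<in> V. \<forall>t\<in>T. \<psi> t v = 0}"
  have eq: "{v \<in> V. \<forall>t'\<in>insert t T. \<psi> t' v = 0} = {v \<in> ?K. \<psi> t v = 0}" by auto
  have "fin_dim ?K" using assms(3) by (rule fin_dim_subset) auto
  moreover have "subspace ?K" "dim V \<le> dim ?K + card T" using insert by auto
  ultimately show ?case
    using dim_kernel_ge[of ?K "\<psi> t"] subspace_kernel[of ?K "\<psi> t"] insert eq by auto
qed (use assms in auto)

lemma separating_functional:
  assumes "subspace I" "\<delta> \<notin> I"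
  obtains \<psi> where "functional \<psi>" "\<And>x. x \<in> I \<Longrightarrow> \<psi> x = 0" "\<psi> \<delta> = 1"
proof -
  obtain A where A: "A \<subseteq> I" "independent A" "I \<subseteq> span A" using maximal_independent_subset[of I] by auto
  have spA: "span A = I" using A span_minimal[OF A(1) assms(1)] by blast
  then have "independent (insert \<delta> A)" using assms A by (auto simp: independent_insert)
  then obtain B where B: "insert \<delta> A \<subseteq> B" "independent B" "span B = UNIV"
    using maximal_independent_subset_extend[of "insert \<delta> A" UNIV] by (metis UNIV_I UNIV_eq_I subset_UNIV subset_iff)
  show ?thesis
  proof
    show "functional (\<lambda>x. representation B x \<delta>)"
      using B by (simp add: functional_def representation_add representation_scale)
    show "representation B \<delta> \<delta> = 1" using B by (simp add: representation_basis)
    fix x assume "x \<in> I"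
    then have "representation B x = representation A x"
      using B spA by (intro representation_extend) auto
    moreover have "\<delta> \<notin> A" using A assms by auto
    ultimately show "representation B x \<delta> = 0" using representation_ne_zero by metis
  qed
qed

text \<open>A basis of a complement of \<open>I\<close>, with its dual basis.\<close>

lemma dual_basis_mod_subspace:
  assumes "subspace I" "finite M" "\<And>v. \<exists>i\<in>I. \<exists>u\<in>span M. v = u + i"
  obtains E \<psi> where "finite E" "\<And>b. b \<in> E \<Longrightarrow> functional (\<psi> b)"
    "\<And>b x. b \<in> E \<Longrightarrow> x \<in> I \<Longrightarrow> \<psi> b x = 0"
    "\<And>b b'. b \<in> E \<Longrightarrow> b' \<in> E \<Longrightarrow> \<psi> b b' = (if b = b' then 1 else 0)"
    "\<And>v. v - (\<Sum>b\<in>E. scale (\<psi> b v) b) \<in> I"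
proof -
  obtain A where A: "A \<subseteq> I" "independent A" "I \<subseteq> span A" using maximal_independent_subset[of I] by auto
  have spA: "span A = I" using A span_minimal[OF A(1) assms(1)] by blast
  have "A \<subseteq> I \<union> M" using A by auto
  then obtain B where B: "A \<subseteq> B" "B \<subseteq> A \<union> M" "independent B" "A \<union> M \<subseteq> span B"
    using maximal_independent_subset_extend[of A "A \<union> M"] A by blast
  have UN: "span B = UNIV"
  proof -
    have "v \<in> span B" for v
    proof -
      obtain i u where "i \<in> I" "u \<in> span M" "v = u + i" using assms(3) by blast
      moreover have "span M \<subseteq> span B" using B(4) by (intro span_minimal) auto
      moreover have "I \<subseteq> span B" using spA span_mono[OF B(1)] by auto
      ultimately show ?thesis using span_add by blast
    qed
    then show ?thesis by auto
  qed
  let ?E = "B - A"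
  have finE: "finite ?E" using B(2) assms(2) by (meson Diff_subset_conv finite_subset)
  show ?thesis
  proof
    show "finite ?E" by (rule finE)
    show "functional (\<lambda>x. representation B x b)" for b
      using B UN by (simp add: functional_def representation_add representation_scale)
    show "representation B b' b = (if b = b' then 1 else 0)" if "b \<in> ?E" "b' \<in> ?E" for b b'
      using that B by (auto simp: representation_basis)
    show "representation B x b = 0" if b: "b \<in> ?E" and "x \<in> I" for b x
    proof -
      have "representation B x = representation A x"
        using B spA that by (intro representation_extend) auto
      then show ?thesis using b representation_ne_zero by (metis DiffD2)
    qed
    fix v
    let ?S = "{b. representation B v b \<noteq> 0}"
    have S: "?S \<subseteq> B" using representation_ne_zero by auto
    have fin: "finite ?S" by (rule finite_representation)
    have "v = (\<Sum>b\<in>?S. scale (representation B v b) b)"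
      using sum_nonzero_representation_eq[OF B(3)] UN by auto
    also have "\<dots> = (\<Sum>b\<in>?S \<inter> A. scale (representation B v b) b) + (\<Sum>b\<in>?S - A. scale (representation B v b) b)"
      using fin by (simp add: sum.Int_Diff)
    also have "(\<Sum>b\<in>?S - A. scale (representation B v b) b) = (\<Sum>b\<in>?E. scale (representation B v b) b)"
      using S finE by (intro sum.mono_neutral_left) auto
    finally have "v - (\<Sum>b\<in>?E. scale (representation B v b) b) = (\<Sum>b\<in>?S \<inter> A. scale (representation B v b) b)"
      by (rule iffD2[OF diff_eq_eq])
    also have "\<dots> \<in> I" using A(1) assms(1) by (intro subspace_sum subspace_scale) auto
    finally show "v - (\<Sum>b\<in>?E. scale (representation B v b) b) \<in> I" .
  qed
qed

text \<open>The version of linear dependence that is used below: the relation holds modulo \<open>I\<close>, and the elements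
  are given as a family, which need not be injective.\<close>

lemma nontrivial_relation_mod_subspace:
  assumes I: "subspace I" and fin: "finite T" "finite M" "card M < card T"
    and w: "\<And>t. t \<in> T \<Longrightarrow> \<exists>i\<in>I. \<exists>u\<in>span M. w t = u + i"
  obtains a where "\<exists>t\<in>T. a t \<noteq> 0" "(\<Sum>t\<in>T. scale (a t) (w t)) \<in> I"
proof -
  obtain u where u: "\<And>t. t \<in> T \<Longrightarrow> u t \<in> span M" "\<And>t. t \<in> T \<Longrightarrow> w t - u t \<in> I"
    using w by (metis add_diff_cancel_left')
  obtain a where a: "\<exists>t\<in>T. a t \<noteq> 0" "(\<Sum>t\<in>T. scale (a t) (u t)) = 0"
  proof (cases "inj_on u T")
    case True
    have "\<not> independent (u ` T)"
      using independent_span_bound[OF fin(2), of "u ` T"] u(1) fin card_image[OF True] by auto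
    then obtain f where "\<exists>v\<in>u ` T. f v \<noteq> 0" "(\<Sum>v\<in>u ` T. scale (f v) v) = 0"
      using dependent_finite[of "u ` T"] fin(1) by auto
    then show ?thesis using True by (intro that[of "\<lambda>t. f (u t)"]) (auto simp: sum.reindex)
  next
    case False
    then obtain x y where xy: "x \<in> T" "y \<in> T" "x \<noteq> y" "u x = u y" by (auto simp: inj_on_def)
    define a where "a z = (if z = x then 1 else if z = y then -1 else 0 :: 'a)" for z
    have "(\<Sum>z\<in>T. scale (a z) (u z)) = (\<Sum>z\<in>{x,y}. scale (a z) (u z))"
      using xy fin(1) by (intro sum.mono_neutral_right) (auto simp: a_def)
    also have "\<dots> = 0" using xy by (simp add: a_def)
    finally show ?thesis using xy by (intro that[of a]) (auto simp: a_def intro!: bexI[of _ x])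
  qed
  have "(\<Sum>t\<in>T. scale (a t) (w t)) = (\<Sum>t\<in>T. scale (a t) (u t)) + (\<Sum>t\<in>T. scale (a t) (w t - u t))"
    by (simp flip: sum.distrib add: scale_right_diff_distrib)
  also have "\<dots> \<in> I" using a(2) u(2) I by (auto intro!: subspace_sum subspace_scale)
  finally show ?thesis using that a(1) by blast
qed

end

interpretation mpoly_vs: vector_space_count "pscale :: 'k::field \<Rightarrow> ('v, 'k) mpoly \<Rightarrow> ('v, 'k) mpoly"
  ..

section \<open>Ideals of the polynomial ring\<close>

abbreviation is_ideal :: "'a::comm_ring_1 set \<Rightarrow> bool" where
  "is_ideal \<equiv> self_module.subspace"

lemmas is_idealD = self_module.subspace_0 self_module.subspace_add self_module.subspace_diff
  self_module.subspace_neg self_module.subspace_sum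

lemma is_ideal_mult: "is_ideal I \<Longrightarrow> x \<in> I \<Longrightarrow> a * x \<in> I"
  using self_module.subspace_scale .

lemma is_ideal_mult_right: "is_ideal I \<Longrightarrow> x \<in> I \<Longrightarrow> x * a \<in> I"
  by (simp add: mult.commute is_ideal_mult)

lemma is_ideal_subspace: "is_ideal I \<Longrightarrow> mpoly_vs.subspace I"
  by (auto simp: self_module.subspace_def mpoly_vs.subspace_def pscale_def)

lemma is_ideal_pscale: "is_ideal I \<Longrightarrow> x \<in> I \<Longrightarrow> pscale c x \<in> I"
  by (simp add: pscale_def is_ideal_mult)

lemma is_ideal_ideal_gen [simp]: "is_ideal (ideal_gen S)"
  by (simp add: ideal_gen_def self_module.subspace_span)

lemma ideal_gen_base: "x \<in> S \<Longrightarrow> x \<in> ideal_gen S"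
  by (simp add: ideal_gen_def self_module.span_base)

lemma ideal_gen_least: "S \<subseteq> I \<Longrightarrow> is_ideal I \<Longrightarrow> ideal_gen S \<subseteq> I"
  by (simp add: ideal_gen_def self_module.span_minimal)

lemma ideal_gen_image_iff:
  assumes "finite A"
  shows "p \<in> ideal_gen (c ` A) \<longleftrightarrow> (\<exists>a. p = (\<Sum>j\<in>A. a j * c j))"
proof
  let ?S = "{p. \<exists>a. p = (\<Sum>j\<in>A. a j * c j)}"
  have "is_ideal ?S"
  proof (rule self_module.subspaceI)
    show "0 \<in> ?S" by (auto intro!: exI[of _ "\<lambda>_. 0"])
    fix x y r assume "x \<in> ?S"
    then obtain a where a: "x = (\<Sum>j\<in>A. a j * c j)" by auto
    then show "r * x \<in> ?S"
      by (auto intro!: exI[of _ "\<lambda>j. r * a j"] simp: sum_distrib_left mult.assoc)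
    assume "y \<in> ?S"
    then obtain b where "y = (\<Sum>j\<in>A. b j * c j)" by auto
    then show "x + y \<in> ?S" using a
      by (auto intro!: exI[of _ "\<lambda>j. a j + b j"] simp: sum.distrib algebra_simps)
  qed
  moreover have "c ` A \<subseteq> ?S"
  proof safe
    fix i assume "i \<in> A"
    have "(\<Sum>j\<in>A. (if j = i then 1 else 0) * c j) = (\<Sum>j\<in>A. if j = i then c j else 0)"
      by (rule sum.cong) auto
    then show "\<exists>a. c i = (\<Sum>j\<in>A. a j * c j)"
      using assms \<open>i \<in> A\<close> by (intro exI[of _ "\<lambda>j. if j = i then 1 else 0"]) (simp add: sum.delta)
  qed
  ultimately show "p \<in> ideal_gen (c ` A) \<Longrightarrow> \<exists>a. p = (\<Sum>j\<in>A. a j * c j)"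
    using ideal_gen_least by blast
  show "p \<in> ideal_gen (c ` A)" if "\<exists>a. p = (\<Sum>j\<in>A. a j * c j)"
  proof -
    from that obtain a where "p = (\<Sum>j\<in>A. a j * c j)" by auto
    also have "\<dots> \<in> ideal_gen (c ` A)"
      by (intro is_idealD(5)[OF is_ideal_ideal_gen] is_ideal_mult[OF is_ideal_ideal_gen] ideal_gen_base imageI)
    finally show ?thesis .
  qed
qed

definition adjoin :: "'a::comm_ring_1 set \<Rightarrow> 'a \<Rightarrow> 'a set" where
  "adjoin I y = {i + h * y | i h. i \<in> I}"

lemma adjoinI: "i \<in> I \<Longrightarrow> i + h * y \<in> adjoin I y"
  by (auto simp: adjoin_def)

lemma is_ideal_adjoin:
  assumes "is_ideal I"
  shows "is_ideal (adjoin I y)"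
proof (rule self_module.subspaceI)
  show "0 \<in> adjoin I y"
    using adjoinI[OF is_idealD(1)[OF assms], of 0 y] by simp
  fix a b r assume "a \<in> adjoin I y"
  then obtain i h where a: "a = i + h * y" "i \<in> I" by (auto simp: adjoin_def)
  then show "r * a \<in> adjoin I y"
    using adjoinI[OF is_ideal_mult[OF assms], of i r "r * h" y] by (simp add: algebra_simps)
  assume "b \<in> adjoin I y"
  then obtain i' h' where "b = i' + h' * y" "i' \<in> I" by (auto simp: adjoin_def)
  then show "a + b \<in> adjoin I y"
    using adjoinI[OF is_idealD(2)[OF assms], of i i' "h + h'" y] a by (simp add: algebra_simps)
qed

lemma adjoin_superset: "I \<subseteq> adjoin I y"
  using adjoinI[of _ I 0 y] by auto

lemma adjoin_self: "is_ideal I \<Longrightarrow> y \<in> adjoin I y"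
  using adjoinI[OF is_idealD(1), of I 1 y] by simp

definition homogeneous :: "('v, 'k::comm_ring_1) mpoly set \<Rightarrow> bool" where
  "homogeneous I \<longleftrightarrow> (\<forall>p\<in>I. \<forall>m. hom_part m p \<in> I)"

lemma homogeneous_ideal_gen:
  fixes S :: "('v, 'k::comm_ring_1) mpoly set"
  assumes "\<And>s. s \<in> S \<Longrightarrow> \<exists>q. s \<in> forms q"
  shows "homogeneous (ideal_gen S)"
  unfolding homogeneous_def
proof safe
  fix p m assume "p \<in> ideal_gen S"
  then show "hom_part m p \<in> ideal_gen S"
    unfolding ideal_gen_def
  proof (induction rule: self_module.span_induct_alt)
    case (step c x y)
    obtain q where "x \<in> forms q" using assms step by auto
    then have "hom_part m (c * x) \<in> self_module.span S"
      using is_ideal_mult[OF self_module.subspace_span self_module.span_base[OF step(1)]]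
      by (auto simp: hom_part_mult_form is_idealD(1)[OF self_module.subspace_span])
    then show ?case using step by (simp add: hom_part_add self_module.span_add)
  qed (simp add: self_module.span_zero)
qed

lemma homogeneous_adjoin:
  assumes "is_ideal I" "homogeneous I" "y \<in> forms q"
  shows "homogeneous (adjoin I y)"
  unfolding homogeneous_def
proof safe
  fix p m assume "p \<in> adjoin I y"
  then obtain i h where p: "p = i + h * y" "i \<in> I" by (auto simp: adjoin_def)
  have "hom_part m i \<in> adjoin I y"
    using assms(2) p adjoin_superset[of I y] by (auto simp: homogeneous_def)
  moreover have "hom_part m (h * y) \<in> adjoin I y"
    using is_ideal_mult[OF is_ideal_adjoin adjoin_self] is_idealD(1)[OF is_ideal_adjoin] assms
    by (auto simp: hom_part_mult_form)
  ultimately show "hom_part m p \<in> adjoin I y"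
    using is_idealD(2)[OF is_ideal_adjoin[OF assms(1)]] p by (simp add: hom_part_add)
qed

text \<open>A representation of a form remains valid when its coefficients are replaced by their homogeneous
  components of the matching degrees.\<close>

lemma form_in_ideal_gen:
  fixes c :: "'a \<Rightarrow> ('v, 'k::comm_ring_1) mpoly"
  assumes "finite A" "\<And>j. j \<in> A \<Longrightarrow> c j \<in> forms (e j)" "p \<in> ideal_gen (c ` A)" "p \<in> forms q"
  obtains a where "p = (\<Sum>j\<in>A. a j * c j)" "\<And>j. a j \<in> forms (q - e j)" "\<And>j. q < e j \<Longrightarrow> a j = 0"
proof -
  obtain b where b: "p = (\<Sum>j\<in>A. b j * c j)"
    using assms(3) ideal_gen_image_iff[OF assms(1)] by blast
  define a where "a j = (if e j \<le> q then hom_part (q - e j) (b j) else 0)" for j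
  have "p = hom_part q p" using assms(4) by (simp add: hom_part_form)
  also have "\<dots> = (\<Sum>j\<in>A. hom_part q (b j * c j))" by (subst b) (simp add: hom_part_sum)
  also have "\<dots> = (\<Sum>j\<in>A. a j * c j)"
    by (intro sum.cong) (auto simp: a_def hom_part_mult_form[OF assms(2)])
  finally show ?thesis by (intro that[of a]) (auto simp: a_def)
qed

lemma form_in_adjoin:
  assumes "homogeneous I" "y \<in> forms e" "p \<in> adjoin I y" "p \<in> forms q"
  obtains i h where "p = i + h * y" "i \<in> I" "i \<in> forms q" "h \<in> forms (q - e)" "q < e \<Longrightarrow> h = 0"
proof -
  obtain i0 h0 where p: "p = i0 + h0 * y" "i0 \<in> I" using assms(3) by (auto simp: adjoin_def)
  define h where "h = (if e \<le> q then hom_part (q - e) h0 else 0)"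
  have "p = hom_part q p" using assms(4) by (simp add: hom_part_form)
  also have "\<dots> = hom_part q i0 + h * y"
    using assms(2) by (subst p(1)) (auto simp: hom_part_add h_def hom_part_mult_form)
  finally show ?thesis
    using assms(1) p(2) by (intro that[of "hom_part q i0" h]) (auto simp: h_def homogeneous_def)
qed

subsection \<open>Ideals that contain all forms of large degree\<close>

text \<open>For a homogeneous ideal this means that its radical contains the irrelevant ideal.\<close>

definition irrelevant_primary :: "('v, 'k::comm_ring_1) mpoly set \<Rightarrow> bool" where
  "irrelevant_primary I \<longleftrightarrow> (\<exists>N. \<forall>q\<ge>N. forms q \<subseteq> I)"

lemma form_Suc_decomposition:
  fixes p :: "('v::finite, 'k::comm_ring_1) mpoly"
  assumes "p \<in> forms (Suc q)"
  obtains g where "p = (\<Sum>i\<in>UNIV. g i * Var i)" "\<And>i. g i \<in> forms q"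
proof -
  have "p \<in> ideal_gen (range Var)"
  proof -
    have "Poly_Mapping.single \<alpha> c \<in> ideal_gen (range Var)" if "mdeg \<alpha> = Suc q" for \<alpha> :: "'v \<Rightarrow>\<^sub>0 nat" and c :: 'k
    proof -
      have "\<alpha> \<noteq> 0" using that by auto
      then obtain i where "Poly_Mapping.lookup \<alpha> i > 0"
        by (metis gr0I lookup_zero poly_mapping_eqI)
      then obtain \<beta> where "\<alpha> = Poly_Mapping.single i 1 + \<beta>" using exponent_pred by metis
      then have "Poly_Mapping.single \<alpha> c = Poly_Mapping.single \<beta> c * Var i"
        by (simp add: Var_def mult_single add.commute)
      then show ?thesis by (metis ideal_gen_base is_ideal_ideal_gen is_ideal_mult rangeI)
    qed
    then show ?thesis
      by (subst form_eq_sum_single[OF assms]) (auto intro: is_idealD(5))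
  qed
  from finite_class.finite_UNIV Var_in_forms this assms show ?thesis
  proof (rule form_in_ideal_gen)
    fix a assume "p = (\<Sum>j\<in>UNIV. a j * Var j)" "\<And>j. a j \<in> forms (Suc q - 1)"
    then show ?thesis using that[of a] by simp
  qed
qed

lemma forms_subset_ideal_mono:
  fixes I :: "('v::finite, 'k::comm_ring_1) mpoly set"
  assumes "is_ideal I" "forms N \<subseteq> I" "N \<le> q"
  shows "forms q \<subseteq> I"
  using assms(3)
proof (induction q rule: dec_induct)
  case (step q)
  show ?case
  proof
    fix p :: "('v, 'k) mpoly" assume "p \<in> forms (Suc q)"
    then obtain g where "p = (\<Sum>i\<in>UNIV. g i * Var i)" "\<And>i. g i \<in> forms q"
      using form_Suc_decomposition by metis
    then show "p \<in> I"
      using step assms(1) by (auto intro!: is_idealD(5) is_ideal_mult_right)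
  qed
qed (rule assms(2))

lemma irrelevant_primaryI:
  fixes I :: "('v::finite, 'k::comm_ring_1) mpoly set"
  assumes "is_ideal I" "forms N \<subseteq> I"
  shows "irrelevant_primary I"
  unfolding irrelevant_primary_def using forms_subset_ideal_mono[OF assms] by blast

lemma irrelevant_primary_Var_power:
  fixes I :: "('v::finite, 'k::comm_ring_1) mpoly set"
  assumes I: "is_ideal I" and pow: "\<And>i. \<exists>N. Var i ^ N \<in> I"
  shows "irrelevant_primary I"
proof -
  obtain N where N: "\<And>i. Var i ^ N i \<in> I" using pow by metis
  have "forms (\<Sum>i\<in>UNIV. N i) \<subseteq> I"
  proof
    fix p :: "('v, 'k) mpoly" assume p: "p \<in> forms (\<Sum>i\<in>UNIV. N i)"
    have "Poly_Mapping.single \<alpha> c \<in> I" if \<alpha>: "mdeg \<alpha> = (\<Sum>i\<in>UNIV. N i)" for \<alpha> :: "'v \<Rightarrow>\<^sub>0 nat" and c :: 'k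
    proof -
      obtain i where i: "N i \<le> Poly_Mapping.lookup \<alpha> i"
      proof (rule ccontr)
        assume "\<not> thesis"
        then have "\<And>i. Poly_Mapping.lookup \<alpha> i < N i" using that by (meson not_le)
        then have "(\<Sum>i\<in>UNIV. Poly_Mapping.lookup \<alpha> i) < (\<Sum>i\<in>UNIV. N i)"
          by (intro sum_strict_mono) auto
        then show False using \<alpha> by (simp add: mdeg_UNIV)
      qed
      have "\<alpha> = (\<alpha> - Poly_Mapping.single i (N i)) + Poly_Mapping.single i (N i)"
        using i by (intro poly_mapping_eqI) (auto simp: lookup_add lookup_minus lookup_single when_def)
      then have "Poly_Mapping.single \<alpha> c = Poly_Mapping.single (\<alpha> - Poly_Mapping.single i (N i)) c * Var i ^ N i"
        by (metis Var_power mult.right_neutral mult_single)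
      then show ?thesis using N is_ideal_mult[OF I] by simp
    qed
    then show "p \<in> I" by (subst form_eq_sum_single[OF p]) (auto intro: is_idealD(5)[OF I])
  qed
  then show ?thesis by (rule irrelevant_primaryI[OF I])
qed

lemma fin_dim_forms: "mpoly_vs.fin_dim (forms q :: ('v::finite, 'k::field) mpoly set)"
  unfolding mpoly_vs.fin_dim_def by (subst forms_span_monomials) (use finite_exponents_mdeg in blast)

lemma fin_dim_subset_forms: "V \<subseteq> forms q \<Longrightarrow> mpoly_vs.fin_dim V"
  for V :: "('v::finite, 'k::field) mpoly set"
  using mpoly_vs.fin_dim_subset[OF fin_dim_forms] .

lemma subspace_ideal_forms: "is_ideal I \<Longrightarrow> mpoly_vs.subspace (I \<inter> forms q)"
  by (intro mpoly_vs.subspace_inter is_ideal_subspace subspace_forms)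

text \<open>A multiple of \<open>h\<close> by a form of the largest degree that does not lead into \<open>I\<close> is annihilated by all
  variables modulo \<open>I\<close>: it represents a nonzero element of the socle of the quotient.\<close>

lemma socle_multiple:
  fixes I :: "('v::finite, 'k::comm_ring_1) mpoly set"
  assumes I: "is_ideal I" "irrelevant_primary I" and h: "h \<notin> I" "h \<in> forms q"
  obtains p r where "p \<in> forms r" "p * h \<notin> I" "\<And>i. Var i * (p * h) \<in> I"
proof -
  obtain N where N: "\<And>q. q \<ge> N \<Longrightarrow> forms q \<subseteq> I" using I(2) by (auto simp: irrelevant_primary_def)
  let ?P = "\<lambda>r. \<exists>p\<in>forms r. p * h \<notin> I"
  have "?P 0" using h(1) by (intro bexI[of _ 1]) auto
  moreover have "r \<le> N" if "?P r" for r
  proof (rule ccontr)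
    assume "\<not> r \<le> N"
    then show False using that N[of "r + q"] forms_mult[OF _ h(2)] by fastforce
  qed
  ultimately obtain r where r: "?P r" "\<And>r'. ?P r' \<Longrightarrow> r' \<le> r"
    using Nat.ex_has_greatest_nat[of ?P 0 N] by blast
  then obtain p where p: "p \<in> forms r" "p * h \<notin> I" by auto
  show ?thesis
  proof (rule that[OF p])
    fix i
    have "Var i * p \<in> forms (1 + r)" using p(1) by (intro forms_mult) auto
    then have "(Var i * p) * h \<in> I" using r(2)[of "1 + r"] by auto
    then show "Var i * (p * h) \<in> I" by (simp add: mult.assoc)
  qed
qed

section \<open>The projective Nullstellensatz\<close>

lemma is_ideal_pscale_iff:
  fixes c :: "'k::field"
  assumes "is_ideal I" "c \<noteq> 0"
  shows "pscale c x \<in> I \<longleftrightarrow> x \<in> I"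
  using is_ideal_pscale[OF assms(1), of "pscale c x" "1 / c"] is_ideal_pscale[OF assms(1), of x c] assms(2)
  by auto

text \<open>The homogenisation of \<open>P\<close> in degree \<open>q\<close>, evaluated at \<open>x\<close> and \<open>y\<close>.\<close>

definition binary_form :: "('v, 'k) mpoly \<Rightarrow> ('v, 'k) mpoly \<Rightarrow> 'k::field poly \<Rightarrow> nat \<Rightarrow> ('v, 'k) mpoly" where
  "binary_form x y P q = (\<Sum>t\<le>q. pscale (coeff P t) (x ^ t * y ^ (q - t)))"

lemma binary_form_pad:
  assumes "degree P \<le> q"
  shows "binary_form x y P (q + b) = y ^ b * binary_form x y P q"
proof -
  have "binary_form x y P (q + b) = (\<Sum>t\<le>q. pscale (coeff P t) (x ^ t * y ^ (q + b - t)))"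
    unfolding binary_form_def using assms
    by (intro sum.mono_neutral_right) (auto simp: coeff_eq_0)
  also have "\<dots> = (\<Sum>t\<le>q. y ^ b * pscale (coeff P t) (x ^ t * y ^ (q - t)))"
    by (intro sum.cong)
      (auto simp: pscale_mult_right mult.left_commute power_add[symmetric] algebra_simps)
  finally show ?thesis by (simp add: binary_form_def sum_distrib_left)
qed

lemma binary_form_linear_factor:
  assumes "degree Q \<le> q"
  shows "binary_form x y ([:-z, 1:] * Q) (Suc q) = (x - pscale z y) * binary_form x y Q q"
proof -
  let ?F = "\<lambda>c t. pscale c (x ^ t * y ^ (Suc q - t))"
  have y: "y * binary_form x y Q q = (\<Sum>t\<le>Suc q. ?F (coeff Q t) t)"
    using binary_form_pad[OF assms, of x y 1] by (simp add: binary_form_def)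
  have x: "x * binary_form x y Q q = (\<Sum>t\<le>q. ?F (coeff Q t) (Suc t))"
    by (simp add: binary_form_def sum_distrib_left pscale_mult_right mult.assoc)
  have coeff: "coeff ([:-z, 1:] * Q) t = (case t of 0 \<Rightarrow> 0 | Suc t' \<Rightarrow> coeff Q t') - z * coeff Q t" for t
    by (cases t) (auto simp: coeff_pCons)
  have "binary_form x y ([:-z, 1:] * Q) (Suc q) =
     (\<Sum>t\<le>Suc q. ?F (case t of 0 \<Rightarrow> 0 | Suc t' \<Rightarrow> coeff Q t') t) - (\<Sum>t\<le>Suc q. ?F (z * coeff Q t) t)"
    unfolding binary_form_def coeff by (simp only: mpoly_vs.scale_left_diff_distrib sum_subtractf)
  also have "(\<Sum>t\<le>Suc q. ?F (case t of 0 \<Rightarrow> 0 | Suc t' \<Rightarrow> coeff Q t') t) = (\<Sum>t\<le>q. ?F (coeff Q t) (Suc t))"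
    by (subst sum.atMost_Suc_shift) simp
  also have "(\<Sum>t\<le>Suc q. ?F (z * coeff Q t) t) = pscale z (\<Sum>t\<le>Suc q. ?F (coeff Q t) t)"
    by (simp only: mpoly_vs.scale_sum_right mpoly_vs.scale_scale)
  finally show ?thesis
    by (simp only: x[symmetric] y[symmetric] left_diff_distrib pscale_mult_left)
qed

text \<open>
  A binary form in \<open>x\<close> and \<open>y\<close> that lies in \<open>L\<close> splits into linear factors. If \<open>L\<close> contained a power of
  \<open>y\<close> after adding any one of them, then the product of these powers would lie in \<open>L\<close> itself.
\<close>

lemma proper_linear_factor:
  fixes P :: "'k::alg_closed_field poly" and L :: "('v, 'k) mpoly set"
  assumes "is_ideal L" "\<And>b. y ^ b \<notin> L" "P \<noteq> 0" "degree P \<le> q" "binary_form x y P q \<in> L"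
  shows "\<exists>z. \<forall>b. y ^ b \<notin> adjoin L (x - pscale z y)"
  using assms(3-5)
proof (induction "degree P" arbitrary: P q)
  case 0
  then obtain c where c: "P = [:c:]" "c \<noteq> 0" by (metis degree_eq_zeroE pCons_0_0)
  have "binary_form x y P q = pscale c (y ^ q)"
    using binary_form_pad[of P 0 x y q] c by (simp add: binary_form_def pscale_mult_right)
  then have "y ^ q \<in> L" using 0(4) is_ideal_pscale_iff[OF assms(1) c(2)] by simp
  then show ?case using assms(2) by blast
next
  case (Suc n)
  obtain z where "poly P z = 0"
    using alg_closed_imp_poly_has_root[of P] Suc by auto
  then obtain Q where Q: "P = [:-z, 1:] * Q" by (metis dvdE poly_eq_0_iff_dvd)
  then have Q0: "Q \<noteq> 0" using Suc by auto
  have degQ: "n = degree Q"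
  proof -
    have "degree ([:-z, 1:] * Q) = 1 + degree Q" using Q0 by (subst degree_mult_eq) auto
    then show ?thesis using Suc(2) Q by simp
  qed
  obtain q' where q': "q = Suc q'" "degree Q \<le> q'"
    using Suc(2,4) degQ by (cases q) auto
  have bin: "(x - pscale z y) * binary_form x y Q q' \<in> L"
    using Suc(5) unfolding Q q'(1) binary_form_linear_factor[OF q'(2)] .
  show ?case
  proof (cases "\<forall>b. y ^ b \<notin> adjoin L (x - pscale z y)")
    case False
    then obtain b l h where b: "y ^ b = l + h * (x - pscale z y)" "l \<in> L" by (auto simp: adjoin_def)
    have "y ^ b * binary_form x y Q q' =
        binary_form x y Q q' * l + h * ((x - pscale z y) * binary_form x y Q q')"
      by (simp add: b(1) algebra_simps)
    also have "\<dots> \<in> L"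
      by (intro is_idealD(2)[OF assms(1)] is_ideal_mult[OF assms(1)] b(2) bin)
    finally have "binary_form x y Q (q' + b) \<in> L" by (simp add: binary_form_pad[OF q'(2)])
    with Suc(1)[OF degQ Q0 trans_le_add1[OF q'(2)]] show ?thesis .
  qed blast
qed

lemma proper_linear_factors:
  fixes L :: "('v, 'k::alg_closed_field) mpoly set"
  assumes "is_ideal L" "\<And>b. y ^ b \<notin> L" "finite S"
    and "\<And>j. j \<in> S \<Longrightarrow> \<exists>P q. P \<noteq> 0 \<and> degree P \<le> q \<and> binary_form (x j) y P q \<in> L"
  shows "\<exists>z L'. is_ideal L' \<and> L \<subseteq> L' \<and> (\<forall>b. y ^ b \<notin> L') \<and> (\<forall>j\<in>S. x j - pscale (z j) y \<in> L')"
  using assms(3,4)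
proof induction
  case empty
  then show ?case using assms by auto
next
  case (insert j S)
  obtain z L' where L': "is_ideal L'" "L \<subseteq> L'" "\<And>b. y ^ b \<notin> L'" "\<And>j. j \<in> S \<Longrightarrow> x j - pscale (z j) y \<in> L'"
    using insert by force
  obtain P q where P: "P \<noteq> 0" "degree P \<le> q" "binary_form (x j) y P q \<in> L'"
    using insert.prems[of j] L'(2) by (metis insertI1 subsetD)
  obtain zj where zj: "\<And>b. y ^ b \<notin> adjoin L' (x j - pscale zj y)"
    using proper_linear_factor[OF L'(1,3) P] by metis
  show ?case
  proof (intro exI[of _ "z(j := zj)"] exI[of _ "adjoin L' (x j - pscale zj y)"] conjI ballI allI)
    show "L \<subseteq> adjoin L' (x j - pscale zj y)" using L'(2) adjoin_superset by blast
    fix i assume "i \<in> insert j S"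
    then show "x i - pscale ((z(j := zj)) i) y \<in> adjoin L' (x j - pscale zj y)"
      using L'(1,4) adjoin_superset adjoin_self insert(2) by (cases "i = j") auto
  qed (use zj L'(1) is_ideal_adjoin in auto)
qed

lemma form_0_eq_Const:
  fixes p :: "('v::finite, 'k::comm_ring_1) mpoly"
  assumes "p \<in> forms 0"
  shows "p = Const (eval_at v p)"
proof -
  have "p = Const (Poly_Mapping.lookup p 0)"
    using form_eq_sum_single[OF assms] by (simp add: mdeg_eq_0_iff Const_def)
  then show ?thesis by (metis eval_at_Const)
qed

text \<open>Modulo the ideal of the point \<open>z\<close>, with \<open>y\<close> as homogenising coordinate, a form is its value at \<open>z\<close>.\<close>

lemma form_cong_value:
  fixes p :: "('v::finite, 'k::field) mpoly"
  assumes L: "is_ideal L" "\<And>j. Var j - pscale (z j) y \<in> L" and "p \<in> forms s"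
  shows "p - pscale (eval_at z p) (y ^ s) \<in> L"
  using assms(3)
proof (induction s arbitrary: p)
  case 0
  then have "p = pscale (eval_at z p) (y ^ 0)" using form_0_eq_Const by (simp add: pscale_def)
  then show ?case using is_idealD(1)[OF L(1)] by simp
next
  case (Suc s)
  obtain g where g: "p = (\<Sum>i\<in>UNIV. g i * Var i)" "\<And>i. g i \<in> forms s"
    using form_Suc_decomposition[OF Suc(2)] by metis
  have *: "g i * Var i - pscale (eval_at z (g i) * z i) (y ^ Suc s) \<in> L" for i
  proof -
    have "g i * Var i - pscale (eval_at z (g i) * z i) (y ^ Suc s) =
        Var i * (g i - pscale (eval_at z (g i)) (y ^ s)) +
        pscale (eval_at z (g i)) (y ^ s) * (Var i - pscale (z i) y)"
      by (simp add: algebra_simps pscale_mult_right pscale_mult_left)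
    also have "\<dots> \<in> L"
      by (intro is_idealD(2)[OF L(1)] is_ideal_mult[OF L(1)] Suc.IH g(2) L(2))
    finally show ?thesis .
  qed
  have "p - pscale (eval_at z p) (y ^ Suc s) =
      (\<Sum>i\<in>UNIV. g i * Var i - pscale (eval_at z (g i) * z i) (y ^ Suc s))"
    by (simp add: g(1) eval_at_sum sum_subtractf mpoly_vs.scale_sum_left)
  also have "\<dots> \<in> L" by (intro is_idealD(5)[OF L(1)] *)
  finally show ?case .
qed

lemma ideal_power_cong:
  assumes I: "is_ideal I" and "a - b \<in> I"
  shows "a ^ n - b ^ n \<in> I"
proof (induction n)
  case (Suc n)
  have "a ^ Suc n - b ^ Suc n = a * (a ^ n - b ^ n) + b ^ n * (a - b)"
    by (simp add: algebra_simps)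
  also have "\<dots> \<in> I" by (intro is_idealD(2)[OF I] is_ideal_mult[OF I] Suc assms(2))
  finally show ?case .
qed (use is_idealD(1)[OF I] in simp)

text \<open>From degree \<open>N\<close> on a form is a multiple of \<open>y\<close> modulo \<open>K\<close>, and the cofactor is again such a form as long
  as its degree is at least \<open>N\<close>.\<close>

lemma form_reduce_adjoin:
  assumes K: "is_ideal K" "homogeneous K" and y: "y \<in> forms 1"
    and N: "\<And>q. q \<ge> N \<Longrightarrow> forms q \<subseteq> adjoin K y" and "p \<in> forms (N + t)"
  shows "\<exists>k\<in>K. \<exists>w\<in>forms N. p = y ^ t * w + k"
  using assms(5)
proof (induction t arbitrary: p)
  case 0
  then show ?case using is_idealD(1)[OF K(1)] by (intro bexI[of _ 0] bexI[of _ p]) auto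
next
  case (Suc t)
  have p: "p \<in> adjoin K y" using N[of "N + Suc t"] Suc(2) by auto
  obtain k h where kh: "p = k + h * y" "k \<in> K" "h \<in> forms (N + Suc t - 1)"
    using form_in_adjoin[OF K(2) y p Suc(2)] by metis
  obtain k' w where w: "k' \<in> K" "w \<in> forms N" "h = y ^ t * w + k'" using Suc.IH[of h] kh(3) by auto
  have "p = y ^ Suc t * w + (y * k' + k)" by (simp add: kh(1) w(3) algebra_simps)
  then show ?case using w kh(2) K(1) by (blast intro: is_idealD(2) is_ideal_mult)
qed

text \<open>
  Add variables to \<open>K\<close> until all forms of large degree are contained, and stop just before the last
  one, \<open>y\<close>. The resulting ideal \<open>K'\<close> contains no power of \<open>y\<close>, but modulo \<open>K'\<close> all forms of large
  degree \<open>q\<close> are multiples of \<open>y\<^sup>q\<^sup>-\<^sup>N\<close>, so they span a space of bounded dimension. Hence for each \<open>j\<close>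
  some nonzero binary form in the variable \<open>j\<close> and \<open>y\<close> lies in \<open>K'\<close>. Its linear factors supply the
  coordinates of a zero of \<open>K\<close> with \<open>y = 1\<close>.
\<close>

lemma projective_nullstellensatz:
  fixes K :: "('v::finite, 'k::alg_closed_field) mpoly set"
  assumes K: "is_ideal K" "homogeneous K" 
    and zero: "\<And>v. (\<And>g. g \<in> K \<Longrightarrow> eval_at v g = 0) \<Longrightarrow> v = (\<lambda>_. 0)"
  shows "irrelevant_primary K"
proof (rule ccontr)
  assume not_primary: "\<not> irrelevant_primary K"
  have Kgen: "ideal_gen K = K" using ideal_gen_least[OF order_refl K(1)] ideal_gen_base by blast
  let ?A = "\<lambda>Y. ideal_gen (K \<union> Var ` Y)"
  have hom: "homogeneous (?A Y)" for Y
  proof -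
    let ?S = "(\<Union>m. hom_part m ` K) \<union> Var ` Y"
    have "ideal_gen ?S = ?A Y"
    proof (intro equalityI ideal_gen_least)
      show "?S \<subseteq> ?A Y" using K(2) by (auto simp: homogeneous_def intro: ideal_gen_base)
      have "p \<in> ideal_gen ?S" if "p \<in> K" for p
      proof -
        obtain B where B: "p = (\<Sum>m\<le>B. hom_part m p)" by (rule sum_hom_part_obtain)
        show ?thesis
          by (subst B, rule is_idealD(5)[OF is_ideal_ideal_gen])
          (use that in \<open>auto intro: ideal_gen_base\<close>)
      qed
      then show "K \<union> Var ` Y \<subseteq> ideal_gen ?S" by (auto intro: ideal_gen_base)
    qed auto
    moreover have "homogeneous (ideal_gen ?S)"
      by (rule homogeneous_ideal_gen) (auto intro: hom_part_in_forms Var_in_forms)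
    ultimately show ?thesis by simp
  qed
  have "irrelevant_primary (?A UNIV)"
    by (rule irrelevant_primary_Var_power) (auto intro!: exI[of _ 1] ideal_gen_base)
  then obtain Y where Y: "irrelevant_primary (?A Y)"
    "\<And>Y'. irrelevant_primary (?A Y') \<Longrightarrow> card Y \<le> card Y'"
    using ex_has_least_nat[of "\<lambda>Y. irrelevant_primary (?A Y)" UNIV card] by blast
  have "Y \<noteq> {}" using Y(1) not_primary Kgen by auto
  then obtain i where i: "i \<in> Y" by auto
  define K' where "K' = ?A (Y - {i})"
  define y where "y = (Var i :: ('v, 'k) mpoly)"
  have K': "is_ideal K'" "homogeneous K'" "K \<subseteq> K'"
    using hom by (auto simp: K'_def intro: ideal_gen_base)
  have not_primary': "\<not> irrelevant_primary K'"
  proof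
    assume "irrelevant_primary K'"
    then have "card Y \<le> card (Y - {i})" unfolding K'_def by (rule Y(2))
    then show False using card_Diff1_less[of Y i] i by simp
  qed
  have "?A Y \<subseteq> adjoin K' y"
  proof (rule ideal_gen_least[OF _ is_ideal_adjoin[OF K'(1)]])
    have "K \<union> Var ` (Y - {i}) \<subseteq> K'" unfolding K'_def by (auto intro: ideal_gen_base)
    also have "\<dots> \<subseteq> adjoin K' y" by (rule adjoin_superset)
    moreover have "Var i \<in> adjoin K' y" using adjoin_self[OF K'(1), of y] by (simp add: y_def)
    ultimately show "K \<union> Var ` Y \<subseteq> adjoin K' y" by fast
  qed
  then obtain N where N: "\<And>q. q \<ge> N \<Longrightarrow> forms q \<subseteq> adjoin K' y"
    using Y(1) unfolding irrelevant_primary_def by blast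
  have no_power: "y ^ a \<notin> K'" for a
  proof
    assume a: "y ^ a \<in> K'"
    have "Var j ^ (N * a) \<in> K'" for j
    proof -
      have "Var j ^ N \<in> adjoin K' y" using N[of N] forms_power[OF Var_in_forms, of j N] by auto
      then obtain k h where "Var j ^ N = k + h * y" "k \<in> K'" by (auto simp: adjoin_def)
      then have "(Var j ^ N) ^ a - (h * y) ^ a \<in> K'" by (intro ideal_power_cong[OF K'(1)]) auto
      moreover have "(h * y) ^ a \<in> K'" using a is_ideal_mult[OF K'(1)] by (simp add: power_mult_distrib)
      ultimately show ?thesis using is_idealD(2)[OF K'(1)] by (fastforce simp: power_mult)
    qed
    then show False using irrelevant_primary_Var_power[OF K'(1)] not_primary' by blast
  qed
  have red: "\<exists>k\<in>K'. \<exists>w\<in>forms N. p = y ^ t * w + k" if "p \<in> forms (N + t)" for p t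
    using K'(1,2) _ N that by (rule form_reduce_adjoin) (simp add: y_def)
  let ?M = "(\<lambda>\<alpha>. Poly_Mapping.single \<alpha> 1) ` {\<alpha>. mdeg \<alpha> = N} :: ('v, 'k) mpoly set"
  define D where "D = card ?M"
  have finM: "finite ?M" using finite_exponents_mdeg by blast
  have rel: "\<exists>P q. P \<noteq> 0 \<and> degree P \<le> q \<and> binary_form (Var j) y P q \<in> K'" for j
  proof -
    let ?q = "N + D" and ?M' = "(\<lambda>u. y ^ D * u) ` ?M"
    have "\<exists>k\<in>K'. \<exists>u\<in>mpoly_vs.span ?M'. Var j ^ t * y ^ (?q - t) = u + k" if "t \<in> {..?q}" for t
    proof -
      have "Var j ^ t * y ^ (?q - t) \<in> forms (t * 1 + (?q - t) * 1)"
        unfolding y_def by (intro forms_mult forms_power Var_in_forms)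
      then have "Var j ^ t * y ^ (?q - t) \<in> forms (N + D)" using that by simp
      then obtain k w where kw: "k \<in> K'" "w \<in> forms N" "Var j ^ t * y ^ (?q - t) = y ^ D * w + k"
        using red by blast
      have "w \<in> mpoly_vs.span ?M" using kw(2) forms_span_monomials by blast
      then have "y ^ D * w \<in> mpoly_vs.span ?M'"
      proof (induction rule: mpoly_vs.span_induct_alt)
        case (step c x w)
        show ?case
          unfolding distrib_left pscale_mult_right
          by (intro mpoly_vs.span_add mpoly_vs.span_scale mpoly_vs.span_base imageI step)
      qed (simp add: mpoly_vs.span_zero)
      then show ?thesis using kw by blast
    qed
    moreover have "card ?M' < card {..?q}"
      using card_image_le[OF finM, of "\<lambda>u. y ^ D * u"] unfolding D_def[symmetric] by simp
    ultimately obtain a where a: "\<exists>t\<in>{..?q}. a t \<noteq> 0"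
      "(\<Sum>t\<in>{..?q}. pscale (a t) (Var j ^ t * y ^ (?q - t))) \<in> K'"
      using mpoly_vs.nontrivial_relation_mod_subspace[OF is_ideal_subspace[OF K'(1)],
          of "{..?q}" ?M' "\<lambda>t. Var j ^ t * y ^ (?q - t)"] finM by blast
    define P where "P = (\<Sum>t\<le>?q. monom (a t) t)"
    have coeff: "coeff P t = (if t \<le> ?q then a t else 0)" for t
      by (auto simp: P_def coeff_sum coeff_monom sum.delta')
    have "P \<noteq> 0" using a(1) coeff by (metis atMost_iff coeff_0)
    moreover have "degree P \<le> ?q" by (rule degree_le) (simp add: coeff)
    moreover have "binary_form (Var j) y P ?q \<in> K'"
      using a(2) by (simp add: binary_form_def coeff)
    ultimately show ?thesis by blast
  qed
  obtain z L where L: "is_ideal L" "K' \<subseteq> L" "\<And>b. y ^ b \<notin> L" "\<And>j. Var j - pscale (z j) y \<in> L"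
    using proper_linear_factors[OF K'(1) no_power finite_class.finite_UNIV, of Var] rel by force
  have "eval_at z g = 0" if g: "g \<in> K" for g
  proof -
    have "eval_at z (hom_part s g) = 0" for s
    proof (rule ccontr)
      assume nz: "eval_at z (hom_part s g) \<noteq> 0"
      have "hom_part s g \<in> L" using K(2) g K'(3) L(2) by (auto simp: homogeneous_def)
      then have "hom_part s g - (hom_part s g - pscale (eval_at z (hom_part s g)) (y ^ s)) \<in> L"
        by (intro is_idealD(3)[OF L(1)] form_cong_value[OF L(1,4)] hom_part_in_forms)
      then show False using L(3)[of s] is_ideal_pscale_iff[OF L(1) nz] by simp
    qed
    moreover obtain B where "g = (\<Sum>m\<le>B. hom_part m g)" by (rule sum_hom_part_obtain)
    ultimately show ?thesis by (metis eval_at_sum sum.neutral)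
  qed
  then have "z i = 0" using zero[of z] by simp
  then have "y ^ 1 \<in> L" using L(4)[of i] by (simp add: y_def)
  then show False using L(3) by blast
qed

section \<open>Determinants over a commutative ring\<close>

definition mdet :: "('n::finite \<Rightarrow> 'n \<Rightarrow> 'a::comm_ring_1) \<Rightarrow> 'a" where
  "mdet A = (\<Sum>p | p permutes UNIV. of_int (sign p) * (\<Prod>i\<in>UNIV. A i (p i)))"

lemma mdet_eq_det: "mdet A = Determinants.det (\<chi> i j. A i j)"
  by (simp add: mdet_def Determinants.det_def)

lemma mdet_mult: "mdet (\<lambda>i j. \<Sum>l\<in>UNIV. A i l * B l j) = mdet A * mdet B"
  unfolding mdet_eq_det det_mul[symmetric] matrix_matrix_mult_def by simp

lemma mdet_transpose: "mdet (\<lambda>i j. A j i) = mdet A"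
  using Determinants.det_transpose[of "\<chi> i j. A i j"] by (simp add: mdet_eq_det Finite_Cartesian_Product.transpose_def)

lemma mdet_diag: "mdet (\<lambda>i j. if j = i then d i else 0) = (\<Prod>i\<in>UNIV. d i)"
  unfolding mdet_eq_det by (subst det_diagonal) auto

lemma mdet_identical_rows: "k \<noteq> l \<Longrightarrow> A k = A l \<Longrightarrow> mdet A = 0"
  unfolding mdet_eq_det by (rule det_identical_rows[of k l]) (auto simp: row_def)

lemma mdet_hom:
  fixes A :: "'n::finite \<Rightarrow> 'n \<Rightarrow> 'a::comm_ring_1" and h :: "'a \<Rightarrow> 'b::comm_ring_1"
  assumes "h 0 = 0" "h 1 = 1" "\<And>a b. h (a + b) = h a + h b" "\<And>a b. h (a * b) = h a * h b"
  shows "h (mdet A) = mdet (\<lambda>i j. h (A i j))"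
proof -
  have neg: "h (- a) = - h a" for a
    using assms(1) assms(3)[of a "- a"] by (simp add: eq_neg_iff_add_eq_0 add.commute)
  have sign: "h (of_int (sign p)) = of_int (sign p)" for p :: "'n \<Rightarrow> 'n"
    by (cases rule: sign_cases[of p]) (simp_all add: neg assms)
  have prod: "h (prod g S) = (\<Prod>i\<in>S. h (g i))" for g :: "'n \<Rightarrow> 'a" and S
    by (induction S rule: infinite_finite_induct) (simp_all add: assms)
  show ?thesis
    unfolding mdet_def by (simp add: additive_sum[of h] assms sign prod)
qed

text \<open>Laplace expansion along row \<open>k\<close>; the cofactors do not depend on that row.\<close>

lemma mdet_row_expansion:
  obtains C where "\<And>u. mdet (A(k := u)) = (\<Sum>j\<in>UNIV. u j * C j)"
proof
  fix u
  let ?c = "\<lambda>p. of_int (sign p) * (\<Prod>i\<in>UNIV - {k}. A i (p i))"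
  have fin: "finite {p :: 'a \<Rightarrow> 'a. p permutes UNIV}" by (rule finite_permutations) simp
  have "mdet (A(k := u)) = (\<Sum>p | p permutes UNIV. u (p k) * ?c p)"
  proof (unfold mdet_def, rule sum.cong)
    fix p :: "'a \<Rightarrow> 'a"
    have "(\<Prod>i\<in>UNIV. (A(k := u)) i (p i)) = u (p k) * (\<Prod>i\<in>UNIV - {k}. (A(k := u)) i (p i))"
      by (subst prod.remove[of UNIV k]) auto
    also have "(\<Prod>i\<in>UNIV - {k}. (A(k := u)) i (p i)) = (\<Prod>i\<in>UNIV - {k}. A i (p i))"
      by (rule prod.cong) auto
    finally show "of_int (sign p) * (\<Prod>i\<in>UNIV. (A(k := u)) i (p i)) = u (p k) * ?c p"
      by (simp add: algebra_simps)
  qed simp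
  also have "\<dots> = (\<Sum>j\<in>UNIV. \<Sum>p\<in>{p \<in> {p. p permutes UNIV}. p k = j}. u (p k) * ?c p)"
    by (rule sum.group[symmetric]) (use fin in auto)
  also have "\<dots> = (\<Sum>j\<in>UNIV. u j * (\<Sum>p\<in>{p \<in> {p. p permutes UNIV}. p k = j}. ?c p))"
    by (intro sum.cong) (auto simp: sum_distrib_left)
  finally show "mdet (A(k := u)) = (\<Sum>j\<in>UNIV. u j * (\<Sum>p\<in>{p \<in> {p. p permutes UNIV}. p k = j}. ?c p))" .
qed

lemma mdet_row_diff: "mdet A - mdet (A(k := u)) = mdet (A(k := (\<lambda>j. A k j - u j)))"
proof -
  obtain C where C: "\<And>u. mdet (A(k := u)) = (\<Sum>j\<in>UNIV. u j * C j)" using mdet_row_expansion by blast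
  have "mdet A = (\<Sum>j\<in>UNIV. A k j * C j)" using C[of "A k"] by simp
  then show ?thesis by (simp add: C algebra_simps sum_subtractf)
qed

lemma mdet_row_scale: "mdet (A(k := (\<lambda>j. a * A k j))) = a * mdet A"
proof -
  obtain C where C: "\<And>u. mdet (A(k := u)) = (\<Sum>j\<in>UNIV. u j * C j)" using mdet_row_expansion by blast
  have "mdet A = (\<Sum>j\<in>UNIV. A k j * C j)" using C[of "A k"] by simp
  then show ?thesis by (simp add: C algebra_simps sum_distrib_left)
qed

text \<open>Cramer's rule over a commutative ring. The cofactors \<open>C\<close> are those of column \<open>l\<close>; paired with another
  column they give the determinant of a matrix with two equal columns.\<close>

lemma mdet_cramer:
  obtains C where "\<And>z. z l * mdet A = (\<Sum>i\<in>UNIV. (\<Sum>j\<in>UNIV. A i j * z j) * C i)"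
proof -
  let ?B = "\<lambda>j i. A i j"
  obtain C where C: "\<And>u. mdet (?B(l := u)) = (\<Sum>i\<in>UNIV. u i * C i)" using mdet_row_expansion by blast
  have col: "(\<Sum>i\<in>UNIV. A i j * C i) = (if j = l then mdet A else 0)" for j
  proof -
    have "(\<Sum>i\<in>UNIV. A i j * C i) = mdet (?B(l := ?B j))" by (simp add: C)
    also have "\<dots> = (if j = l then mdet A else 0)"
    proof (cases "j = l")
      case True
      have "mdet (?B(l := ?B l)) = mdet A"
        by (subst fun_upd_idem, rule refl, rule mdet_transpose)
      then show ?thesis by (simp only: True simp_thms if_True)
    qed (use mdet_identical_rows[of j l "?B(l := ?B j)"] in simp)
    finally show ?thesis .
  qed
  have "z l * mdet A = (\<Sum>i\<in>UNIV. (\<Sum>j\<in>UNIV. A i j * z j) * C i)" for z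
  proof -
    have "(\<Sum>i\<in>UNIV. (\<Sum>j\<in>UNIV. A i j * z j) * C i) = (\<Sum>i\<in>UNIV. \<Sum>j\<in>UNIV. z j * (A i j * C i))"
      by (simp add: sum_distrib_right sum_distrib_left algebra_simps)
    also have "\<dots> = (\<Sum>j\<in>UNIV. z j * (\<Sum>i\<in>UNIV. A i j * C i))"
      by (subst sum.swap) (simp add: sum_distrib_left)
    also have "\<dots> = z l * mdet A" by (simp add: col if_distrib sum.delta cong: if_cong)
    finally show ?thesis by simp
  qed
  then show ?thesis using that by blast
qed

lemma mdet_cramer_ideal:
  assumes "is_ideal I" "\<And>i. (\<Sum>j\<in>UNIV. A i j * z j) \<in> I"
  shows "z l * mdet A \<in> I"
proof -
  obtain C where C: "\<And>z. z l * mdet A = (\<Sum>i\<in>UNIV. (\<Sum>j\<in>UNIV. A i j * z j) * C i)"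
    using mdet_cramer by blast
  show ?thesis unfolding C by (intro is_idealD(5) is_ideal_mult_right assms)
qed

section \<open>Ideals with as many generators as variables\<close>

lemma power_ideal_iff:
  fixes p :: "('v::finite, 'k::comm_ring_1) mpoly"
  shows "p \<in> ideal_gen ((\<lambda>j. Var j ^ N) ` T) \<longleftrightarrow>
    (\<forall>\<alpha>. Poly_Mapping.lookup p \<alpha> \<noteq> 0 \<longrightarrow> (\<exists>j\<in>T. N \<le> Poly_Mapping.lookup \<alpha> j))"
proof
  have "is_ideal {p :: ('v, 'k) mpoly. \<forall>\<alpha>. Poly_Mapping.lookup p \<alpha> \<noteq> 0 \<longrightarrow> (\<exists>j\<in>T. N \<le> Poly_Mapping.lookup \<alpha> j)}"
    (is "is_ideal ?I")
  proof (rule self_module.subspaceI)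
    fix x y r :: "('v, 'k) mpoly" assume x: "x \<in> ?I"
    show "x + y \<in> ?I" if "y \<in> ?I"
      using x that unfolding mem_Collect_eq lookup_add by (metis add_0)
    show "r * x \<in> ?I"
    proof safe
      fix \<alpha> assume "Poly_Mapping.lookup (r * x) \<alpha> \<noteq> 0"
      then obtain \<beta> \<gamma> where "\<alpha> = \<beta> + \<gamma>" "\<gamma> \<in> Poly_Mapping.keys x"
        using keys_mult[of r x] by (auto simp: in_keys_iff)
      moreover from this obtain j where "j \<in> T" "N \<le> Poly_Mapping.lookup \<gamma> j"
        using x by (auto simp: in_keys_iff)
      ultimately show "\<exists>j\<in>T. N \<le> Poly_Mapping.lookup \<alpha> j"
        by (intro bexI[of _ j]) (simp_all add: lookup_add)
    qed
  qed simp
  moreover have "(\<lambda>j. Var j ^ N) ` T \<subseteq> ?I"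
    by (force simp: Var_power lookup_single when_def split: if_splits)
  ultimately show "p \<in> ideal_gen ((\<lambda>j. Var j ^ N) ` T) \<Longrightarrow>
      \<forall>\<alpha>. Poly_Mapping.lookup p \<alpha> \<noteq> 0 \<longrightarrow> (\<exists>j\<in>T. N \<le> Poly_Mapping.lookup \<alpha> j)"
    using ideal_gen_least by blast
next
  assume p: "\<forall>\<alpha>. Poly_Mapping.lookup p \<alpha> \<noteq> 0 \<longrightarrow> (\<exists>j\<in>T. N \<le> Poly_Mapping.lookup \<alpha> j)"
  have "Poly_Mapping.single \<alpha> (Poly_Mapping.lookup p \<alpha>) \<in> ideal_gen ((\<lambda>j. Var j ^ N) ` T)"
    if \<alpha>: "\<alpha> \<in> Poly_Mapping.keys p" for \<alpha>
  proof -
    obtain j where j: "j \<in> T" "N \<le> Poly_Mapping.lookup \<alpha> j" using p \<alpha> by (metis in_keys_iff)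
    have "\<alpha> = (\<alpha> - Poly_Mapping.single j N) + Poly_Mapping.single j N"
      using j by (intro poly_mapping_eqI) (auto simp: lookup_add lookup_minus lookup_single when_def)
    then have "Poly_Mapping.single \<alpha> (Poly_Mapping.lookup p \<alpha>) =
        Poly_Mapping.single (\<alpha> - Poly_Mapping.single j N) (Poly_Mapping.lookup p \<alpha>) * Var j ^ N"
      by (metis Var_power mult.right_neutral mult_single)
    also have "\<dots> \<in> ideal_gen ((\<lambda>j. Var j ^ N) ` T)"
      by (intro is_ideal_mult[OF is_ideal_ideal_gen] ideal_gen_base imageI j)
    finally show ?thesis .
  qed
  then show "p \<in> ideal_gen ((\<lambda>j. Var j ^ N) ` T)"
    by (subst poly_mapping_eq_sum_single) (rule is_idealD(5)[OF is_ideal_ideal_gen])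
qed

lemma lookup_Var_times:
  "Poly_Mapping.lookup (Var i * h) (Poly_Mapping.single i 1 + \<alpha>) = Poly_Mapping.lookup h \<alpha>"
  for h :: "('v, 'k::comm_ring_1) mpoly"
proof (induction h rule: poly_mapping_additive_induct)
  case (single \<beta> a)
  then show ?case by (auto simp: Var_def mult_single lookup_single when_def)
qed (simp add: algebra_simps lookup_add)

lemma power_ideal_nonzerodivisor:
  fixes h :: "('v::finite, 'k::comm_ring_1) mpoly"
  assumes "Var i * h \<in> ideal_gen ((\<lambda>j. Var j ^ N) ` T)" "i \<notin> T"
  shows "h \<in> ideal_gen ((\<lambda>j. Var j ^ N) ` T)"
  unfolding power_ideal_iff
proof (intro allI impI)
  fix \<alpha> assume "Poly_Mapping.lookup h \<alpha> \<noteq> 0"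
  then have "Poly_Mapping.lookup (Var i * h) (Poly_Mapping.single i 1 + \<alpha>) \<noteq> 0"
    by (simp only: lookup_Var_times not_False_eq_True)
  then obtain j where "j \<in> T" "N \<le> Poly_Mapping.lookup (Poly_Mapping.single i 1 + \<alpha>) j"
    using assms(1) unfolding power_ideal_iff by blast
  then show "\<exists>j\<in>T. N \<le> Poly_Mapping.lookup \<alpha> j"
    using assms(2) by (intro bexI[of _ j]) (auto simp: lookup_add lookup_single when_def split: if_splits)
qed

text \<open>All matrices that send the vector of variables to the vector of their \<open>N\<close>-th powers have the
  same determinant modulo these powers. Exchanging one row changes the determinant by that of a
  matrix whose row \<open>i\<close> is orthogonal to the variables; by Cramer's rule its product with the \<open>i\<close>-th
  variable lies in the ideal of the other powers, for which this variable is a nonzerodivisor.\<close>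

lemma det_power_matrix_cong:
  fixes G :: "'n::finite \<Rightarrow> 'n \<Rightarrow> ('n, 'k::comm_ring_1) mpoly"
  assumes G: "\<And>i. (\<Sum>j\<in>UNIV. G i j * Var j) = Var i ^ Suc N"
  shows "mdet G - (\<Prod>i\<in>UNIV. Var i ^ N) \<in> ideal_gen (range (\<lambda>j. Var j ^ Suc N))"
    (is "_ \<in> ?I")
proof -
  let ?d = "\<lambda>i j. if j = i then Var i ^ N else (0 :: ('n, 'k) mpoly)"
  have diag: "(\<Sum>j\<in>UNIV. ?d i j * Var j) = Var i ^ Suc N" for i
  proof -
    have "(\<Sum>j\<in>UNIV. ?d i j * Var j) = (\<Sum>j\<in>UNIV. if j = i then Var i ^ N * Var j else 0)"
      by (rule sum.cong) auto
    then show ?thesis by (simp add: mult.commute)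
  qed
  have "mdet G - mdet (\<lambda>i. if i \<in> S then ?d i else G i) \<in> ?I" if "finite S" for S
    using that
  proof induction
    case empty
    then show ?case by (simp add: is_idealD(1))
  next
    case (insert k S)
    let ?A = "\<lambda>i. if i \<in> S then ?d i else G i"
    let ?H = "?A(k := (\<lambda>j. ?A k j - ?d k j))"
    let ?J = "ideal_gen ((\<lambda>j. Var j ^ Suc N) ` (UNIV - {k})) :: ('n, 'k) mpoly set"
    have A: "(\<Sum>j\<in>UNIV. ?A i j * Var j) = Var i ^ Suc N" for i
      using G diag by (cases "i \<in> S") simp_all
    have "(\<Sum>j\<in>UNIV. ?H i j * Var j) \<in> ?J" for i
    proof (cases "i = k")
      case True
      have "(\<Sum>j\<in>UNIV. ?H k j * Var j) = (\<Sum>j\<in>UNIV. ?A k j * Var j) - (\<Sum>j\<in>UNIV. ?d k j * Var j)"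
        by (simp only: fun_upd_same left_diff_distrib sum_subtractf)
      then show ?thesis using True by (simp only: A diag) (simp add: is_idealD(1))
    next
      case False
      then have "(\<Sum>j\<in>UNIV. ?H i j * Var j) = Var i ^ Suc N" using A[of i] by (simp only: fun_upd_apply if_False)
      also have "\<dots> \<in> ?J" using False by (intro ideal_gen_base) auto
      finally show ?thesis .
    qed
    then have "Var k * mdet ?H \<in> ?J" by (rule mdet_cramer_ideal[OF is_ideal_ideal_gen])
    then have "mdet ?H \<in> ?J" by (rule power_ideal_nonzerodivisor) simp
    moreover have "?J \<subseteq> ?I" by (intro ideal_gen_least) (auto intro: ideal_gen_base)
    ultimately have "mdet ?A - mdet (?A(k := ?d k)) \<in> ?I" by (subst mdet_row_diff) blast
    moreover have "?A(k := ?d k) = (\<lambda>i. if i \<in> insert k S then ?d i else G i)" by auto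
    ultimately have "(mdet G - mdet ?A) + (mdet ?A - mdet (\<lambda>i. if i \<in> insert k S then ?d i else G i)) \<in> ?I"
      by (intro is_idealD(2)[OF is_ideal_ideal_gen insert.IH]) simp
    then show ?case by simp
  qed
  from this[of UNIV] show ?thesis by (simp add: mdet_diag[of "\<lambda>i. Var i ^ N"])
qed

lemma prod_Var_power_notin_power_ideal:
  "(\<Prod>i\<in>UNIV. Var i ^ N) \<notin> (ideal_gen (range (\<lambda>j. Var j ^ Suc N)) :: ('n::finite, 'k::comm_ring_1) mpoly set)"
proof
  let ?\<alpha> = "\<Sum>i\<in>UNIV. Poly_Mapping.single i N :: 'n \<Rightarrow>\<^sub>0 nat"
  have "(\<Prod>i\<in>A. Var i ^ N) = (Poly_Mapping.single (\<Sum>i\<in>A. Poly_Mapping.single i N) 1 :: ('n, 'k) mpoly)"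
    if "finite A" for A
    using that by induction (simp_all add: Var_power mult_single)
  moreover assume "(\<Prod>i\<in>UNIV. Var i ^ N) \<in> (ideal_gen (range (\<lambda>j. Var j ^ Suc N)) :: ('n, 'k) mpoly set)"
  ultimately have "Poly_Mapping.single ?\<alpha> 1 \<in> (ideal_gen (range (\<lambda>j. Var j ^ Suc N)) :: ('n, 'k) mpoly set)"
    by simp
  then obtain j where "Suc N \<le> Poly_Mapping.lookup ?\<alpha> j"
    unfolding power_ideal_iff by (metis lookup_single_eq one_neq_zero)
  then show False by (simp add: lookup_sum lookup_single when_def)
qed

text \<open>
  Let \<open>M\<close> express the powers of the variables through the \<open>c i\<close>. By Cramer's rule multiplication by
  \<open>mdet M\<close> sends the ideal of the \<open>c i\<close> into the ideal of these powers, but it sends \<open>mdet D\<close> to the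
  determinant of a matrix as in the previous lemma, which is not in that ideal.
\<close>

lemma det_notin_ideal:
  fixes c :: "'n::finite \<Rightarrow> ('n, 'k::comm_ring_1) mpoly"
  assumes D: "\<And>i. c i = (\<Sum>j\<in>UNIV. D i j * Var j)" and prim: "irrelevant_primary (ideal_gen (range c))"
  shows "mdet D \<notin> ideal_gen (range c)"
proof
  assume det: "mdet D \<in> ideal_gen (range c)"
  obtain N where N: "\<And>q. q \<ge> N \<Longrightarrow> forms q \<subseteq> ideal_gen (range c)"
    using prim by (auto simp: irrelevant_primary_def)
  have "Var i ^ Suc N \<in> ideal_gen (range c)" for i
    using N[of "Suc N"] forms_power[OF Var_in_forms, of i "Suc N"] by auto
  then have "\<exists>a. Var i ^ Suc N = (\<Sum>j\<in>UNIV. a j * c j)" for i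
    using ideal_gen_image_iff[of UNIV _ c] by simp
  then obtain M where M: "\<And>i. Var i ^ Suc N = (\<Sum>j\<in>UNIV. M i j * c j)" by metis
  let ?G = "\<lambda>i l. \<Sum>j\<in>UNIV. M i j * D j l"
  let ?I = "ideal_gen (range (\<lambda>j. Var j ^ Suc N)) :: ('n, 'k) mpoly set"
  have "(\<Sum>l\<in>UNIV. ?G i l * Var l) = Var i ^ Suc N" for i
  proof -
    have "(\<Sum>l\<in>UNIV. ?G i l * Var l) = (\<Sum>j\<in>UNIV. M i j * (\<Sum>l\<in>UNIV. D j l * Var l))"
      by (simp add: sum_distrib_left sum_distrib_right mult.assoc) (rule sum.swap)
    also have "\<dots> = (\<Sum>j\<in>UNIV. M i j * c j)" by (simp only: D)
    also have "\<dots> = Var i ^ Suc N" by (simp only: M)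
    finally show ?thesis .
  qed
  then have "mdet ?G - (\<Prod>i\<in>UNIV. Var i ^ N) \<in> ?I" by (rule det_power_matrix_cong)
  then have 1: "mdet M * mdet D - (\<Prod>i\<in>UNIV. Var i ^ N) \<in> ?I" by (simp only: mdet_mult)
  obtain b where b: "mdet D = (\<Sum>j\<in>UNIV. b j * c j)"
    using det ideal_gen_image_iff[of UNIV _ c] by auto
  have cM: "c j * mdet M \<in> ?I" for j
    by (rule mdet_cramer_ideal[OF is_ideal_ideal_gen], unfold M[symmetric]) (rule ideal_gen_base, rule rangeI)
  have "(\<Sum>j\<in>UNIV. b j * (c j * mdet M)) \<in> ?I"
    by (rule is_idealD(5)[OF is_ideal_ideal_gen]) (rule is_ideal_mult[OF is_ideal_ideal_gen cM])
  moreover have "mdet M * mdet D = (\<Sum>j\<in>UNIV. b j * (c j * mdet M))"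
    by (simp add: b sum_distrib_left algebra_simps)
  ultimately have "mdet M * mdet D \<in> ?I" by simp
  from is_idealD(3)[OF is_ideal_ideal_gen this 1]
  show False using prod_Var_power_notin_power_ideal by auto
qed

section \<open>The Bezoutian and the socle\<close>

text \<open>
  Polynomials in a second set of variables, written \<open>y\<close>, with coefficients in the polynomial ring
  \<open>k[x]\<close>. A polynomial \<open>p(x)\<close> is embedded as the constant \<open>Const p\<close>, and \<open>p(y)\<close> is \<open>second_copy p\<close>.
\<close>

definition second_copy :: "('v, 'k::comm_ring_1) mpoly \<Rightarrow> ('v, ('v, 'k) mpoly) mpoly" where
  "second_copy = insertion_via (\<lambda>a. Const (Const a)) Var"

lemma second_copy_add [simp]: "second_copy (p + q) = second_copy p + second_copy q"
  and second_copy_mult [simp]: "second_copy (p * q) = second_copy p * second_copy q"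
  and second_copy_Const [simp]: "second_copy (Const a) = Const (Const a)"
  and second_copy_Var [simp]: "second_copy (Var i) = Var i"
  by (simp_all add: second_copy_def insertion_via_add insertion_via_mult insertion_via_Const insertion_via_Var
      Const_add Const_mult)

lemma second_copy_single: "second_copy (Poly_Mapping.single \<alpha> a) = Poly_Mapping.single \<alpha> (Const a)"
  by (simp add: second_copy_def insertion_via_single single_eq_prod_Var[symmetric])
    (metis single_eq_Const_times)

text \<open>\<open>p(x) - p(y)\<close> lies in the ideal generated by the differences of the variables.\<close>

lemma difference_quotients:
  fixes p :: "('v::finite, 'k::comm_ring_1) mpoly"
  shows "\<exists>D. Const p - second_copy p = (\<Sum>j\<in>UNIV. D j * (Const (Var j) - Var j))"
proof (induction p rule: mpoly_ring_induct)
  case (Const c)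
  then show ?case by (intro exI[of _ "\<lambda>_. 0"]) simp
next
  case (Var i)
  have "(\<Sum>j\<in>UNIV. (if j = i then 1 else 0) * (Const (Var j) - Var j)) =
      (\<Sum>j\<in>UNIV. if j = i then Const (Var j) - Var j else (0 :: ('v, ('v, 'k) mpoly) mpoly))"
    by (rule sum.cong) auto
  then show ?case by (intro exI[of _ "\<lambda>j. if j = i then 1 else 0"]) (simp add: sum.delta)
next
  case (add p q)
  then obtain D E where "Const p - second_copy p = (\<Sum>j\<in>UNIV. D j * (Const (Var j) - Var j))"
    "Const q - second_copy q = (\<Sum>j\<in>UNIV. E j * (Const (Var j) - Var j))" by blast
  moreover have "Const (p + q) - second_copy (p + q) = (Const p - second_copy p) + (Const q - second_copy q)"
    by (simp add: Const_add)
  ultimately show ?case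
    by (intro exI[of _ "\<lambda>j. D j + E j"]) (simp only: distrib_right sum.distrib)
next
  case (mult p q)
  then obtain D E where DE: "Const p - second_copy p = (\<Sum>j\<in>UNIV. D j * (Const (Var j) - Var j))"
    "Const q - second_copy q = (\<Sum>j\<in>UNIV. E j * (Const (Var j) - Var j))" by blast
  have "Const (p * q) - second_copy (p * q) =
      second_copy q * (Const p - second_copy p) + Const p * (Const q - second_copy q)"
    by (simp add: Const_mult algebra_simps)
  then show ?case unfolding DE
    by (intro exI[of _ "\<lambda>j. second_copy q * D j + Const p * E j"])
      (simp only: distrib_right sum.distrib sum_distrib_left mult.assoc)
qed

text \<open>The map \<open>k[x] \<otimes> k[y] \<rightarrow> k[x]\<close> that applies the functional \<open>\<psi>\<close> to the second factor.\<close>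

definition contract :: "(('v, 'k) mpoly \<Rightarrow> 'k::field) \<Rightarrow> ('v, ('v, 'k) mpoly) mpoly \<Rightarrow> ('v, 'k) mpoly" where
  "contract \<psi> F = (\<Sum>\<beta>\<in>Poly_Mapping.keys F. Poly_Mapping.lookup F \<beta> * Const (\<psi> (Poly_Mapping.single \<beta> 1)))"

lemma contract_superset:
  assumes "finite A" "Poly_Mapping.keys F \<subseteq> A"
  shows "contract \<psi> F = (\<Sum>\<beta>\<in>A. Poly_Mapping.lookup F \<beta> * Const (\<psi> (Poly_Mapping.single \<beta> 1)))"
  unfolding contract_def using assms by (intro sum.mono_neutral_left) (auto simp: in_keys_iff)

lemma contract_add: "contract \<psi> (F + G) = contract \<psi> F + contract \<psi> G"
proof -
  let ?A = "Poly_Mapping.keys F \<union> Poly_Mapping.keys G"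
  have "Poly_Mapping.keys (F + G) \<subseteq> ?A" by (rule keys_add)
  then show ?thesis
    by (subst (1 2 3) contract_superset[where A = ?A]) (auto simp: lookup_add algebra_simps sum.distrib)
qed

lemma contract_single: "contract \<psi> (Poly_Mapping.single \<beta> a) = a * Const (\<psi> (Poly_Mapping.single \<beta> 1))"
  by (subst contract_superset[where A = "{\<beta>}"]) (auto split: if_splits)

lemma contract_0 [simp]: "contract \<psi> 0 = 0"
  by (simp add: contract_def)

lemma contract_diff: "contract \<psi> (F - G) = contract \<psi> F - contract \<psi> G"
  using contract_add[of \<psi> "F - G" G] by simp

lemma contract_sum: "contract \<psi> (sum g A) = (\<Sum>a\<in>A. contract \<psi> (g a))"
  by (rule additive_sum) (simp_all add: contract_add)

lemma contract_Const_mult: "contract \<psi> (Const a * F) = a * contract \<psi> F"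
proof (induction F rule: poly_mapping_additive_induct)
  case (single \<beta> b)
  have "Const a * Poly_Mapping.single \<beta> b = Poly_Mapping.single \<beta> (a * b)"
    by (simp add: Const_def mult_single)
  then show ?case by (simp add: contract_single mult.assoc)
qed (simp add: algebra_simps contract_add)

lemma contract_second_copy:
  assumes "mpoly_vs.functional \<psi>"
  shows "contract \<psi> (F * second_copy p) = contract (\<lambda>q. \<psi> (q * p)) F"
proof (induction F rule: poly_mapping_additive_induct)
  case (single \<beta> b)
  show ?case
  proof (induction p rule: poly_mapping_additive_induct)
    case (single \<alpha> a)
    have "Poly_Mapping.single \<beta> 1 * Poly_Mapping.single \<alpha> a = pscale a (Poly_Mapping.single (\<beta> + \<alpha>) 1)"
      by (simp add: mult_single pscale_single)
    then have "\<psi> (Poly_Mapping.single \<beta> 1 * Poly_Mapping.single \<alpha> a) = a * \<psi> (Poly_Mapping.single (\<beta> + \<alpha>) 1)"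
      using mpoly_vs.functional_scale[OF assms] by simp
    then show ?case
      by (simp add: second_copy_single mult_single contract_single Const_mult mult.assoc)
  next
    case (add p q)
    then show ?case
      by (simp add: algebra_simps contract_add contract_single mpoly_vs.functional_add[OF assms] Const_add)
  qed
qed (simp add: algebra_simps contract_add)

lemma contract_combination:
  "contract (\<lambda>q. \<Sum>b\<in>E. a b * \<psi> b q) F = (\<Sum>b\<in>E. Const (a b) * contract (\<psi> b) F)"
proof -
  have "contract (\<lambda>q. \<Sum>b\<in>E. a b * \<psi> b q) F = (\<Sum>\<beta>\<in>Poly_Mapping.keys F. \<Sum>b\<in>E.
      Const (a b) * (Poly_Mapping.lookup F \<beta> * Const (\<psi> b (Poly_Mapping.single \<beta> 1))))"
    by (simp add: contract_def Const_sum Const_mult sum_distrib_left mult.left_commute)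
  also have "\<dots> = (\<Sum>b\<in>E. Const (a b) * contract (\<psi> b) F)"
    by (subst sum.swap) (simp add: contract_def sum_distrib_left)
  finally show ?thesis .
qed

lemma contract_scale: "contract (\<lambda>q. a * \<psi> q) F = Const a * contract \<psi> F"
  using contract_combination[of "\<lambda>_. a" "\<lambda>_. \<psi>" "{()}" F] by simp

lemma contract_plus: "contract (\<lambda>q. \<psi> q + \<psi>' q) F = contract \<psi> F + contract \<psi>' F"
  by (simp add: contract_def Const_add algebra_simps sum.distrib)

lemma lookup_0_eq_eval_at: "Poly_Mapping.lookup p 0 = eval_at (\<lambda>_. 0) p"
  for p :: "('v, 'a::comm_ring_1) mpoly"
proof (induction p rule: poly_mapping_additive_induct)
  case (single \<alpha> c)
  show ?case
  proof (cases "\<alpha> = 0")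
    case False
    then obtain i where "i \<in> Poly_Mapping.keys \<alpha>" by (metis ex_in_conv keys_eq_empty)
    then have "(\<Prod>i\<in>Poly_Mapping.keys \<alpha>. (0::'a) ^ Poly_Mapping.lookup \<alpha> i) = 0"
      by (intro prod_zero) (auto simp: in_keys_iff zero_power)
    with False show ?thesis by (simp add: eval_at_single lookup_single)
  qed (simp add: eval_at_single)
qed (simp add: lookup_add)

lemma contract_constant_coefficient: "contract (\<lambda>q. Poly_Mapping.lookup q 0) F = eval_at (\<lambda>_. 0) F"
proof -
  have "contract (\<lambda>q. Poly_Mapping.lookup q 0) F = Poly_Mapping.lookup F 0"
  proof (induction F rule: poly_mapping_additive_induct)
    case (single \<beta> b)
    then show ?case by (simp add: contract_single lookup_single when_def)
  qed (simp add: contract_add lookup_add)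
  then show ?thesis by (simp add: lookup_0_eq_eval_at)
qed

lemma eval_at_second_copy: "eval_at (\<lambda>_. 0) (second_copy p) = Const (eval_at (\<lambda>_. 0) p)"
  by (induction p rule: mpoly_ring_induct) (simp_all add: Const_add Const_mult)

text \<open>
  Let the ideal \<open>I\<close> contain all forms of large degree and have as many generators \<open>c\<^sub>i\<close> as there are
  variables, without constant terms. Contraction of the Bezoutian, the determinant of a matrix of
  difference quotients, sends functionals on the quotient by \<open>I\<close> to elements of this quotient.
  This map is linear over the polynomial ring, and it sends the constant coefficient, which spans the
  socle of the dual space, to an element that is not zero. So the map is injective, and by dimension
  bijective; hence the socle of the quotient is one-dimensional as well.
\<close>

locale bezoutian =
  fixes c :: "'n::finite \<Rightarrow> ('n, 'k::field) mpoly"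
    and D :: "'n \<Rightarrow> 'n \<Rightarrow> ('n, ('n, 'k) mpoly) mpoly"
  assumes constant_term: "\<And>i. eval_at (\<lambda>_. 0) (c i) = 0"
    and primary: "irrelevant_primary (ideal_gen (range c))"
    and D: "\<And>i. Const (c i) - second_copy (c i) = (\<Sum>j\<in>UNIV. D i j * (Const (Var j) - Var j))"
begin

definition I where "I = ideal_gen (range c)"
definition \<theta> where "\<theta> \<psi> = contract \<psi> (mdet D)"
definition \<delta> where "\<delta> = mdet (\<lambda>i j. eval_at (\<lambda>_. 0) (D i j))"

definition dual where "dual \<psi> \<longleftrightarrow> mpoly_vs.functional \<psi> \<and> (\<forall>p\<in>I. \<psi> p = 0)"

lemma is_ideal_I: "is_ideal I"
  by (simp add: I_def)

lemma dual_mult: "dual \<psi> \<Longrightarrow> dual (\<lambda>q. \<psi> (q * p))"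
  using is_ideal_mult_right[OF is_ideal_I]
  by (auto simp: dual_def mpoly_vs.functional_def distrib_right pscale_mult_left)

lemma \<delta>_notin_I: "\<delta> \<notin> I"
  unfolding \<delta>_def I_def
proof (rule det_notin_ideal[OF _ primary])
  fix i
  have "c i = eval_at (\<lambda>_. 0) (Const (c i) - second_copy (c i))"
    by (simp add: eval_at_second_copy constant_term)
  also have "\<dots> = (\<Sum>j\<in>UNIV. eval_at (\<lambda>_. 0) (D i j) * Var j)"
    by (simp add: D eval_at_sum)
  finally show "c i = (\<Sum>j\<in>UNIV. eval_at (\<lambda>_. 0) (D i j) * Var j)" .
qed

lemma \<theta>_constant_coefficient: "\<theta> (\<lambda>q. a * Poly_Mapping.lookup q 0) = pscale a \<delta>"
proof -
  have "eval_at (\<lambda>_. 0) (mdet D) = \<delta>"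
    unfolding \<delta>_def by (rule mdet_hom) simp_all
  then show ?thesis
    by (simp add: \<theta>_def contract_scale contract_constant_coefficient pscale_def)
qed

text \<open>Cramer's rule for the matrix \<open>D\<close> and the vector of the \<open>x\<^sub>j - y\<^sub>j\<close>: their products with the
  Bezoutian lie in the ideal of the \<open>c\<^sub>i(x)\<close> and the \<open>c\<^sub>i(y)\<close>, and contraction kills the latter.\<close>

lemma \<theta>_Var:
  assumes "dual \<psi>"
  shows "Var l * \<theta> \<psi> - \<theta> (\<lambda>q. \<psi> (q * Var l)) \<in> I"
proof -
  have \<psi>: "mpoly_vs.functional \<psi>" using assms by (simp add: dual_def)
  obtain C where C: "\<And>z. z l * mdet D = (\<Sum>i\<in>UNIV. (\<Sum>j\<in>UNIV. D i j * z j) * C i)"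
    using mdet_cramer by blast
  have "Var l * \<theta> \<psi> - \<theta> (\<lambda>q. \<psi> (q * Var l)) = contract \<psi> ((Const (Var l) - Var l) * mdet D)"
    using contract_second_copy[OF \<psi>, of "mdet D" "Var l"] mult.commute[of "mdet D" "Var l"]
    by (simp add: \<theta>_def contract_Const_mult contract_diff left_diff_distrib)
  also have "\<dots> = (\<Sum>i\<in>UNIV. contract \<psi> ((Const (c i) - second_copy (c i)) * C i))"
    unfolding C[of "\<lambda>j. Const (Var j) - Var j"] D by (simp only: contract_sum)
  also have "\<dots> = (\<Sum>i\<in>UNIV. c i * contract \<psi> (C i))"
  proof (rule sum.cong)
    fix i
    have ci: "c i \<in> I" by (simp add: I_def ideal_gen_base)
    have "contract (\<lambda>q. \<psi> (q * c i)) (C i) = 0"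
      using assms is_ideal_mult[OF is_ideal_I ci] by (simp add: contract_def dual_def)
    then have "contract \<psi> (second_copy (c i) * C i) = 0"
      using contract_second_copy[OF \<psi>, of "C i" "c i"] by (simp add: mult.commute)
    then show "contract \<psi> ((Const (c i) - second_copy (c i)) * C i) = c i * contract \<psi> (C i)"
      by (simp add: left_diff_distrib contract_diff contract_Const_mult)
  qed simp
  also have "\<dots> \<in> I"
    by (intro is_idealD(5)[OF is_ideal_I] is_ideal_mult_right[OF is_ideal_I]) (simp add: I_def ideal_gen_base)
  finally show ?thesis .
qed

lemma \<theta>_multiple:
  assumes "dual \<psi>" "\<theta> \<psi> \<in> I"
  shows "\<theta> (\<lambda>q. \<psi> (q * p)) \<in> I"
  using assms
proof (induction p arbitrary: \<psi> rule: mpoly_ring_induct)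
  case (Const a)
  have "\<psi> (q * Const a) = a * \<psi> q" for q
    using Const(1) mpoly_vs.functional_scale[of \<psi> a q] by (simp add: dual_def pscale_def mult.commute)
  then show ?case
    using is_ideal_mult[OF is_ideal_I Const(2)] by (simp add: \<theta>_def contract_scale)
next
  case (Var i)
  have "Var i * \<theta> \<psi> - (Var i * \<theta> \<psi> - \<theta> (\<lambda>q. \<psi> (q * Var i))) \<in> I"
    by (intro is_idealD(3)[OF is_ideal_I] is_ideal_mult[OF is_ideal_I] Var \<theta>_Var)
  then show ?case by simp
next
  case (add p q)
  have "(\<lambda>r. \<psi> (r * (p + q))) = (\<lambda>r. \<psi> (r * p) + \<psi> (r * q))"
    using add.prems(1) by (simp add: dual_def distrib_left mpoly_vs.functional_add)
  then show ?case
    using is_idealD(2)[OF is_ideal_I add.IH(1)[OF add.prems] add.IH(2)[OF add.prems]]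
    by (simp add: \<theta>_def contract_plus)
next
  case (mult p q)
  from mult.IH(1)[OF dual_mult[OF mult.prems(1)] mult.IH(2)[OF mult.prems]] show ?case
    by (simp add: mult.assoc)
qed

lemma dual_eq_constant_coefficient:
  assumes "mpoly_vs.functional \<psi>" "\<And>\<beta>. \<beta> \<noteq> 0 \<Longrightarrow> \<psi> (Poly_Mapping.single \<beta> 1) = 0"
  shows "\<psi> q = \<psi> 1 * Poly_Mapping.lookup q 0"
proof (induction q rule: poly_mapping_additive_induct)
  case (single \<beta> a)
  have "\<psi> (Poly_Mapping.single \<beta> a) = a * \<psi> (Poly_Mapping.single \<beta> 1)"
    using mpoly_vs.functional_scale[OF assms(1), of a "Poly_Mapping.single \<beta> 1"] by (simp add: pscale_single)
  then show ?case using assms(2)[of \<beta>] by (cases "\<beta> = 0") (simp_all add: lookup_single)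
qed (simp add: mpoly_vs.functional_add[OF assms(1)] lookup_add algebra_simps)

text \<open>A monomial of maximal degree on which \<open>\<psi>\<close> does not vanish multiplies \<open>\<psi>\<close> to a multiple of the constant
  coefficient, whose image is known not to be zero.\<close>

lemma \<theta>_injective:
  assumes "dual \<psi>" "\<theta> \<psi> \<in> I"
  shows "\<psi> p = 0"
proof (rule ccontr)
  assume "\<psi> p \<noteq> 0"
  have \<psi>: "mpoly_vs.functional \<psi>" using assms by (simp add: dual_def)
  have scale: "\<psi> (Poly_Mapping.single \<alpha> a) = a * \<psi> (Poly_Mapping.single \<alpha> 1)" for \<alpha> a
    using mpoly_vs.functional_scale[OF \<psi>, of a "Poly_Mapping.single \<alpha> 1"] by (simp add: pscale_single)
  let ?P = "\<lambda>m. \<exists>\<alpha>. mdeg \<alpha> = m \<and> \<psi> (Poly_Mapping.single \<alpha> 1) \<noteq> 0"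
  have "\<exists>\<alpha>. \<psi> (Poly_Mapping.single \<alpha> 1) \<noteq> 0"
  proof (rule ccontr)
    assume "\<nexists>\<alpha>. \<psi> (Poly_Mapping.single \<alpha> 1) \<noteq> 0"
    then have "\<psi> q = 0" for q
    proof (induction q rule: poly_mapping_additive_induct)
      case (single \<alpha> a)
      then show ?case using scale[of \<alpha> a] by simp
    qed (simp add: mpoly_vs.functional_add[OF \<psi>])
    then show False using \<open>\<psi> p \<noteq> 0\<close> by simp
  qed
  then obtain m0 where m0: "?P m0" by blast
  obtain N where N: "\<And>q. q \<ge> N \<Longrightarrow> forms q \<subseteq> I"
    using primary by (auto simp: irrelevant_primary_def I_def)
  have "m \<le> N" if m: "?P m" for m
  proof (rule ccontr)
    assume "\<not> m \<le> N"
    then have "forms m \<subseteq> I" using N by simp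
    moreover obtain \<alpha> where "mdeg \<alpha> = m" "\<psi> (Poly_Mapping.single \<alpha> 1) \<noteq> 0" using m by blast
    ultimately show False using assms(1) single_in_forms[of \<alpha> 1] by (auto simp: dual_def)
  qed
  then obtain m where m: "?P m" "\<And>m'. ?P m' \<Longrightarrow> m' \<le> m"
    using Nat.ex_has_greatest_nat[of ?P m0 N] m0 by blast
  then obtain \<alpha> where \<alpha>: "mdeg \<alpha> = m" "\<psi> (Poly_Mapping.single \<alpha> 1) \<noteq> 0" by blast
  let ?\<phi> = "\<lambda>q. \<psi> (q * Poly_Mapping.single \<alpha> 1)"
  have "?\<phi> (Poly_Mapping.single \<beta> 1) = 0" if "\<beta> \<noteq> 0" for \<beta>
  proof (rule ccontr)
    assume "?\<phi> (Poly_Mapping.single \<beta> 1) \<noteq> 0"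
    then have "?P (mdeg (\<beta> + \<alpha>))" by (auto simp: mult_single)
    then have "mdeg (\<beta> + \<alpha>) \<le> m" by (rule m(2))
    then show False using that \<alpha>(1) by (simp add: mdeg_add mdeg_eq_0_iff)
  qed
  then have "?\<phi> q = ?\<phi> 1 * Poly_Mapping.lookup q 0" for q
    using dual_mult[OF assms(1), of "Poly_Mapping.single \<alpha> 1"]
    by (intro dual_eq_constant_coefficient) (simp_all add: dual_def)
  then have "?\<phi> = (\<lambda>q. ?\<phi> 1 * Poly_Mapping.lookup q 0)" by (rule ext)
  then have "\<theta> ?\<phi> = \<theta> (\<lambda>q. ?\<phi> 1 * Poly_Mapping.lookup q 0)" by (rule arg_cong)
  then have "\<theta> ?\<phi> = pscale (?\<phi> 1) \<delta>" using \<theta>_constant_coefficient[of "?\<phi> 1"] by (rule trans)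
  then have "pscale (?\<phi> 1) \<delta> \<in> I" using \<theta>_multiple[OF assms, of "Poly_Mapping.single \<alpha> 1"] by simp
  then show False using \<delta>_notin_I \<alpha>(2) is_ideal_pscale_iff[OF is_ideal_I, of "?\<phi> 1" \<delta>] by simp
qed

lemma \<theta>_surjective:
  obtains \<psi> where "dual \<psi>" "h - \<theta> \<psi> \<in> I"
proof -
  obtain N where N: "\<And>q. q \<ge> N \<Longrightarrow> forms q \<subseteq> I"
    using primary by (auto simp: irrelevant_primary_def I_def)
  let ?M = "(\<lambda>\<alpha>. Poly_Mapping.single \<alpha> 1) ` {\<alpha>. mdeg \<alpha> \<le> N} :: ('n, 'k) mpoly set"
  have finM: "finite ?M" using finite_exponents_mdeg_le by blast
  have spanM: "\<exists>i\<in>I. \<exists>u\<in>mpoly_vs.span ?M. v = u + i" for v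
  proof (induction v rule: poly_mapping_additive_induct)
    case (single \<alpha> a)
    show ?case
    proof (cases "mdeg \<alpha> \<le> N")
      case True
      have "pscale a (Poly_Mapping.single \<alpha> 1) \<in> mpoly_vs.span ?M"
        using True by (intro mpoly_vs.span_scale mpoly_vs.span_base) auto
      then show ?thesis using is_idealD(1)[OF is_ideal_I]
        by (intro bexI[of _ 0] bexI[of _ "Poly_Mapping.single \<alpha> a"]) (simp_all add: pscale_single)
    next
      case False
      then have "Poly_Mapping.single \<alpha> a \<in> I" using N[of "mdeg \<alpha>"] single_in_forms[of \<alpha> a] by auto
      then show ?thesis using mpoly_vs.span_zero[of ?M]
        by (intro bexI[of _ "Poly_Mapping.single \<alpha> a"] bexI[of _ 0]) simp_all
    qed
  next
    case (add p q)
    then obtain i u i' u' where "i \<in> I" "i' \<in> I" "u \<in> mpoly_vs.span ?M" "u' \<in> mpoly_vs.span ?M"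
      "p = u + i" "q = u' + i'" by blast
    then show ?case using is_idealD(2)[OF is_ideal_I] mpoly_vs.span_add[of u ?M u']
      by (intro bexI[of _ "i + i'"] bexI[of _ "u + u'"]) simp_all
  qed
  obtain E \<psi> where E: "finite E" "\<And>b. b \<in> E \<Longrightarrow> mpoly_vs.functional (\<psi> b)"
    "\<And>b x. b \<in> E \<Longrightarrow> x \<in> I \<Longrightarrow> \<psi> b x = 0"
    "\<And>b b'. b \<in> E \<Longrightarrow> b' \<in> E \<Longrightarrow> \<psi> b b' = (if b = b' then 1 else 0)"
    "\<And>v. v - (\<Sum>b\<in>E. pscale (\<psi> b v) b) \<in> I"
    by (rule mpoly_vs.dual_basis_mod_subspace[OF is_ideal_subspace[OF is_ideal_I] finM spanM]) (rule that)
  have dual: "dual (\<lambda>q. \<Sum>b\<in>E. a b * \<psi> b q)" for a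
    using E(2,3) mpoly_vs.functional_combination[of E \<psi> a] by (simp add: dual_def)
  have \<theta>: "\<theta> (\<lambda>q. \<Sum>b\<in>E. a b * \<psi> b q) = (\<Sum>b\<in>E. pscale (a b) (\<theta> (\<psi> b)))" for a
    by (simp add: \<theta>_def contract_combination pscale_def)
  \<comment> \<open>one more element than the dimension of the quotient: the images of the dual basis and \<open>h\<close>\<close>
  define w where "w t = (case t of None \<Rightarrow> h | Some b \<Rightarrow> \<theta> (\<psi> b))" for t
  have wE: "\<exists>i\<in>I. \<exists>u\<in>mpoly_vs.span E. w t = u + i" for t
    using E(5)[of "w t"]
    by (intro bexI[of _ "w t - (\<Sum>b\<in>E. pscale (\<psi> b (w t)) b)"] bexI[of _ "\<Sum>b\<in>E. pscale (\<psi> b (w t)) b"]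
        mpoly_vs.span_sum mpoly_vs.span_scale mpoly_vs.span_base) simp_all
  have finT: "finite (insert None (Some ` E))" and cardT: "card E < card (insert None (Some ` E))"
    using E(1) by (simp_all add: card_image)
  obtain a where a: "\<exists>t\<in>insert None (Some ` E). a t \<noteq> 0"
    "(\<Sum>t\<in>insert None (Some ` E). pscale (a t) (w t)) \<in> I"
    by (rule mpoly_vs.nontrivial_relation_mod_subspace[OF is_ideal_subspace[OF is_ideal_I] finT E(1) cardT wE])
      (rule that)
  have rel: "pscale (a None) h + \<theta> (\<lambda>q. \<Sum>b\<in>E. a (Some b) * \<psi> b q) \<in> I"
    using a(2) E(1) by (simp add: w_def \<theta> sum.reindex)
  have "a None \<noteq> 0"
  proof
    assume 0: "a None = 0"
    have "a (Some b) = 0" if b: "b \<in> E" for b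
    proof -
      have "(\<Sum>b'\<in>E. a (Some b') * \<psi> b' b) = 0"
        by (rule \<theta>_injective[OF dual]) (use rel 0 in simp)
      also have "(\<Sum>b'\<in>E. a (Some b') * \<psi> b' b) = (\<Sum>b'\<in>E. if b' = b then a (Some b') else 0)"
        using E(4) b by (intro sum.cong) auto
      finally show ?thesis using b E(1) by simp
    qed
    then show False using a(1) 0 by auto
  qed
  let ?a = "\<lambda>b. - a (Some b) / a None"
  have "pscale (1 / a None) (pscale (a None) h + \<theta> (\<lambda>q. \<Sum>b\<in>E. a (Some b) * \<psi> b q)) \<in> I"
    by (rule is_ideal_pscale[OF is_ideal_I rel])
  also have "pscale (1 / a None) (pscale (a None) h + \<theta> (\<lambda>q. \<Sum>b\<in>E. a (Some b) * \<psi> b q)) =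
      h - \<theta> (\<lambda>q. \<Sum>b\<in>E. ?a b * \<psi> b q)"
    unfolding \<theta> using \<open>a None \<noteq> 0\<close>
    by (simp add: mpoly_vs.scale_right_distrib mpoly_vs.scale_sum_right mpoly_vs.scale_minus_left sum_negf)
  finally show ?thesis by (rule that[OF dual])
qed

lemma socle:
  assumes "\<And>i. Var i * h \<in> I"
  obtains a where "h - pscale a \<delta> \<in> I"
proof -
  obtain \<psi> where \<psi>: "dual \<psi>" "h - \<theta> \<psi> \<in> I" by (rule \<theta>_surjective)
  have 0: "\<psi> (q * Var l) = 0" for q l
  proof -
    have "Var l * h - (Var l * (h - \<theta> \<psi>) + (Var l * \<theta> \<psi> - \<theta> (\<lambda>q. \<psi> (q * Var l)))) \<in> I"
      by (intro is_idealD(2,3)[OF is_ideal_I] is_ideal_mult[OF is_ideal_I] assms \<psi> \<theta>_Var)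
    then have "\<theta> (\<lambda>q. \<psi> (q * Var l)) \<in> I" by (simp add: algebra_simps)
    from \<theta>_injective[OF dual_mult[OF \<psi>(1)] this] show ?thesis .
  qed
  have "\<psi> (Poly_Mapping.single \<beta> 1) = 0" if \<beta>: "\<beta> \<noteq> 0" for \<beta>
  proof -
    obtain i where "Poly_Mapping.lookup \<beta> i > 0"
      using \<beta> by (metis gr0I lookup_zero poly_mapping_eqI)
    then obtain \<gamma> where "\<beta> = Poly_Mapping.single i 1 + \<gamma>" using exponent_pred by metis
    then have "Poly_Mapping.single \<beta> 1 = (Poly_Mapping.single \<gamma> 1 * Var i :: ('n, 'k) mpoly)"
      by (simp add: Var_def mult_single add.commute)
    then show ?thesis using 0 by simp
  qed
  then have "\<psi> q = \<psi> 1 * Poly_Mapping.lookup q 0" for q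
    using \<psi>(1) by (intro dual_eq_constant_coefficient) (simp_all add: dual_def)
  then have "\<psi> = (\<lambda>q. \<psi> 1 * Poly_Mapping.lookup q 0)" by (rule ext)
  then have "\<theta> \<psi> = \<theta> (\<lambda>q. \<psi> 1 * Poly_Mapping.lookup q 0)" by (rule arg_cong)
  also have "\<dots> = pscale (\<psi> 1) \<delta>" by (rule \<theta>_constant_coefficient)
  finally have "\<theta> \<psi> = pscale (\<psi> 1) \<delta>" .
  then show ?thesis using \<psi>(2) by (intro that[of "\<psi> 1"]) (simp only:)
qed

end

text \<open>The determinant of any matrix that expresses the generators through the variables is a socle element
  by Cramer's rule, and it is not zero, so it spans the one-dimensional socle.\<close>

lemma socle_generated_by_det:
  fixes c :: "'n::finite \<Rightarrow> ('n, 'k::field) mpoly"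
  assumes cD: "\<And>i. c i = (\<Sum>j\<in>UNIV. D i j * Var j)" and prim: "irrelevant_primary (ideal_gen (range c))"
    and h: "\<And>i. Var i * h \<in> ideal_gen (range c)"
  shows "\<exists>a. h - pscale a (mdet D) \<in> ideal_gen (range c)"
proof -
  have "\<forall>i. \<exists>E. Const (c i) - second_copy (c i) = (\<Sum>j\<in>UNIV. E j * (Const (Var j) - Var j))"
    using difference_quotients by blast
  from choice[OF this] obtain E
    where E: "\<forall>i. Const (c i) - second_copy (c i) = (\<Sum>j\<in>UNIV. E i j * (Const (Var j) - Var j))"
    by (rule exE)
  interpret bezoutian c E
  proof
    show "eval_at (\<lambda>_. 0) (c i) = 0" for i by (simp add: cD eval_at_sum)
  qed (use prim E in blast)+
  have "Var l * mdet D \<in> I" for l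
    by (rule mdet_cramer_ideal[OF is_ideal_I]) (auto simp: I_def cD[symmetric] intro: ideal_gen_base)
  then obtain b where b: "mdet D - pscale b \<delta> \<in> I" by (rule socle)
  have "b \<noteq> 0" using b det_notin_ideal[OF cD prim] by (auto simp: I_def)
  obtain a where a: "h - pscale a \<delta> \<in> I" using h by (auto simp flip: I_def intro: socle)
  have "(h - pscale a \<delta>) - pscale (a / b) (mdet D - pscale b \<delta>) \<in> I"
    by (intro is_idealD(3)[OF is_ideal_I] a is_ideal_pscale[OF is_ideal_I b])
  then have "h - pscale (a / b) (mdet D) \<in> I"
    using \<open>b \<noteq> 0\<close> by (simp add: mpoly_vs.scale_right_diff_distrib)
  then show ?thesis by (auto simp: I_def)
qed

section \<open>Duality and Hilbert functions of complete intersections\<close>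

text \<open>The Hilbert function of the quotient by \<open>I\<close>.\<close>

definition hilbert :: "('v, 'k::field) mpoly set \<Rightarrow> nat \<Rightarrow> nat" where
  "hilbert I q = proj_codim (forms q) (I \<inter> forms q)"

lemma dim_plus_hilbert:
  fixes I :: "('v::finite, 'k::field) mpoly set"
  shows "mpoly_vs.dim (I \<inter> forms q) + hilbert I q = mpoly_vs.dim (forms q :: ('v, 'k) mpoly set)"
  unfolding hilbert_def proj_codim_def
  using mpoly_vs.fin_dim_mono[OF fin_dim_forms, of "I \<inter> forms q" q] by simp

lemma hilbert_eq_0: "forms q \<subseteq> I \<Longrightarrow> hilbert I q = 0"
  by (simp add: hilbert_def proj_codim_def Int_absorb1)

lemma dim_forms_1: "mpoly_vs.dim (forms 1 :: ('v::finite, 'k::field) mpoly set) = CARD('v)"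
proof -
  have inj: "inj (Var :: 'v \<Rightarrow> ('v, 'k) mpoly)"
  proof (rule injI)
    fix i j :: 'v assume "(Var i :: ('v, 'k) mpoly) = Var j"
    from arg_cong[OF this, of "eval_at (\<lambda>l. if l = i then 1 else 0)"] show "i = j"
      by (simp split: if_splits)
  qed
  show ?thesis
  proof (rule mpoly_vs.dim_unique[of "range Var"])
    show "range Var \<subseteq> (forms 1 :: ('v, 'k) mpoly set)" by auto
    show "forms 1 \<subseteq> mpoly_vs.span (range (Var :: 'v \<Rightarrow> ('v, 'k) mpoly))"
    proof
      fix p :: "('v, 'k) mpoly" assume "p \<in> forms 1"
      then obtain g where g: "p = (\<Sum>i\<in>UNIV. g i * Var i)" "\<And>i. g i \<in> forms 0"
        using form_Suc_decomposition[of p 0] by auto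
      have "g i * Var i = pscale (eval_at (\<lambda>_. 0) (g i)) (Var i)" for i
        using form_0_eq_Const[OF g(2), of i "\<lambda>_. 0"] by (simp add: pscale_def)
      then show "p \<in> mpoly_vs.span (range Var)"
        unfolding g(1) by (simp only:) (intro mpoly_vs.span_sum mpoly_vs.span_scale mpoly_vs.span_base rangeI)
    qed
    show "mpoly_vs.independent (range (Var :: 'v \<Rightarrow> ('v, 'k) mpoly))"
    proof (rule mpoly_vs.independent_if_scalars_zero)
      fix f :: "('v, 'k) mpoly \<Rightarrow> 'k" and y :: "('v, 'k) mpoly"
      assume f: "(\<Sum>y\<in>range Var. pscale (f y) y) = 0" and "y \<in> range Var"
      then obtain i :: 'v where i: "y = Var i" by auto
      have "0 = eval_at (\<lambda>l. if l = i then 1 else 0) (\<Sum>j\<in>UNIV. pscale (f (Var j)) (Var j))"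
        using f inj by (simp add: sum.reindex)
      also have "\<dots> = (\<Sum>j\<in>UNIV. if j = i then f (Var j) else 0)"
        unfolding eval_at_sum by (rule sum.cong) auto
      finally show "f y = 0" by (simp add: i)
    qed simp
    show "card (range (Var :: 'v \<Rightarrow> ('v, 'k) mpoly)) = CARD('v)" using inj by (rule card_image)
  qed
qed

lemma mdet_form:
  assumes "\<And>i j. A i j \<in> forms (m i)"
  shows "mdet A \<in> forms (\<Sum>i\<in>UNIV. m i)"
  unfolding mdet_def
proof (rule forms_sum)
  fix p :: "'a \<Rightarrow> 'a"
  have "(\<Prod>i\<in>UNIV. A i (p i)) \<in> forms (\<Sum>i\<in>UNIV. m i)" by (rule forms_prod) (rule assms)
  then show "of_int (sign p) * (\<Prod>i\<in>UNIV. A i (p i)) \<in> forms (\<Sum>i\<in>UNIV. m i)"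
    by (cases rule: sign_cases[of p]) auto
qed

lemma forms_through_variables:
  fixes c :: "'n::finite \<Rightarrow> ('n, 'k::comm_ring_1) mpoly"
  assumes "\<And>i. c i \<in> forms (e i)" "\<And>i. e i \<ge> 1"
  obtains D where "\<And>i. c i = (\<Sum>j\<in>UNIV. D i j * Var j)" "\<And>i j. D i j \<in> forms (e i - 1)"
proof -
  have "\<exists>g. c i = (\<Sum>j\<in>UNIV. g j * Var j) \<and> (\<forall>j. g j \<in> forms (e i - 1))" for i
  proof -
    have "c i \<in> forms (Suc (e i - 1))" using assms[of i] by simp
    then show ?thesis using form_Suc_decomposition by metis
  qed
  then show ?thesis using that by metis
qed

text \<open>Forms as many as the variables whose ideal contains all forms of large degree: a complete
  intersection, and \<open>s\<close> is its socle degree.\<close>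

locale complete_intersection =
  fixes c :: "'n::finite \<Rightarrow> ('n, 'k::field) mpoly" and e :: "'n \<Rightarrow> nat"
  assumes c_forms: "\<And>i. c i \<in> forms (e i)" and e_pos: "\<And>i. e i \<ge> 1"
    and primary: "irrelevant_primary (ideal_gen (range c))"
begin

definition I where "I = ideal_gen (range c)"
definition s where "s = (\<Sum>i\<in>UNIV. e i - 1)"

lemma ideal_I: "is_ideal I" and homogeneous_I: "homogeneous I"
  using c_forms by (auto simp: I_def intro!: homogeneous_ideal_gen)

lemma socle_generator:
  obtains \<delta> where "\<delta> \<in> forms s" "\<delta> \<notin> I" "\<And>h. \<forall>i. Var i * h \<in> I \<Longrightarrow> \<exists>a. h - pscale a \<delta> \<in> I"
proof -
  obtain D where D: "\<And>i. c i = (\<Sum>j\<in>UNIV. D i j * Var j)" "\<And>i j. D i j \<in> forms (e i - 1)"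
    using forms_through_variables[of c e, OF c_forms e_pos] by blast
  show ?thesis
  proof (rule that)
    show "mdet D \<in> forms s" unfolding s_def by (rule mdet_form) (rule D(2))
    show "mdet D \<notin> I" unfolding I_def by (rule det_notin_ideal[OF D(1) primary])
    show "\<exists>a. h - pscale a (mdet D) \<in> I" if "\<forall>i. Var i * h \<in> I" for h
      unfolding I_def
      by (rule socle_generated_by_det[OF D(1) primary]) (rule that[unfolded I_def, THEN spec])
  qed
qed

text \<open>Every nonzero element of the quotient has a nonzero multiple in the socle, and the socle lives in
  degree \<open>s\<close>.\<close>

lemma pairing_nondegenerate:
  assumes "h \<in> forms q" "h \<notin> I"
  shows "q \<le> s \<and> (\<exists>p\<in>forms (s - q). p * h \<notin> I)"
proof -
  obtain \<delta> where \<delta>: "\<delta> \<in> forms s" "\<delta> \<notin> I" "\<And>h. \<forall>i. Var i * h \<in> I \<Longrightarrow> \<exists>a. h - pscale a \<delta> \<in> I"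
    by (rule socle_generator) (rule that)
  obtain p r where p: "p \<in> forms r" "p * h \<notin> I" "\<And>i. Var i * (p * h) \<in> I"
    using socle_multiple[OF ideal_I primary[folded I_def] assms(2,1)] by metis
  obtain a where a: "p * h - pscale a \<delta> \<in> I" using \<delta>(3) p(3) by blast
  have ph: "p * h \<in> forms (r + q)" using p(1) assms(1) by auto
  have "r + q = s"
  proof (rule ccontr)
    assume "r + q \<noteq> s"
    then have "hom_part (r + q) (p * h - pscale a \<delta>) = p * h"
      using hom_part_form[OF ph] hom_part_form[OF \<delta>(1)] by (simp add: hom_part_diff hom_part_pscale)
    moreover have "hom_part (r + q) (p * h - pscale a \<delta>) \<in> I"
      using a homogeneous_I by (auto simp: homogeneous_def)
    ultimately show False using p(2) by simp
  qed
  then have "r = s - q" "q \<le> s" by auto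
  then show ?thesis using p(1,2) by blast
qed

lemma forms_above_socle: "q > s \<Longrightarrow> forms q \<subseteq> I"
  using pairing_nondegenerate by (meson leD subsetI)

text \<open>
  The functional \<open>\<phi>\<close> identifies the quotient in degree \<open>s\<close> with the base field. The elements of degree
  \<open>q\<close> that are orthogonal to a basis \<open>W\<close> of the quotient in degree \<open>q'\<close> are in \<open>I\<close>, and orthogonality to
  \<open>W\<close> is \<open>card W\<close> linear conditions.
\<close>

lemma hilbert_le:
  assumes "q + q' = s"
  shows "hilbert I q \<le> hilbert I q'"
proof -
  obtain \<delta> where \<delta>: "\<delta> \<in> forms s" "\<delta> \<notin> I" "\<And>h. \<forall>i. Var i * h \<in> I \<Longrightarrow> \<exists>a. h - pscale a \<delta> \<in> I"
    by (rule socle_generator) (rule that)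
  obtain \<phi> where \<phi>: "mpoly_vs.functional \<phi>" "\<And>x. x \<in> I \<Longrightarrow> \<phi> x = 0" "\<phi> \<delta> = 1"
    by (rule mpoly_vs.separating_functional[OF is_ideal_subspace[OF ideal_I] \<delta>(2)]) (rule that)
  have \<phi>_zero: "u \<in> I" if u: "u \<in> forms s" "\<phi> u = 0" for u
  proof -
    have "\<forall>i. Var i * u \<in> I"
    proof
      fix i
      show "Var i * u \<in> I" using forms_above_socle[of "1 + s"] forms_mult[OF Var_in_forms u(1), of i] by auto
    qed
    then obtain a where a: "u - pscale a \<delta> \<in> I" using \<delta>(3) by blast
    then have "a = 0"
      using \<phi>(2)[OF a] u(2) \<phi>(3) by (simp add: mpoly_vs.functional_diff[OF \<phi>(1)] mpoly_vs.functional_scale[OF \<phi>(1)])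
    then show ?thesis using a by simp
  qed
  obtain W where W: "finite W" "W \<subseteq> forms q'"
    "card W + mpoly_vs.dim (I \<inter> forms q') = mpoly_vs.dim (forms q' :: ('n, 'k) mpoly set)"
    "\<And>v. v \<in> forms q' \<Longrightarrow> \<exists>r. v - (\<Sum>w\<in>W. pscale (r w) w) \<in> I \<inter> forms q'"
    by (rule mpoly_vs.complement_basis[OF subspace_forms fin_dim_forms subspace_ideal_forms[OF ideal_I] Int_lower2])
      (rule that)
  have cardW: "card W = hilbert I q'" using dim_plus_hilbert[of I q'] W(3) by simp
  let ?K = "{h \<in> forms q. \<forall>w\<in>W. \<phi> (h * w) = 0}"
  have "mpoly_vs.dim (forms q :: ('n, 'k) mpoly set) \<le> mpoly_vs.dim ?K + card W"
    using \<phi>(1)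
    by (intro mpoly_vs.dim_kernels_ge[THEN conjunct1] W(1) subspace_forms fin_dim_forms)
      (auto simp: mpoly_vs.functional_def distrib_right pscale_mult_left)
  moreover have "?K \<subseteq> I \<inter> forms q"
  proof safe
    fix h assume h: "h \<in> forms q" "\<forall>w\<in>W. \<phi> (h * w) = 0"
    have zero: "\<phi> (h * p) = 0" if p: "p \<in> forms q'" for p
    proof -
      obtain r where r: "p - (\<Sum>w\<in>W. pscale (r w) w) \<in> I" using W(4)[OF p] by blast
      have "h * p = h * (p - (\<Sum>w\<in>W. pscale (r w) w)) + (\<Sum>w\<in>W. pscale (r w) (h * w))"
        by (simp add: right_diff_distrib sum_distrib_left pscale_mult_right)
      then have "\<phi> (h * p) = (\<Sum>w\<in>W. r w * \<phi> (h * w))"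
        using \<phi>(2)[OF is_ideal_mult[OF ideal_I r, of h]]
        by (simp add: mpoly_vs.functional_add[OF \<phi>(1)] mpoly_vs.functional_sum[OF \<phi>(1)]
            mpoly_vs.functional_scale[OF \<phi>(1)])
      then show ?thesis using h(2) by simp
    qed
    show "h \<in> I"
    proof (rule ccontr)
      assume "h \<notin> I"
      then obtain p where p: "p \<in> forms (s - q)" "p * h \<notin> I" using pairing_nondegenerate[OF h(1)] by blast
      have "s - q = q'" using assms by linarith
      with p(1) have p': "p \<in> forms q'" by simp
      then have "h * p \<in> forms (q + q')" by (rule forms_mult[OF h(1)])
      then have "h * p \<in> I" using \<phi>_zero[OF _ zero[OF p']] assms by simp
      then show False using p(2) by (simp add: mult.commute)
    qed
  qed
  then have "mpoly_vs.dim ?K \<le> mpoly_vs.dim (I \<inter> forms q)"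
    by (intro mpoly_vs.fin_dim_mono fin_dim_subset_forms) auto
  ultimately show ?thesis using dim_plus_hilbert[of I q] cardW by simp
qed

lemma hilbert_symmetric: "q + q' = s \<Longrightarrow> hilbert I q = hilbert I q'"
  using hilbert_le[of q q'] hilbert_le[of q' q] by simp

end

text \<open>Multiplication by \<open>x\<^sup>b\<^sup>-\<^sup>1\<close> embeds the quotient by \<open>(g, x)\<close> into the quotient by \<open>(g, x\<^sup>b)\<close>: it is
  injective on the socle, since it sends one determinant to the other.\<close>

lemma ideal_with_power_cancel:
  fixes c :: "'n::finite \<Rightarrow> ('n, 'k::field) mpoly"
  assumes c: "\<And>i. c i \<in> forms (e i)" "\<And>i. e i \<ge> 1"
    and prim: "irrelevant_primary (ideal_gen (range c))"
    and prim': "irrelevant_primary (ideal_gen (range (c(i0 := c i0 ^ Suc b))))"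
    and h: "h \<in> forms q" "c i0 ^ b * h \<in> ideal_gen (range (c(i0 := c i0 ^ Suc b)))"
  shows "h \<in> ideal_gen (range c)"
proof (rule ccontr)
  let ?c' = "c(i0 := c i0 ^ Suc b)" and ?x = "c i0"
  let ?I = "ideal_gen (range c)" and ?I' = "ideal_gen (range ?c')"
  assume "h \<notin> ?I"
  then obtain p r where p: "p * h \<notin> ?I" "\<And>i. Var i * (p * h) \<in> ?I"
    using socle_multiple[OF is_ideal_ideal_gen prim _ h(1)] by metis
  obtain D where D: "\<And>i. c i = (\<Sum>j\<in>UNIV. D i j * Var j)" and "\<And>i j. D i j \<in> forms (e i - 1)"
    by (rule forms_through_variables[of c e, OF c]) (rule that)
  obtain a where a: "p * h - pscale a (mdet D) \<in> ?I"
    using socle_generated_by_det[OF D prim p(2)] by blast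
  have "a \<noteq> 0" using a p(1) by auto
  have xI: "?x ^ b * u \<in> ?I'" if u: "u \<in> ?I" for u
  proof -
    obtain d where d: "u = (\<Sum>j\<in>UNIV. d j * c j)" using u ideal_gen_image_iff[of UNIV u c] by auto
    have gen: "?c' j \<in> ?I'" for j by (rule ideal_gen_base) (rule rangeI)
    have cj: "?x ^ b * c j \<in> ?I'" for j
    proof (cases "j = i0")
      case True
      then show ?thesis using gen[of i0] by (simp add: mult.commute)
    next
      case False
      then show ?thesis using gen[of j] is_ideal_mult[OF is_ideal_ideal_gen] by (simp only: fun_upd_apply if_False)
    qed
    have "?x ^ b * u = (\<Sum>j\<in>UNIV. d j * (?x ^ b * c j))" by (simp add: d sum_distrib_left mult.left_commute)
    also have "\<dots> \<in> ?I'"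
      by (rule is_idealD(5)[OF is_ideal_ideal_gen]) (rule is_ideal_mult[OF is_ideal_ideal_gen cj])
    finally show ?thesis .
  qed
  have "p * (?x ^ b * h) - ?x ^ b * (p * h - pscale a (mdet D)) \<in> ?I'"
    by (rule is_idealD(3)[OF is_ideal_ideal_gen is_ideal_mult[OF is_ideal_ideal_gen h(2)] xI[OF a]])
  moreover have "p * (?x ^ b * h) - ?x ^ b * (p * h - pscale a (mdet D)) = pscale a (?x ^ b * mdet D)"
    by (simp add: right_diff_distrib pscale_mult_right mult.left_commute)
  ultimately have "pscale a (?x ^ b * mdet D) \<in> ?I'" by (simp only:)
  then have "?x ^ b * mdet D \<in> ?I'" using is_ideal_pscale_iff[OF is_ideal_ideal_gen \<open>a \<noteq> 0\<close>] by blast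
  then have "mdet (D(i0 := (\<lambda>j. ?x ^ b * D i0 j))) \<in> ?I'" by (simp add: mdet_row_scale)
  moreover have "?c' i = (\<Sum>j\<in>UNIV. (D(i0 := (\<lambda>j. ?x ^ b * D i0 j))) i j * Var j)" for i
  proof (cases "i = i0")
    case True
    have "?x ^ Suc b = ?x ^ b * (\<Sum>j\<in>UNIV. D i0 j * Var j)"
      unfolding D[symmetric] power_Suc by (rule mult.commute)
    then show ?thesis using True by (simp add: sum_distrib_left mult.assoc)
  qed (simp add: D[symmetric])
  ultimately show False using det_notin_ideal[OF _ prim'] by blast
qed

section \<open>The Hilbert function one below the top degree\<close>

text \<open>
  All but one of the \<open>g i\<close> together with the linear form \<open>x\<close> form a complete intersection. So \<open>G\<close>
  is the ideal of a one-dimensional complete intersection, and its quotients by the powers of \<open>x\<close>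
  are accessible to duality.
\<close>

locale parameter_system =
  fixes g :: "'n::finite \<Rightarrow> ('n, 'k::field) mpoly" and i0 :: 'n and x :: "('n, 'k) mpoly" and e :: nat
  assumes g_forms: "\<And>i. g i \<in> forms e" and e_ge_2: "e \<ge> 2" and x_form: "x \<in> forms 1"
    and primary: "irrelevant_primary (ideal_gen (range (g(i0 := x))))"
begin

definition G where "G = ideal_gen (g ` (UNIV - {i0}))"
definition C where "C a = ideal_gen (range (g(i0 := x ^ a)))"

lemma ideal_G: "is_ideal G" and homogeneous_G: "homogeneous G"
  using g_forms by (auto simp: G_def intro!: homogeneous_ideal_gen)

lemma C_eq_adjoin: "C a = adjoin G (x ^ a)"
proof
  have gen: "(g(i0 := x ^ a)) i \<in> C a" for i
    unfolding C_def by (rule ideal_gen_base) (rule rangeI)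
  show "C a \<subseteq> adjoin G (x ^ a)"
    unfolding C_def
  proof (rule ideal_gen_least[OF _ is_ideal_adjoin[OF ideal_G]])
    have "g i \<in> adjoin G (x ^ a)" if "i \<noteq> i0" for i
      using adjoin_superset[of G "x ^ a"] that by (auto simp: G_def intro: ideal_gen_base)
    then show "range (g(i0 := x ^ a)) \<subseteq> adjoin G (x ^ a)"
      using adjoin_self[OF ideal_G, of "x ^ a"] by auto
  qed
  have G: "G \<subseteq> C a"
    unfolding G_def
  proof (rule ideal_gen_least)
    show "g ` (UNIV - {i0}) \<subseteq> C a"
    proof (rule image_subsetI)
      fix i assume "i \<in> UNIV - {i0}"
      then have "i \<noteq> i0" by simp
      then show "g i \<in> C a" using gen[of i] by (simp only: fun_upd_apply if_False)
    qed
  qed (simp add: C_def)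
  have x: "x ^ a \<in> C a" using gen[of i0] by simp
  show "adjoin G (x ^ a) \<subseteq> C a"
  proof
    fix p assume "p \<in> adjoin G (x ^ a)"
    then obtain u h where uh: "p = u + h * x ^ a" "u \<in> G" by (auto simp: adjoin_def)
    have "is_ideal (C a)" by (simp add: C_def)
    moreover have "u \<in> C a" using G uh(2) by blast
    ultimately show "p \<in> C a"
      unfolding uh(1) using x by (intro is_idealD(2) is_ideal_mult)
  qed
qed

lemma is_ideal_C: "is_ideal (C a)"
  by (simp add: C_def)

lemma G_subset_C: "G \<subseteq> C a"
  unfolding C_eq_adjoin by (rule adjoin_superset)

lemma x_power_form: "x ^ a \<in> forms a"
  using forms_power[OF x_form, of a] by simp

lemma primary_C: "irrelevant_primary (C a)"
proof -
  have "irrelevant_primary (C 1)" using primary by (simp add: C_def)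
  then obtain N where N: "\<And>q. q \<ge> N \<Longrightarrow> forms q \<subseteq> C 1" by (auto simp: irrelevant_primary_def)
  show ?thesis
  proof (rule irrelevant_primary_Var_power[OF is_ideal_C])
    fix i
    have "Var i ^ N \<in> C 1" using N[of N] forms_power[OF Var_in_forms, of i N] by auto
    then obtain u h where uh: "Var i ^ N = u + h * x" "u \<in> G" by (auto simp: C_eq_adjoin adjoin_def)
    then have "(Var i ^ N) ^ a - (h * x) ^ a \<in> G" by (intro ideal_power_cong[OF ideal_G]) simp
    then have "((Var i ^ N) ^ a - (h * x) ^ a) + h ^ a * x ^ a \<in> C a"
      unfolding C_eq_adjoin by (rule adjoinI)
    then show "\<exists>M. Var i ^ M \<in> C a"
      by (intro exI[of _ "N * a"]) (simp add: power_mult power_mult_distrib)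
  qed
qed

lemma x_power_cancel:
  assumes "h \<in> forms q" "x ^ b * h \<in> C (Suc b)"
  shows "h \<in> C 1"
proof -
  let ?c = "g(i0 := x)"
  have c: "?c i \<in> forms (if i = i0 then 1 else e)" "(if i = i0 then 1 else e) \<ge> 1" for i
    using g_forms x_form e_ge_2 by auto
  have "?c(i0 := ?c i0 ^ Suc b) = g(i0 := x ^ Suc b)" by auto
  then have "h \<in> ideal_gen (range ?c)"
    using assms primary_C[of "Suc b"]
    by (intro ideal_with_power_cancel[of ?c "\<lambda>i. if i = i0 then 1 else e" i0 b, OF c primary])
      (simp_all add: C_def)
  then show ?thesis by (simp add: C_def)
qed

text \<open>\<open>x\<close> is a nonzerodivisor modulo \<open>G\<close>: by repeated cancellation a form \<open>h\<close> with \<open>x h \<in> G\<close> is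
  divisible modulo \<open>G\<close> by all powers of \<open>x\<close>, so it lies in \<open>G\<close> for reasons of degree.\<close>

lemma x_nonzerodivisor:
  assumes h: "h \<in> forms q" and xh: "x * h \<in> G"
  shows "h \<in> G"
proof -
  have "\<exists>h'\<in>forms (q - k). (k > q \<longrightarrow> h' = 0) \<and> h - x ^ k * h' \<in> G \<and> x ^ Suc k * h' \<in> G" for k
  proof (induction k)
    case 0
    then show ?case using h xh by (intro bexI[of _ h]) (simp_all add: is_idealD(1)[OF ideal_G])
  next
    case (Suc k)
    then obtain h' where h': "h' \<in> forms (q - k)" "k > q \<Longrightarrow> h' = 0" "h - x ^ k * h' \<in> G" "x ^ Suc k * h' \<in> G"
      by blast
    have "h' \<in> C 1" using h'(4) G_subset_C by (intro x_power_cancel[OF h'(1), of "Suc k"]) blast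
    then obtain u h'' where u: "h' = u + h'' * x" "u \<in> G" "h'' \<in> forms (q - k - 1)" "q - k < 1 \<Longrightarrow> h'' = 0"
      using form_in_adjoin[OF homogeneous_G x_form _ h'(1)] by (simp add: C_eq_adjoin) metis
    have "(h - x ^ k * h') + x ^ k * u \<in> G"
      by (intro is_idealD(2)[OF ideal_G] is_ideal_mult[OF ideal_G] h'(3) u(2))
    moreover have "(h - x ^ k * h') + x ^ k * u = h - x ^ Suc k * h''" by (simp add: u(1) algebra_simps)
    moreover have "x ^ Suc k * h' - x ^ Suc k * u \<in> G"
      by (intro is_idealD(3)[OF ideal_G] is_ideal_mult[OF ideal_G] h'(4) u(2))
    moreover have "x ^ Suc k * h' - x ^ Suc k * u = x ^ Suc (Suc k) * h''" by (simp add: u(1) algebra_simps)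
    ultimately show ?case using u(3,4) by (intro bexI[of _ h'']) auto
  qed
  from this[of "Suc q"] show ?thesis by auto
qed

lemma x_power_nonzerodivisor: "h \<in> forms q \<Longrightarrow> x ^ a * h \<in> G \<Longrightarrow> h \<in> G"
proof (induction a)
  case (Suc a)
  have "x ^ a * h \<in> forms (a + q)" by (intro forms_mult x_power_form Suc.prems)
  moreover have "x * (x ^ a * h) \<in> G" using Suc.prems(2) by (simp only: power_Suc mult.assoc)
  ultimately have "x ^ a * h \<in> G" by (rule x_nonzerodivisor)
  then show ?case by (rule Suc.IH[OF Suc.prems(1)])
qed simp

lemma subspace_G_forms: "mpoly_vs.subspace (G \<inter> forms q)"
  by (rule subspace_ideal_forms[OF ideal_G])

lemma hilbert_G_step:
  assumes "forms (Suc q) \<subseteq> C 1"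
  shows "hilbert G (Suc q) = hilbert G q"
proof -
  have "{x * v + w | v w. v \<in> forms q \<and> w \<in> G \<inter> forms (Suc q)} = forms (Suc q)"
  proof safe
    fix v w :: "('n, 'k) mpoly" assume "v \<in> forms q" "w \<in> forms (Suc q)"
    then show "x * v + w \<in> forms (Suc q)" using forms_mult[OF x_form] by auto
  next
    fix p :: "('n, 'k) mpoly" assume p: "p \<in> forms (Suc q)"
    then have "p \<in> adjoin G x" using assms by (auto simp: C_eq_adjoin)
    then obtain u h where "p = u + h * x" "u \<in> G" "u \<in> forms (Suc q)" "h \<in> forms (Suc q - 1)"
      using form_in_adjoin[OF homogeneous_G x_form _ p] by metis
    then show "\<exists>v w. p = x * v + w \<and> v \<in> forms q \<and> w \<in> G \<inter> forms (Suc q)"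
      by (intro exI[of _ h] exI[of _ u]) (simp add: algebra_simps)
  qed
  moreover have "{v \<in> forms q. x * v \<in> G \<inter> forms (Suc q)} = G \<inter> forms q"
    using x_nonzerodivisor forms_mult[OF x_form] is_ideal_mult[OF ideal_G] by auto
  ultimately have "mpoly_vs.dim (forms (Suc q) :: ('n, 'k) mpoly set) + mpoly_vs.dim (G \<inter> forms q) =
      mpoly_vs.dim (forms q :: ('n, 'k) mpoly set) + mpoly_vs.dim (G \<inter> forms (Suc q))"
    using mpoly_vs.dim_image_plus_subspace[OF subspace_forms[of q] fin_dim_forms
        subspace_G_forms[of "Suc q"] fin_dim_subset_forms, of "Suc q" "\<lambda>v. x * v"]
    by (simp add: distrib_left pscale_mult_right)
  then show ?thesis using dim_plus_hilbert[of G q] dim_plus_hilbert[of G "Suc q"] by linarith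
qed

lemma hilbert_G_stable:
  obtains N where "\<And>q. q \<ge> N \<Longrightarrow> hilbert G q = hilbert G N"
proof -
  obtain N where N: "\<And>q. q \<ge> N \<Longrightarrow> forms q \<subseteq> C 1"
    using primary_C[of 1] by (auto simp: irrelevant_primary_def)
  have "hilbert G q = hilbert G N" if "q \<ge> N" for q
    using that
  proof (induction q rule: dec_induct)
    case (step q)
    then show ?case using hilbert_G_step[OF N[of "Suc q"]] by simp
  qed simp
  then show ?thesis by (rule that)
qed

lemma C_forms_low:
  assumes "q < a"
  shows "C a \<inter> forms q = G \<inter> forms q"
proof safe
  fix p assume p: "p \<in> C a" "p \<in> forms q"
  then obtain u h where "p = u + h * x ^ a" "u \<in> G" "q < a \<Longrightarrow> h = 0"
    using form_in_adjoin[OF homogeneous_G x_power_form[of a] _ p(2)] by (simp add: C_eq_adjoin) metis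
  then show "p \<in> G" using assms by simp
qed (use G_subset_C in auto)

lemma hilbert_C_low: "q < a \<Longrightarrow> hilbert (C a) q = hilbert G q"
  by (simp add: hilbert_def C_forms_low)

lemma hilbert_C_high:
  assumes "a \<le> q"
  shows "hilbert (C a) q + hilbert G (q - a) = hilbert G q"
proof -
  have "{x ^ a * v + w | v w. v \<in> forms (q - a) \<and> w \<in> G \<inter> forms q} = C a \<inter> forms q"
  proof (intro equalityI subsetI)
    fix p assume "p \<in> {x ^ a * v + w | v w. v \<in> forms (q - a) \<and> w \<in> G \<inter> forms q}"
    then obtain v w where vw: "p = w + v * x ^ a" "v \<in> forms (q - a)" "w \<in> G" "w \<in> forms q"
      by (auto simp: algebra_simps)
    then have "x ^ a * v \<in> forms (a + (q - a))" by (intro forms_mult x_power_form)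
    then show "p \<in> C a \<inter> forms q"
      using vw assms adjoinI[OF vw(3)] by (auto simp: C_eq_adjoin mult.commute)
  next
    fix p assume p: "p \<in> C a \<inter> forms q"
    then have "p \<in> adjoin G (x ^ a)" "p \<in> forms q" by (simp_all add: C_eq_adjoin)
    then obtain u h where "p = u + h * x ^ a" "u \<in> G" "u \<in> forms q" "h \<in> forms (q - a)"
      by (rule form_in_adjoin[OF homogeneous_G x_power_form]) (rule that)
    then show "p \<in> {x ^ a * v + w | v w. v \<in> forms (q - a) \<and> w \<in> G \<inter> forms q}"
      by (intro CollectI exI[of _ h] exI[of _ u]) (simp add: algebra_simps)
  qed
  moreover have "{v \<in> forms (q - a). x ^ a * v \<in> G \<inter> forms q} = G \<inter> forms (q - a)"
    using x_power_nonzerodivisor forms_mult[OF x_power_form, of _ "q - a" a] is_ideal_mult[OF ideal_G] assms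
    by auto
  ultimately have "mpoly_vs.dim (C a \<inter> forms q) + mpoly_vs.dim (G \<inter> forms (q - a)) =
      mpoly_vs.dim (forms (q - a) :: ('n, 'k) mpoly set) + mpoly_vs.dim (G \<inter> forms q)"
    using mpoly_vs.dim_image_plus_subspace[OF subspace_forms[of "q - a"] fin_dim_forms
        subspace_G_forms[of q] fin_dim_subset_forms, of q "\<lambda>v. x ^ a * v"]
    by (simp add: distrib_left pscale_mult_right)
  then show ?thesis
    using dim_plus_hilbert[of G q] dim_plus_hilbert[of G "q - a"] dim_plus_hilbert[of "C a" q] by linarith
qed

text \<open>The socle degree of the quotient by \<open>C a\<close> is \<open>\<sigma> + (a - 1)\<close>.\<close>

definition \<sigma> where "\<sigma> = (CARD('n) - 1) * (e - 1)"

lemma duality: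
  assumes "a \<ge> 1"
  shows "q + q' = \<sigma> + (a - 1) \<Longrightarrow> hilbert (C a) q = hilbert (C a) q'"
    and "q > \<sigma> + (a - 1) \<Longrightarrow> forms q \<subseteq> C a"
    and "h \<in> forms q \<Longrightarrow> h \<notin> C a \<Longrightarrow> \<exists>p\<in>forms (\<sigma> + (a - 1) - q). p * h \<notin> C a"
proof -
  interpret ci: complete_intersection "g(i0 := x ^ a)" "\<lambda>i. if i = i0 then a else e"
    using primary_C[of a] g_forms x_power_form e_ge_2 assms by unfold_locales (auto simp: C_def)
  have I: "ci.I = C a" by (simp add: ci.I_def C_def)
  have "ci.s = (\<Sum>i\<in>UNIV - {i0}. e - 1) + (a - 1)"
    unfolding ci.s_def by (subst sum.remove[of UNIV i0]) auto
  then have s: "ci.s = \<sigma> + (a - 1)" by (simp add: \<sigma>_def card_Diff_singleton)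
  show "q + q' = \<sigma> + (a - 1) \<Longrightarrow> hilbert (C a) q = hilbert (C a) q'"
    using ci.hilbert_symmetric by (simp add: I s)
  show "q > \<sigma> + (a - 1) \<Longrightarrow> forms q \<subseteq> C a"
    using ci.forms_above_socle by (simp add: I s)
  show "h \<in> forms q \<Longrightarrow> h \<notin> C a \<Longrightarrow> \<exists>p\<in>forms (\<sigma> + (a - 1) - q). p * h \<notin> C a"
    using ci.pairing_nondegenerate by (simp add: I s)
qed

text \<open>
  The ideal \<open>J = adjoin G (g i0)\<close> of all \<open>g i\<close>, in the degree before its expected socle degree. Let \<open>a\<close>
  be large. By duality modulo \<open>C a\<close> the Hilbert function of \<open>G\<close> at \<open>\<sigma> + e - 2\<close> is its
  stable value, and at \<open>\<sigma> - 2\<close> it is smaller by the number of variables. Multiplication with \<open>g i0\<close>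
  is injective from degree \<open>\<sigma> - 2\<close> of the quotient by \<open>G\<close>: an element of the kernel is orthogonal,
  for the pairing modulo \<open>C a\<close>, to \<open>J\<close> and to \<open>x\<^sup>a\<close>, hence by hypothesis to everything.
\<close>

lemma hilbert_adjoin_below_top:
  assumes large: "\<And>a0. \<exists>a\<ge>a0. \<forall>u\<in>forms (Suc a). \<exists>j\<in>adjoin G (g i0). \<exists>l. u = j + x ^ a * l"
  shows "hilbert (adjoin G (g i0)) (CARD('n) * (e - 1) - 1) = CARD('n)"
proof -
  let ?n = "CARD('n)" and ?J = "adjoin G (g i0)"
  define m where "m = ?n * (e - 1) - 1"
  have n: "?n \<ge> 1" by (simp add: Suc_leI)
  have m: "m + 2 = \<sigma> + e"
    unfolding m_def \<sigma>_def using n e_ge_2 by (cases ?n; cases e) auto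
  obtain N where N: "\<And>q. q \<ge> N \<Longrightarrow> hilbert G q = hilbert G N" by (rule hilbert_G_stable) (rule that)
  obtain a where a: "a \<ge> N + e + m + \<sigma> + 2"
    "\<And>u. u \<in> forms (Suc a) \<Longrightarrow> \<exists>j\<in>?J. \<exists>l. u = j + x ^ a * l"
    using large by blast
  have a1: "a \<ge> 1" using a(1) by simp
  have G_low: "p = 0" if p: "p \<in> G" "p \<in> forms q" "q < e" for p q
  proof -
    have "p \<in> ideal_gen (g ` (UNIV - {i0}))" using p by (simp add: G_def)
    then obtain b where "p = (\<Sum>j\<in>UNIV - {i0}. b j * g j)" "\<And>j. q < e \<Longrightarrow> b j = 0"
      using form_in_ideal_gen[of "UNIV - {i0}" g "\<lambda>_. e" p q] g_forms p(2) by (metis finite)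
    then show ?thesis using p(3) by simp
  qed
  have hG1: "hilbert G 1 = ?n"
  proof -
    have "G \<inter> forms 1 = {0}" using G_low[of _ 1] e_ge_2 is_idealD(1)[OF ideal_G] by auto
    moreover have "mpoly_vs.dim {0 :: ('n, 'k) mpoly} = 0"
      using mpoly_vs.dim_le_card[of "{0}" "{}"] by simp
    ultimately show ?thesis
      using dim_plus_hilbert[of G 1] dim_forms_1[where 'v = 'n and 'k = 'k] by simp
  qed
  have hGm: "hilbert G m = hilbert G N"
  proof -
    have "hilbert G m = hilbert (C a) m" using a(1) by (intro hilbert_C_low[symmetric]) simp
    also have "\<dots> = hilbert (C a) (a + 1 - e)" using a(1) m e_ge_2 by (intro duality(1)[OF a1]) simp
    also have "\<dots> = hilbert G (a + 1 - e)" using e_ge_2 a(1) by (intro hilbert_C_low) simp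
    also have "\<dots> = hilbert G N" using a(1) by (intro N) simp
    finally show ?thesis .
  qed
  have hCa: "hilbert (C a) (a + 1) + ?n = hilbert G N"
    using hilbert_C_high[of a "a + 1"] hG1 N[of "a + 1"] a(1) by simp
  show ?thesis
  proof (cases "\<sigma> \<ge> 2")
    \<comment> \<open>here \<open>m < e\<close>, so \<open>J\<close> and \<open>G\<close> agree in degree \<open>m\<close>\<close>
    case False
    then have "forms (a + 1) \<subseteq> C a" using a1 by (intro duality(2)[OF a1]) simp
    then have "hilbert (C a) (a + 1) = 0" by (rule hilbert_eq_0)
    then have "hilbert G m = ?n" using hCa hGm by simp
    moreover have "?J \<inter> forms m = G \<inter> forms m"
    proof safe
      fix p assume p: "p \<in> ?J" "p \<in> forms m"
      then obtain u h where "p = u + h * g i0" "u \<in> G" "m < e \<Longrightarrow> h = 0"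
        using form_in_adjoin[OF homogeneous_G g_forms[of i0] p] by metis
      then show "p \<in> G" using False m by simp
    qed (use adjoin_superset in blast)
    ultimately show ?thesis by (simp add: hilbert_def m_def)
  next
    case True
    have me: "m - e = \<sigma> - 2" "e \<le> m" using m True by auto
    have hG\<sigma>: "hilbert G (\<sigma> - 2) = hilbert (C a) (a + 1)"
    proof -
      have "hilbert G (\<sigma> - 2) = hilbert (C a) (\<sigma> - 2)" using a(1) by (intro hilbert_C_low[symmetric]) simp
      also have "\<dots> = hilbert (C a) (a + 1)" using a1 True by (intro duality(1)[OF a1]) simp
      finally show ?thesis .
    qed
    have inj: "h \<in> G" if h: "h \<in> forms (\<sigma> - 2)" "g i0 * h \<in> G" for h
    proof (rule ccontr)
      assume "h \<notin> G"
      moreover have "\<sigma> - 2 < a" using a(1) by linarith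
      then have "C a \<inter> forms (\<sigma> - 2) = G \<inter> forms (\<sigma> - 2)" by (rule C_forms_low)
      ultimately have "h \<notin> C a" using h(1) by blast
      then obtain p where p: "p \<in> forms (\<sigma> + (a - 1) - (\<sigma> - 2))" "p * h \<notin> C a"
        using duality(3)[OF a1 h(1)] by blast
      have "\<sigma> + (a - 1) - (\<sigma> - 2) = Suc a" using True a1 by simp
      with p(1) obtain j l where jl: "j \<in> ?J" "p = j + x ^ a * l" using a(2)[of p] by auto
      obtain u v where uv: "u \<in> G" "j = u + v * g i0" using jl(1) by (auto simp: adjoin_def)
      have "p * h = (h * u + v * (g i0 * h)) + (l * h) * x ^ a" by (simp add: jl(2) uv(2) algebra_simps)
      also have "\<dots> \<in> C a"
        unfolding C_eq_adjoin
        by (intro adjoinI is_idealD(2)[OF ideal_G] is_ideal_mult[OF ideal_G] uv(1) h(2))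
      finally show False using p(2) by simp
    qed
    have "{g i0 * v + w | v w. v \<in> forms (\<sigma> - 2) \<and> w \<in> G \<inter> forms m} = ?J \<inter> forms m"
    proof (intro equalityI subsetI)
      fix p assume "p \<in> {g i0 * v + w | v w. v \<in> forms (\<sigma> - 2) \<and> w \<in> G \<inter> forms m}"
      then obtain v w where vw: "p = w + v * g i0" "v \<in> forms (\<sigma> - 2)" "w \<in> G" "w \<in> forms m"
        by (auto simp: algebra_simps)
      then have "g i0 * v \<in> forms (e + (\<sigma> - 2))" by (intro forms_mult g_forms)
      moreover have "e + (\<sigma> - 2) = m" using m True by simp
      ultimately show "p \<in> ?J \<inter> forms m"
        using vw adjoinI[OF vw(3)] by (auto simp: mult.commute)
    next
      fix p assume p: "p \<in> ?J \<inter> forms m"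
      then have "p \<in> ?J" "p \<in> forms m" by simp_all
      then obtain u h where "p = u + h * g i0" "u \<in> G" "u \<in> forms m" "h \<in> forms (m - e)"
        by (rule form_in_adjoin[OF homogeneous_G g_forms]) (rule that)
      then show "p \<in> {g i0 * v + w | v w. v \<in> forms (\<sigma> - 2) \<and> w \<in> G \<inter> forms m}"
        using me(1) by (intro CollectI exI[of _ h] exI[of _ u]) (simp add: algebra_simps)
    qed
    moreover have "{v \<in> forms (\<sigma> - 2). g i0 * v \<in> G \<inter> forms m} = G \<inter> forms (\<sigma> - 2)"
    proof -
      have "g i0 * v \<in> forms m" if "v \<in> forms (\<sigma> - 2)" for v
      proof -
        have "e + (\<sigma> - 2) = m" using m True by linarith
        then show ?thesis using forms_mult[OF g_forms that, of i0] by simp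
      qed
      then show ?thesis using inj is_ideal_mult[OF ideal_G] by blast
    qed
    ultimately have "mpoly_vs.dim (?J \<inter> forms m) + mpoly_vs.dim (G \<inter> forms (\<sigma> - 2)) =
        mpoly_vs.dim (forms (\<sigma> - 2) :: ('n, 'k) mpoly set) + mpoly_vs.dim (G \<inter> forms m)"
      using mpoly_vs.dim_image_plus_subspace[OF subspace_forms[of "\<sigma> - 2"] fin_dim_forms
          subspace_G_forms[of m] fin_dim_subset_forms, of m "\<lambda>v. g i0 * v"]
      by (simp add: distrib_left pscale_mult_right)
    then have "hilbert ?J m + hilbert G (\<sigma> - 2) = hilbert G m"
      using dim_plus_hilbert[of G m] dim_plus_hilbert[of G "\<sigma> - 2"] dim_plus_hilbert[of ?J m] by linarith
    then show ?thesis using hG\<sigma> hCa hGm by (simp add: m_def)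
  qed
qed

end

section \<open>General combinations of the generators\<close>

text \<open>Base-\<open>L\<close> expansions as a substitution: all variables become powers of a single one.\<close>

fun digit_sum :: "nat \<Rightarrow> 'a list \<Rightarrow> ('a \<Rightarrow> nat) \<Rightarrow> nat" where
  "digit_sum L [] \<beta> = 0"
| "digit_sum L (x # xs) \<beta> = \<beta> x + L * digit_sum L xs \<beta>"

lemma digit_sum_inject:
  assumes "\<And>x. \<beta> x < L" "\<And>x. \<beta>' x < L" "digit_sum L xs \<beta> = digit_sum L xs \<beta>'" "x \<in> set xs"
  shows "\<beta> x = \<beta>' x"
  using assms(3,4)
proof (induction xs)
  case (Cons y xs)
  have "(\<beta> y + L * digit_sum L xs \<beta>) mod L = \<beta> y" "(\<beta>' y + L * digit_sum L xs \<beta>') mod L = \<beta>' y"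
    using assms(1,2) by simp_all
  then have y: "\<beta> y = \<beta>' y" using Cons.prems(1) by (metis digit_sum.simps(2))
  moreover have "L > 0" using assms(1)[of y] by simp
  ultimately have "digit_sum L xs \<beta> = digit_sum L xs \<beta>'" using Cons.prems(1) by simp
  then show ?case using Cons y by auto
qed simp

lemma power_digit_sum:
  fixes t :: "'k::field"
  assumes "t \<noteq> 0" "distinct xs"
  shows "\<exists>c. (\<forall>x. c x \<noteq> 0) \<and> (\<forall>\<beta>. t ^ digit_sum L xs \<beta> = (\<Prod>x\<in>set xs. c x ^ \<beta> x))"
  using assms
proof (induction xs arbitrary: t)
  case Nil
  then show ?case by (intro exI[of _ "\<lambda>_. 1"]) simp
next
  case (Cons y xs)
  obtain c where c: "\<forall>x. c x \<noteq> 0" "\<forall>\<beta>. (t ^ L) ^ digit_sum L xs \<beta> = (\<Prod>x\<in>set xs. c x ^ \<beta> x)"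
    using Cons.IH[of "t ^ L"] Cons.prems by auto
  have "(\<Prod>x\<in>set (y # xs). (c(y := t)) x ^ \<beta> x) = t ^ \<beta> y * (\<Prod>x\<in>set xs. c x ^ \<beta> x)" for \<beta>
  proof -
    have "(\<Prod>x\<in>set xs. (c(y := t)) x ^ \<beta> x) = (\<Prod>x\<in>set xs. c x ^ \<beta> x)"
      using Cons.prems(2) by (intro prod.cong) auto
    then show ?thesis using Cons.prems(2) by simp
  qed
  then show ?case
    using c Cons.prems(1) by (intro exI[of _ "c(y := t)"]) (simp add: power_add power_mult)
qed

text \<open>A nonzero polynomial, with exponents below \<open>L\<close>, has a nonzero value at a point without zero coordinates.
  The substitution by powers of one variable keeps its monomials apart.\<close>

lemma nonvanishing_point:
  fixes a :: "('n::finite \<Rightarrow> nat) \<Rightarrow> 'k::field_char_0"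
  assumes "finite T" "\<And>\<beta> x. \<beta> \<in> T \<Longrightarrow> \<beta> x < L" "\<gamma> \<in> T" "a \<gamma> \<noteq> 0"
  obtains c where "\<And>i. c i \<noteq> 0" "(\<Sum>\<beta>\<in>T. a \<beta> * (\<Prod>i\<in>UNIV. c i ^ \<beta> i)) \<noteq> 0"
proof -
  obtain xs :: "'n list" where xs: "set xs = UNIV" "distinct xs"
    using finite_distinct_list[of "UNIV :: 'n set"] by auto
  let ?w = "digit_sum L xs"
  have inj: "\<beta> = \<gamma>" if \<beta>: "\<beta> \<in> T" "?w \<beta> = ?w \<gamma>" for \<beta>
  proof
    fix x
    show "\<beta> x = \<gamma> x"
      by (rule digit_sum_inject[OF _ _ \<beta>(2)]) (use assms \<beta>(1) xs in auto)
  qed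
  define Q where "Q = (\<Sum>\<beta>\<in>T. monom (a \<beta>) (?w \<beta>))"
  have "coeff Q (?w \<gamma>) = (\<Sum>\<beta>\<in>T. if \<beta> = \<gamma> then a \<beta> else 0)"
    unfolding Q_def coeff_sum coeff_monom using inj by (intro sum.cong) auto
  then have "coeff Q (?w \<gamma>) \<noteq> 0" using assms by simp
  then have "Q \<noteq> 0" by auto
  then have "finite {t. poly ([:0, 1:] * Q) t = 0}" by (intro poly_roots_finite) simp
  then obtain t where "poly ([:0, 1:] * Q) t \<noteq> 0"
    using infinite_UNIV_char_0[where 'a = 'k] by (metis (mono_tags) UNIV_eq_I mem_Collect_eq)
  then have t: "t \<noteq> 0" "poly Q t \<noteq> 0" by auto
  obtain c where c: "\<forall>x. c x \<noteq> 0" "\<forall>\<beta>. t ^ ?w \<beta> = (\<Prod>x\<in>set xs. c x ^ \<beta> x)"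
    using power_digit_sum[OF t(1) xs(2)] by blast
  have "poly Q t = (\<Sum>\<beta>\<in>T. a \<beta> * (\<Prod>i\<in>UNIV. c i ^ \<beta> i))"
    using c(2) by (simp add: Q_def poly_sum poly_monom xs(1))
  then show ?thesis using that[of c] c(1) t(2) by simp
qed

text \<open>For counting monomials after the variable \<open>i\<close> has been eliminated.\<close>

definition box_polys :: "'v \<Rightarrow> nat \<Rightarrow> ('v, 'k::comm_ring_1) mpoly set" where
  "box_polys i B = {p. \<forall>\<alpha>. Poly_Mapping.lookup p \<alpha> \<noteq> 0 \<longrightarrow>
     Poly_Mapping.lookup \<alpha> i = 0 \<and> (\<forall>l. Poly_Mapping.lookup \<alpha> l \<le> B)}"

lemma box_polys_mono: "p \<in> box_polys i B \<Longrightarrow> B \<le> B' \<Longrightarrow> p \<in> box_polys i B'"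
  by (auto simp: box_polys_def intro: order_trans)

lemma box_polys_add: "p \<in> box_polys i B \<Longrightarrow> q \<in> box_polys i B \<Longrightarrow> p + q \<in> box_polys i B"
  unfolding box_polys_def mem_Collect_eq lookup_add by (metis add_0)

lemma box_polys_sum: "(\<And>a. a \<in> A \<Longrightarrow> h a \<in> box_polys i B) \<Longrightarrow> sum h A \<in> box_polys i B"
  by (induction A rule: infinite_finite_induct) (auto simp: box_polys_add, auto simp: box_polys_def)

lemma box_polys_mult:
  assumes "p \<in> box_polys i B" "q \<in> box_polys i B'"
  shows "p * q \<in> box_polys i (B + B')"
proof -
  have "Poly_Mapping.lookup \<alpha> i = 0 \<and> (\<forall>l. Poly_Mapping.lookup \<alpha> l \<le> B + B')"
    if \<alpha>: "\<alpha> \<in> Poly_Mapping.keys (p * q)" for \<alpha>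
  proof -
    obtain \<beta> \<gamma> where "\<alpha> = \<beta> + \<gamma>" "\<beta> \<in> Poly_Mapping.keys p" "\<gamma> \<in> Poly_Mapping.keys q"
      using keys_mult[of p q] \<alpha> by blast
    then show ?thesis using assms by (auto simp: box_polys_def in_keys_iff lookup_add add_mono)
  qed
  then show ?thesis by (auto simp: box_polys_def in_keys_iff)
qed

lemma box_polys_Const: "Const a \<in> box_polys i 0"
  by (auto simp: box_polys_def Const_def lookup_single when_def)

lemma box_polys_power: "p \<in> box_polys i B \<Longrightarrow> p ^ t \<in> box_polys i (t * B)"
proof (induction t)
  case 0
  then show ?case using box_polys_Const[of 1] by simp
qed (auto intro: box_polys_mult)

lemma box_polys_prod: "(\<And>a. a \<in> A \<Longrightarrow> h a \<in> box_polys i (B a)) \<Longrightarrow> prod h A \<in> box_polys i (sum B A)"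
  using box_polys_Const[of 1 i]
  by (induction A rule: infinite_finite_induct) (auto intro: box_polys_mult)

lemma box_polys_subset_span:
  obtains M where "finite M" "card M \<le> Suc B ^ (CARD('v) - 1)"
    "(box_polys i B :: ('v::finite, 'k::field) mpoly set) \<subseteq> mpoly_vs.span M"
proof -
  let ?E = "{\<alpha> :: 'v \<Rightarrow>\<^sub>0 nat. Poly_Mapping.lookup \<alpha> i = 0 \<and> (\<forall>l. Poly_Mapping.lookup \<alpha> l \<le> B)}"
  let ?P = "(UNIV - {i}) \<rightarrow>\<^sub>E {..B}"
  have inj: "inj_on (\<lambda>\<alpha>. restrict (Poly_Mapping.lookup \<alpha>) (UNIV - {i})) ?E"
  proof (rule inj_onI, rule poly_mapping_eqI)
    fix \<alpha> \<beta> l assume "\<alpha> \<in> ?E" "\<beta> \<in> ?E"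
      "restrict (Poly_Mapping.lookup \<alpha>) (UNIV - {i}) = restrict (Poly_Mapping.lookup \<beta>) (UNIV - {i})"
    then show "Poly_Mapping.lookup \<alpha> l = Poly_Mapping.lookup \<beta> l"
      by (cases "l = i") (auto dest: fun_cong[where x = l])
  qed
  have sub: "(\<lambda>\<alpha>. restrict (Poly_Mapping.lookup \<alpha>) (UNIV - {i})) ` ?E \<subseteq> ?P"
    by (auto simp: restrict_def split: if_split_asm)
  have finP: "finite ?P" by (simp add: finite_PiE)
  have finE: "finite ?E" using inj finite_subset[OF sub finP] by (rule finite_imageD[rotated])
  have "card ?E \<le> card ?P" by (rule card_inj_on_le[OF inj sub finP])
  also have "card ?P = Suc B ^ (CARD('v) - 1)" by (simp add: card_PiE)
  finally have cardE: "card ?E \<le> Suc B ^ (CARD('v) - 1)" .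
  let ?M = "(\<lambda>\<alpha>. Poly_Mapping.single \<alpha> 1) ` ?E :: ('v, 'k) mpoly set"
  show ?thesis
  proof (rule that[of ?M])
    show "finite ?M" using finE by simp
    show "card ?M \<le> Suc B ^ (CARD('v) - 1)" using card_image_le[OF finE] cardE by (rule order_trans)
    show "box_polys i B \<subseteq> mpoly_vs.span ?M"
    proof
      fix p :: "('v, 'k) mpoly" assume p: "p \<in> box_polys i B"
      have "p = (\<Sum>\<alpha>\<in>Poly_Mapping.keys p. pscale (Poly_Mapping.lookup p \<alpha>) (Poly_Mapping.single \<alpha> 1))"
        unfolding pscale_single mult_1_right by (rule poly_mapping_eq_sum_single)
      also have "\<dots> \<in> mpoly_vs.span ?M"
        using p by (intro mpoly_vs.span_sum mpoly_vs.span_scale mpoly_vs.span_base)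
          (auto simp: box_polys_def in_keys_iff)
      finally show "p \<in> mpoly_vs.span ?M" .
    qed
  qed
qed

lemma eval_at_linear_form:
  fixes x :: "('v::finite, 'k::comm_ring_1) mpoly"
  assumes "x \<in> forms 1"
  obtains \<xi> where "x = (\<Sum>l\<in>UNIV. Const (\<xi> l) * Var l)" "\<And>v. eval_at v x = (\<Sum>l\<in>UNIV. \<xi> l * v l)"
proof -
  obtain g where g: "x = (\<Sum>i\<in>UNIV. g i * Var i)" "\<And>i. g i \<in> forms 0"
    using form_Suc_decomposition[of x 0] assms by auto
  have "g i = Const (eval_at (\<lambda>_. 0) (g i))" for i by (rule form_0_eq_Const[OF g(2)])
  then have "x = (\<Sum>l\<in>UNIV. Const (eval_at (\<lambda>_. 0) (g l)) * Var l)" using g(1) by simp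
  then show ?thesis by (intro that[of "\<lambda>l. eval_at (\<lambda>_. 0) (g l)"]) (simp_all add: eval_at_sum)
qed

text \<open>
  On a hyperplane, which has one dimension less, \<open>n\<close> forms in \<open>n\<close> variables are algebraically
  dependent: there are more monomials in the forms, with exponents below \<open>L\<close>, than monomials of
  the degrees that occur. So the values of the forms on the hyperplane miss a point.
\<close>

lemma forms_on_hyperplane_miss_point:
  fixes f :: "'n::finite \<Rightarrow> ('n, 'k::field_char_0) mpoly"
  assumes f: "\<And>i. f i \<in> forms e" and x: "x \<in> forms 1" "x \<noteq> 0"
  obtains c where "\<And>i. c i \<noteq> 0" "\<And>v. eval_at v x = 0 \<Longrightarrow> \<exists>i. eval_at v (f i) \<noteq> c i"
proof -
  obtain \<xi> where \<xi>: "x = (\<Sum>l\<in>UNIV. Const (\<xi> l) * Var l)" "\<And>v. eval_at v x = (\<Sum>l\<in>UNIV. \<xi> l * v l)"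
    by (rule eval_at_linear_form[OF x(1)]) (rule that)
  have "\<exists>i1. \<xi> i1 \<noteq> 0"
  proof (rule ccontr)
    assume "\<nexists>i1. \<xi> i1 \<noteq> 0"
    then show False using \<xi>(1) x(2) by simp
  qed
  then obtain i1 where i1: "\<xi> i1 \<noteq> 0" by blast
  \<comment> \<open>eliminate the variable \<open>i1\<close> by means of \<open>x\<close>\<close>
  define s where "s l = (if l = i1 then (\<Sum>l\<in>UNIV - {i1}. Const (- \<xi> l / \<xi> i1) * Var l) else Var l)" for l
  have Var_box: "(Var l :: ('n, 'k) mpoly) \<in> box_polys i1 1" if "l \<noteq> i1" for l
    using that by (auto simp: box_polys_def Var_def lookup_single when_def)
  have s_box: "s l \<in> box_polys i1 1" for l
  proof (cases "l = i1")
    case True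
    have "Const (- \<xi> l / \<xi> i1) * Var l \<in> box_polys i1 (0 + 1)" if "l \<in> UNIV - {i1}" for l
      using that by (intro box_polys_mult box_polys_Const Var_box) simp
    then show ?thesis using True by (auto simp: s_def intro!: box_polys_sum)
  next
    case False
    then show ?thesis using Var_box[OF False] by (simp only: s_def if_False)
  qed
  have s_eval: "eval_at v (subst s p) = eval_at v p" if v: "eval_at v x = 0" for v p
  proof -
    have "eval_at v (s l) = v l" for l
    proof (cases "l = i1")
      case True
      have "0 = \<xi> i1 * v i1 + (\<Sum>l\<in>UNIV - {i1}. \<xi> l * v l)"
        using v unfolding \<xi>(2) by (subst (asm) sum.remove[of UNIV i1]) simp_all
      then have "v i1 = (\<Sum>l\<in>UNIV - {i1}. - \<xi> l / \<xi> i1 * v l)"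
        using i1 by (simp add: field_simps sum_negf sum_divide_distrib[symmetric] eq_neg_iff_add_eq_0)
      then show ?thesis using True by (simp add: s_def eval_at_sum)
    qed (simp add: s_def)
    then show ?thesis by (simp add: eval_at_subst)
  qed
  have subst_box: "subst s p \<in> box_polys i1 q" if "p \<in> forms q" for p q
    using that
  proof (induction q arbitrary: p)
    case 0
    then show ?case using form_0_eq_Const[OF 0, of "\<lambda>_. 0"] box_polys_Const by (metis subst_Const)
  next
    case (Suc q)
    obtain g where g: "p = (\<Sum>i\<in>UNIV. g i * Var i)" "\<And>i. g i \<in> forms q"
      using form_Suc_decomposition[OF Suc(2)] by metis
    have subst_0: "subst s 0 = (0 :: ('n, 'k) mpoly)" using subst_Const[of s 0] by simp
    have "subst s p = (\<Sum>i\<in>UNIV. subst s (g i) * s i)"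
      by (simp add: g(1) additive_sum[of "subst s", OF subst_0])
    also have "\<dots> \<in> box_polys i1 (q + 1)"
      by (intro box_polys_sum box_polys_mult Suc.IH g(2) s_box)
    finally show ?case by simp
  qed
  let ?n = "CARD('n)"
  \<comment> \<open>With exponents below \<open>L\<close> there are \<open>L\<^sup>n\<close> monomials in the forms. They lie in a space of dimension
    at most \<open>(B + 1)\<^sup>n\<^sup>-\<^sup>1 \<le> ((n e + 1) L)\<^sup>n\<^sup>-\<^sup>1\<close>, which is smaller for this \<open>L\<close>.\<close>
  define L where "L = Suc (Suc (?n * e) ^ (?n - 1))"
  define B where "B = ?n * L * e"
  define T where "T = (UNIV :: 'n set) \<rightarrow>\<^sub>E {..<L}"
  define w where "w \<beta> = (\<Prod>i\<in>UNIV. subst s (f i) ^ \<beta> i)" for \<beta> :: "'n \<Rightarrow> nat"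
  have finT: "finite T" by (simp add: T_def finite_PiE)
  have Tlt: "\<beta> x < L" if "\<beta> \<in> T" for \<beta> x using that by (auto simp: T_def PiE_def Pi_def)
  obtain M where M: "finite M" "card M \<le> Suc B ^ (?n - 1)"
    "(box_polys i1 B :: ('n, 'k) mpoly set) \<subseteq> mpoly_vs.span M"
    by (rule box_polys_subset_span) (rule that)
  have n: "?n \<ge> 1" by (simp add: Suc_leI)
  have "Suc B ^ (?n - 1) < L ^ ?n"
  proof -
    have "Suc B \<le> Suc (?n * e) * L" by (simp add: B_def L_def algebra_simps)
    then have "Suc B ^ (?n - 1) \<le> Suc (?n * e) ^ (?n - 1) * L ^ (?n - 1)"
      by (metis power_mono power_mult_distrib zero_le)
    also have "\<dots> < L * L ^ (?n - 1)" by (simp add: L_def)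
    also have "\<dots> = L ^ ?n" using n by (simp flip: power_Suc)
    finally show ?thesis .
  qed
  moreover have "card T = L ^ ?n" by (simp add: T_def card_PiE)
  ultimately have card: "card M < card T" using M(2) by linarith
  have w_span: "\<exists>i\<in>{0}. \<exists>u\<in>mpoly_vs.span M. w \<beta> = u + i" if \<beta>: "\<beta> \<in> T" for \<beta>
  proof -
    have "w \<beta> \<in> box_polys i1 (\<Sum>i\<in>UNIV. \<beta> i * e)"
      unfolding w_def by (intro box_polys_prod box_polys_power subst_box f)
    moreover have "(\<Sum>i\<in>UNIV. \<beta> i * e) \<le> B"
    proof -
      have "(\<Sum>i\<in>UNIV. \<beta> i * e) \<le> (\<Sum>i\<in>(UNIV :: 'n set). L * e)"
        using Tlt[OF \<beta>] by (intro sum_mono mult_le_mono1) (simp add: less_imp_le)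
      then show ?thesis by (simp add: B_def mult.assoc)
    qed
    ultimately have "w \<beta> \<in> box_polys i1 B" by (rule box_polys_mono)
    then show ?thesis using M(3) by auto
  qed
  obtain a where a: "\<exists>\<beta>\<in>T. a \<beta> \<noteq> 0" "(\<Sum>\<beta>\<in>T. pscale (a \<beta>) (w \<beta>)) \<in> {0}"
    by (rule mpoly_vs.nontrivial_relation_mod_subspace[OF mpoly_vs.subspace_single_0 finT M(1) card w_span])
      (assumption, rule that)
  then obtain \<beta>0 where \<beta>0: "\<beta>0 \<in> T" "a \<beta>0 \<noteq> 0" by blast
  obtain c where c: "\<And>i. c i \<noteq> 0" "(\<Sum>\<beta>\<in>T. a \<beta> * (\<Prod>i\<in>UNIV. c i ^ \<beta> i)) \<noteq> 0"
    by (rule nonvanishing_point[of T L \<beta>0 a, OF finT _ \<beta>0]) (erule Tlt, rule that)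
  show ?thesis
  proof (rule that[OF c(1)], rule ccontr)
    fix v assume v: "eval_at v x = 0" "\<nexists>i. eval_at v (f i) \<noteq> c i"
    have "0 = eval_at v (\<Sum>\<beta>\<in>T. pscale (a \<beta>) (w \<beta>))" using a(2) by simp
    also have "\<dots> = (\<Sum>\<beta>\<in>T. a \<beta> * (\<Prod>i\<in>UNIV. c i ^ \<beta> i))"
      using v(2) by (simp add: eval_at_sum w_def eval_at_prod s_eval[OF v(1)])
    finally show False using c(2) by simp
  qed
qed

text \<open>If \<open>n\<close> forms of the same degree have no common zero on the hyperplane \<open>x = 0\<close>, then \<open>n - 1\<close> of
  their linear combinations have none either. The combinations are those whose vector of coefficients
  is orthogonal to a point that the values of the forms miss.\<close>

lemma parameter_system_exists:
  fixes f :: "'n::finite \<Rightarrow> ('n, 'k::{alg_closed_field, field_char_0}) mpoly"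
  assumes f: "\<And>i. f i \<in> forms e" and e: "e \<ge> 2" and x: "x \<in> forms 1" "x \<noteq> 0"
    and zero: "\<And>v. (\<And>i. eval_at v (f i) = 0) \<Longrightarrow> eval_at v x = 0 \<Longrightarrow> v = (\<lambda>_. 0)"
  obtains g i0 where "parameter_system g i0 x e"
    "adjoin (ideal_gen (g ` (UNIV - {i0}))) (g i0) = ideal_gen (range f)"
proof -
  obtain c where c: "\<And>i. c i \<noteq> 0" "\<And>v. eval_at v x = 0 \<Longrightarrow> \<exists>i. eval_at v (f i) \<noteq> c i"
    by (rule forms_on_hyperplane_miss_point[OF f x]) (rule that)
  obtain i0 :: 'n where True by blast
  define g where "g i = (if i = i0 then f i0 else f i - pscale (c i / c i0) (f i0))" for i
  have g: "g i \<in> forms e" for i using f by (auto simp: g_def)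
  let ?G = "ideal_gen (g ` (UNIV - {i0}))"
  have "irrelevant_primary (ideal_gen (range (g(i0 := x))))"
  proof (rule projective_nullstellensatz[OF is_ideal_ideal_gen])
    show "homogeneous (ideal_gen (range (g(i0 := x))))"
      by (rule homogeneous_ideal_gen) (use g x(1) in auto)
    fix v assume v: "\<And>h. h \<in> ideal_gen (range (g(i0 := x))) \<Longrightarrow> eval_at v h = 0"
    have v': "eval_at v ((g(i0 := x)) i) = 0" for i by (intro v ideal_gen_base rangeI)
    have vx: "eval_at v x = 0" using v'[of i0] by simp
    define \<mu> where "\<mu> = eval_at v (f i0) / c i0"
    have vf: "eval_at v (f i) = \<mu> * c i" for i
      using v'[of i] c(1)[of i0] by (cases "i = i0") (auto simp: g_def \<mu>_def field_simps)
    have "\<mu> = 0"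
    proof (rule ccontr)
      assume "\<mu> \<noteq> 0"
      obtain t where t: "t ^ e = 1 / \<mu>" using nth_root_exists[of e "1 / \<mu>"] e by auto
      have "eval_at (\<lambda>i. t * v i) x = 0" using eval_at_form_scale[OF x(1)] vx by simp
      moreover have "eval_at (\<lambda>i. t * v i) (f i) = c i" for i
        using eval_at_form_scale[OF f] vf t \<open>\<mu> \<noteq> 0\<close> by simp
      ultimately show False using c(2) by blast
    qed
    then show "v = (\<lambda>_. 0)" using vf vx by (intro zero) simp_all
  qed
  then have ps: "parameter_system g i0 x e" using g e x by unfold_locales auto
  have J: "adjoin ?G (g i0) = ideal_gen (range f)"
  proof
    have fi: "f i \<in> ideal_gen (range f)" for i by (intro ideal_gen_base rangeI)
    have gi: "g i \<in> ideal_gen (range f)" for i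
      unfolding g_def using fi by (simp add: is_idealD(3) is_ideal_pscale)
    have "?G \<subseteq> ideal_gen (range f)" using gi by (intro ideal_gen_least) auto
    then show "adjoin ?G (g i0) \<subseteq> ideal_gen (range f)"
      using gi
      by (auto simp: adjoin_def intro!: is_idealD(2)[OF is_ideal_ideal_gen] is_ideal_mult[OF is_ideal_ideal_gen])
    have adj: "is_ideal (adjoin ?G (g i0))" by (simp add: is_ideal_adjoin)
    have g0: "g i0 \<in> adjoin ?G (g i0)" by (rule adjoin_self) simp
    have "f i \<in> adjoin ?G (g i0)" for i
    proof (cases "i = i0")
      case False
      have "g i \<in> adjoin ?G (g i0)" using False adjoin_superset[of ?G] by (auto intro!: ideal_gen_base)
      then have "g i + pscale (c i / c i0) (g i0) \<in> adjoin ?G (g i0)"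
        by (intro is_idealD(2)[OF adj] is_ideal_pscale[OF adj] g0)
      then show ?thesis using False by (simp add: g_def)
    qed (use g0 in \<open>simp add: g_def\<close>)
    then show "ideal_gen (range f) \<subseteq> adjoin ?G (g i0)" by (intro ideal_gen_least adj) auto
  qed
  show ?thesis by (rule that[OF ps J])
qed

section \<open>Nodes\<close>

subsection \<open>Elimination in the local ring\<close>

text \<open>
  Nakayama's lemma, for the maximal ideal \<open>M\<close> of a point: if the \<open>z j\<close> generate each other with
  coefficients in \<open>M\<close> up to elements of \<open>J\<close>, then they lie in \<open>J\<close> locally at the point. The proof
  eliminates one generator after the other.
\<close>

lemma nakayama_elimination:
  fixes J M :: "'a::comm_ring_1 set"
  assumes J: "is_ideal J" and M: "is_ideal M" and "finite S"
    and "\<And>j. j \<in> S \<Longrightarrow> \<exists>w\<in>J. \<exists>r. (\<forall>k. r k \<in> M) \<and> z j = w + (\<Sum>k\<in>S. r k * z k)"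
  shows "\<exists>u. u - 1 \<in> M \<and> (\<forall>j\<in>S. u * z j \<in> J)"
  using assms(3,4)
proof (induction S)
  case empty
  then show ?case using is_idealD(1)[OF M] by (intro exI[of _ 1]) simp
next
  case (insert s S)
  obtain w r where w: "w \<in> J" "\<And>k. r k \<in> M" "z s = w + (\<Sum>k\<in>insert s S. r k * z k)"
    using insert.prems[of s] by blast
  let ?a = "1 - r s"
  have as: "?a * z s = w + (\<Sum>k\<in>S. r k * z k)"
    using w(3) insert.hyps by (simp add: algebra_simps)
  have "\<exists>w\<in>J. \<exists>r. (\<forall>k. r k \<in> M) \<and> z j = w + (\<Sum>k\<in>S. r k * z k)" if j: "j \<in> S" for j
  proof -
    obtain w' r' where w': "w' \<in> J" "\<And>k. r' k \<in> M" "z j = w' + (\<Sum>k\<in>insert s S. r' k * z k)"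
      using insert.prems[of j] j by blast
    let ?r = "\<lambda>k. r' s * r k + ?a * r' k + (if k = j then r s else 0)"
    have "z j = ?a * z j + r s * z j" by (simp add: algebra_simps)
    also have "?a * z j = ?a * w' + r' s * (?a * z s) + (\<Sum>k\<in>S. ?a * r' k * z k)"
      by (subst w'(3)) (use insert.hyps in \<open>simp add: distrib_left sum_distrib_left mult_ac\<close>)
    also have "r' s * (?a * z s) = r' s * w + (\<Sum>k\<in>S. r' s * r k * z k)"
      by (simp only: as distrib_left sum_distrib_left mult.assoc)
    also have "r s * z j = (\<Sum>k\<in>S. (if k = j then r s else 0) * z k)"
    proof -
      have "(\<Sum>k\<in>S. (if k = j then r s else 0) * z k) = (\<Sum>k\<in>S. if k = j then r s * z k else 0)"
        by (rule sum.cong) auto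
      then show ?thesis using j insert.hyps by simp
    qed
    finally have zj: "z j = ?a * w' + (r' s * w + (\<Sum>k\<in>S. r' s * r k * z k)) +
        (\<Sum>k\<in>S. ?a * r' k * z k) + (\<Sum>k\<in>S. (if k = j then r s else 0) * z k)" .
    have "(\<Sum>k\<in>S. ?r k * z k) = (\<Sum>k\<in>S. r' s * r k * z k) + (\<Sum>k\<in>S. ?a * r' k * z k) +
        (\<Sum>k\<in>S. (if k = j then r s else 0) * z k)"
      by (simp only: distrib_right sum.distrib)
    with zj have a1: "z j = (?a * w' + r' s * w) + (\<Sum>k\<in>S. ?r k * z k)"
      by (simp only: add_ac)
    have a2: "?a * w' + r' s * w \<in> J" by (intro is_idealD(2)[OF J] is_ideal_mult[OF J] w w')
    have a3: "?r k \<in> M" for k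
      by (intro is_idealD(2)[OF M] is_ideal_mult[OF M] w w') (simp add: w(2) is_idealD(1)[OF M])
    show ?thesis
      by (intro bexI[of _ "?a * w' + r' s * w"] exI[of _ ?r] conjI allI) (rule a3, rule a1, rule a2)
  qed
  then obtain u where u: "u - 1 \<in> M" "\<And>j. j \<in> S \<Longrightarrow> u * z j \<in> J" using insert.IH by blast
  have "?a * u - 1 = (u - 1) - u * r s" by (simp add: algebra_simps)
  also have "\<dots> \<in> M" by (intro is_idealD(3)[OF M] is_ideal_mult[OF M] u w)
  finally have 1: "?a * u - 1 \<in> M" .
  have "u * (?a * z s) = u * w + (\<Sum>k\<in>S. r k * (u * z k))"
    unfolding as by (simp add: distrib_left sum_distrib_left mult.left_commute)
  also have "\<dots> \<in> J" by (intro is_idealD(2,5)[OF J] is_ideal_mult[OF J] w u)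
  finally have "(?a * u) * z s \<in> J" by (simp add: mult_ac)
  moreover have "(?a * u) * z j \<in> J" if "j \<in> S" for j
    using is_ideal_mult[OF J u(2)[OF that], of ?a] by (simp add: mult.assoc)
  ultimately show ?case using 1 by (intro exI[of _ "?a * u"]) auto
qed

subsection \<open>The Hessian at a node\<close>

lemma partial_partial_mdeg_ne_2:
  fixes p :: "('v::finite, 'k::comm_ring_1) mpoly"
  assumes "p \<in> forms m" "m \<noteq> 2"
  shows "eval_at (\<lambda>_. 0) (partial j (partial k p)) = 0"
proof (cases "m \<le> 1")
  case True
  then have "partial k p \<in> forms 0" using partial_form[OF assms(1), of k] by simp
  then have "partial k p = Const (eval_at (\<lambda>_. 0) (partial k p))" by (rule form_0_eq_Const)
  then have "partial j (partial k p) = 0" by (metis partial_Const)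
  then show ?thesis by simp
next
  case False
  have "partial j (partial k p) \<in> forms (m - 1 - 1)" using assms(1) by (intro partial_form)
  then show ?thesis by (rule eval_at_form_zero) (use False assms(2) in auto)
qed

text \<open>The polar form of the quadratic part is given by the Hessian at the origin.\<close>

lemma polar_of_quadratic_part:
  fixes p :: "('v::finite, 'k::comm_ring_1) mpoly"
  shows "eval_at (\<lambda>j. u j + w j) (hom_part 2 p) - eval_at u (hom_part 2 p) - eval_at w (hom_part 2 p) =
    (\<Sum>j\<in>UNIV. \<Sum>k\<in>UNIV. eval_at (\<lambda>_. 0) (partial j (partial k p)) * u j * w k)"
proof (induction p rule: poly_mapping_additive_induct)
  case (single \<alpha> c)
  have form: "Poly_Mapping.single \<alpha> c \<in> forms (mdeg \<alpha>)" by simp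
  show ?case
  proof (cases "mdeg \<alpha> = 2")
    case False
    then show ?thesis
      using partial_partial_mdeg_ne_2[OF form] by (simp add: hom_part_form[OF form])
  next
    case True
    then have "\<alpha> \<noteq> 0" by auto
    then obtain a where "Poly_Mapping.lookup \<alpha> a > 0" by (metis gr0I lookup_zero poly_mapping_eqI)
    then obtain \<beta> where \<beta>: "\<alpha> = Poly_Mapping.single a 1 + \<beta>" using exponent_pred by metis
    then have "mdeg \<beta> = 1" using True by (simp add: mdeg_add)
    then have "\<beta> \<noteq> 0" by auto
    then obtain b where "Poly_Mapping.lookup \<beta> b > 0" by (metis gr0I lookup_zero poly_mapping_eqI)
    then obtain \<gamma> where \<gamma>: "\<beta> = Poly_Mapping.single b 1 + \<gamma>" using exponent_pred by metis
    then have "\<gamma> = 0" using \<open>mdeg \<beta> = 1\<close> by (simp add: mdeg_add mdeg_eq_0_iff)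
    then have p: "Poly_Mapping.single \<alpha> c = Const c * (Var a * Var b)"
      using \<beta> \<gamma> by (simp add: Const_def Var_def mult_single)
    have hom: "hom_part 2 (Poly_Mapping.single \<alpha> c) = Const c * (Var a * Var b)"
      using True hom_part_form[OF form, of 2] p by simp
    let ?d = "\<lambda>i j :: 'v. if i = j then 1 else 0 :: 'k"
    have hess: "eval_at (\<lambda>_. 0) (partial j (partial k (Poly_Mapping.single \<alpha> c))) =
        c * (?d k a * ?d j b + ?d j a * ?d k b)" for j k
      unfolding p by (simp add: partial_mult)
    have "(\<Sum>j\<in>UNIV. \<Sum>k\<in>UNIV. c * (?d k a * ?d j b + ?d j a * ?d k b) * u j * w k) =
        (\<Sum>j\<in>UNIV. \<Sum>k\<in>UNIV. (if k = a then if j = b then c * u j * w k else 0 else 0)) +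
        (\<Sum>j\<in>UNIV. \<Sum>k\<in>UNIV. (if k = b then if j = a then c * u j * w k else 0 else 0))"
    proof -
      have "c * (?d k a * ?d j b + ?d j a * ?d k b) * u j * w k =
          (if k = a then if j = b then c * u j * w k else 0 else 0) +
          (if k = b then if j = a then c * u j * w k else 0 else 0)" for j k
        by (simp add: algebra_simps)
      then show ?thesis by (simp only: sum.distrib)
    qed
    also have "\<dots> = c * u b * w a + c * u a * w b" by simp
    finally show ?thesis unfolding hess hom by (simp add: algebra_simps)
  qed
next
  case (add p q)
  have "eval_at (\<lambda>j. u j + w j) (hom_part 2 (p + q)) - eval_at u (hom_part 2 (p + q)) - eval_at w (hom_part 2 (p + q)) =
    (eval_at (\<lambda>j. u j + w j) (hom_part 2 p) - eval_at u (hom_part 2 p) - eval_at w (hom_part 2 p)) +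
    (eval_at (\<lambda>j. u j + w j) (hom_part 2 q) - eval_at u (hom_part 2 q) - eval_at w (hom_part 2 q))"
    by (simp add: hom_part_add)
  then show ?case
    unfolding add by (simp add: distrib_right sum.distrib)
qed

lemma partial_local_equation:
  assumes "j \<noteq> i"
  shows "partial j (local_equation p v i) = local_equation (partial j p) v i"
proof -
  have 0: "subst s 0 = (0 :: ('v, 'k) mpoly)" for s :: "'v \<Rightarrow> ('v, 'k::comm_ring_1) mpoly"
    using subst_Const[of s 0] by simp
  have 1: "subst s 1 = (1 :: ('v, 'k) mpoly)" for s :: "'v \<Rightarrow> ('v, 'k::comm_ring_1) mpoly"
    using subst_Const[of s 1] by simp
  have p0: "partial j 0 = (0 :: ('a, 'b) mpoly)" using partial_Const[of j 0] by simp
  show ?thesis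
    unfolding local_equation_def using assms
    by (induction p rule: mpoly_ring_induct) (auto simp: partial_mult 0 1 p0)
qed

lemma eval_at_0_local_equation: "eval_at (\<lambda>_. 0) (local_equation p v i) = eval_at v p"
proof -
  have "eval_at (\<lambda>_. 0) (Const (v j) + (if j = i then 0 else Var j)) = v j" for j by simp
  then show ?thesis by (simp add: local_equation_def eval_at_subst)
qed

text \<open>A vector in the kernel of the Hessian without row and column \<open>i\<close> is in the radical of the polar form of
  the quadratic part. To have a square matrix, row and column \<open>i\<close> are replaced by those of the identity.\<close>

lemma hessian_left_inverse:
  fixes f :: "('v::finite, 'k::field) mpoly"
  assumes "nondegenerate_on {u. u i = 0} (hom_part 2 (local_equation f v i))"
  obtains b where "\<And>j k. j \<noteq> i \<Longrightarrow> k \<noteq> i \<Longrightarrow>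
    (\<Sum>l\<in>UNIV - {i}. b j l * eval_at v (partial k (partial l f))) = (if j = k then 1 else 0)"
proof -
  define H where "H l k = (if l = i \<or> k = i then (if l = k then 1 else 0) else eval_at v (partial k (partial l f)))" for l k
  let ?A = "\<chi> l k. H l k"
  have "x = 0" if x: "?A *v x = 0" for x :: "'k ^ 'v"
  proof -
    let ?u = "vec_nth x"
    have row: "(\<Sum>k\<in>UNIV. H l k * ?u k) = 0" for l
      using x by (simp add: vec_eq_iff matrix_vector_mult_def)
    have "(\<Sum>k\<in>UNIV. H i k * ?u k) = ?u i"
      by (simp add: H_def if_distrib[of "\<lambda>c. c * _"] sum.delta cong: if_cong)
    then have ui: "?u i = 0" using row[of i] by simp
    have "?u = (\<lambda>_. 0)"
    proof (rule assms[unfolded nondegenerate_on_def, rule_format])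
      show "?u \<in> {u. u i = 0}" using ui by simp
      fix w :: "'v \<Rightarrow> 'k" assume w: "w \<in> {u. u i = 0}"
      have "eval_at (\<lambda>j. ?u j + w j) (hom_part 2 (local_equation f v i)) -
          eval_at ?u (hom_part 2 (local_equation f v i)) - eval_at w (hom_part 2 (local_equation f v i)) =
          (\<Sum>j\<in>UNIV. \<Sum>k\<in>UNIV. eval_at (\<lambda>_. 0) (partial j (partial k (local_equation f v i))) * ?u j * w k)"
        by (rule polar_of_quadratic_part)
      also have "\<dots> = (\<Sum>j\<in>UNIV. \<Sum>k\<in>UNIV. w k * (H k j * ?u j))"
      proof (intro sum.cong refl)
        fix j k
        show "eval_at (\<lambda>_. 0) (partial j (partial k (local_equation f v i))) * ?u j * w k = w k * (H k j * ?u j)"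
          using ui w
          by (cases "j = i"; cases "k = i")
            (simp_all add: H_def partial_local_equation eval_at_0_local_equation algebra_simps)
      qed
      also have "\<dots> = (\<Sum>k\<in>UNIV. w k * (\<Sum>j\<in>UNIV. H k j * ?u j))"
        by (subst sum.swap) (simp only: sum_distrib_left)
      also have "\<dots> = 0" by (simp only: row) simp
      finally show "eval_at (\<lambda>j. ?u j + w j) (hom_part 2 (local_equation f v i)) -
          eval_at ?u (hom_part 2 (local_equation f v i)) - eval_at w (hom_part 2 (local_equation f v i)) = 0" .
    qed
    then show "x = 0" by (simp add: vec_eq_iff)
  qed
  then obtain B where B: "B ** ?A = mat 1" using matrix_left_invertible_ker[of ?A] by blast
  have "(\<Sum>l\<in>UNIV - {i}. vec_nth (vec_nth B j) l * eval_at v (partial k (partial l f))) = (if j = k then 1 else 0)"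
    if jk: "j \<noteq> i" "k \<noteq> i" for j k
  proof -
    have "(if j = k then 1 else 0) = vec_nth (vec_nth (B ** ?A) j) k" by (simp add: B mat_def)
    also have "\<dots> = (\<Sum>l\<in>UNIV. vec_nth (vec_nth B j) l * H l k)" by (simp add: matrix_matrix_mult_def)
    also have "\<dots> = (\<Sum>l\<in>UNIV - {i}. vec_nth (vec_nth B j) l * H l k)"
      using jk by (intro sum.mono_neutral_right) (auto simp: H_def)
    also have "\<dots> = (\<Sum>l\<in>UNIV - {i}. vec_nth (vec_nth B j) l * eval_at v (partial k (partial l f)))"
      using jk by (intro sum.cong) (auto simp: H_def)
    finally show ?thesis by simp
  qed
  then show ?thesis by (rule that)
qed

text \<open>
  Locally at a node the gradient ideal is the ideal of the point: modulo the square of the latter,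
  the partial derivatives are given by the Hessian, which is invertible, and Nakayama's lemma
  removes the error terms.
\<close>

lemma node_local_generation:
  fixes f :: "('v::finite, 'k::field) mpoly"
  assumes f: "f \<in> forms d" and v: "v i = 1" and sing: "\<And>l. eval_at v (partial l f) = 0"
    and nondeg: "nondegenerate_on {u. u i = 0} (hom_part 2 (local_equation f v i))"
  shows "\<exists>u. eval_at v u = 1 \<and> (\<forall>q h. h \<in> forms q \<longrightarrow> eval_at v h = 0 \<longrightarrow> u * h \<in> gradient_ideal f)"
proof -
  let ?J = "gradient_ideal f" and ?S = "UNIV - {i}" and ?M = "{h. eval_at v h = 0}"
  define z where "z j = Var j - pscale (v j) (Var i)" for j
  have J: "is_ideal ?J" by (simp add: gradient_ideal_def)
  have M: "is_ideal ?M" by (rule self_module.subspaceI) simp_all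
  let ?L = "ideal_gen (z ` ?S)"
  have zL: "Var j - pscale (v j) (Var i) \<in> ?L" for j
  proof (cases "j = i")
    case True
    then show ?thesis using v by (simp add: is_idealD(1))
  next
    case False
    then show ?thesis unfolding z_def[symmetric] by (intro ideal_gen_base) simp
  qed
  have in_L: "\<exists>a. h = (\<Sum>j\<in>?S. a j * z j)" if "h \<in> forms q" "eval_at v h = 0" for h q
  proof -
    have "h - pscale (eval_at v h) (Var i ^ q) \<in> ?L"
      by (rule form_cong_value[OF is_ideal_ideal_gen zL that(1)])
    then show ?thesis using that(2) ideal_gen_image_iff[of ?S h z] by simp
  qed
  have zv: "eval_at v (z j) = 0" for j by (simp add: z_def v)
  have "\<exists>a. partial l f = (\<Sum>j\<in>?S. a j * z j)" for l
    by (rule in_L[OF partial_form[OF f] sing])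
  then obtain a where a: "\<And>l. partial l f = (\<Sum>j\<in>?S. a l j * z j)" by metis
  have hess: "eval_at v (partial k (partial l f)) = eval_at v (a l k)" if k: "k \<noteq> i" for k l
  proof -
    have pz: "partial k (z j) = (if k = j then 1 else 0)" for j
    proof -
      have "z j = Var j + Const (- v j) * Var i" by (simp add: z_def pscale_def Const_minus)
      then show ?thesis using k by (simp add: partial_mult)
    qed
    have p0: "partial k 0 = (0 :: ('v, 'k) mpoly)" using partial_Const[of k 0] by simp
    have "partial k (partial l f) = (\<Sum>j\<in>?S. partial k (a l j * z j))"
      by (subst a) (rule additive_sum[of "partial k", OF p0 partial_add])
    then have "eval_at v (partial k (partial l f)) = (\<Sum>j\<in>?S. if k = j then eval_at v (a l j) else 0)"
      by (simp add: eval_at_sum partial_mult pz zv if_distrib cong: if_cong)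
    then show ?thesis using k by simp
  qed
  obtain b where b: "\<And>j k. j \<noteq> i \<Longrightarrow> k \<noteq> i \<Longrightarrow>
      (\<Sum>l\<in>?S. b j l * eval_at v (partial k (partial l f))) = (if j = k then 1 else 0)"
    by (rule hessian_left_inverse[OF nondeg]) (rule that)
  have gen: "\<exists>w\<in>?J. \<exists>r. (\<forall>k. r k \<in> ?M) \<and> z j = w + (\<Sum>k\<in>?S. r k * z k)" if j: "j \<in> ?S" for j
  proof -
    let ?w = "\<Sum>l\<in>?S. Const (b j l) * partial l f"
    let ?c = "\<lambda>k. \<Sum>l\<in>?S. Const (b j l) * a l k"
    let ?r = "\<lambda>k. if k = i then 0 else (if k = j then 1 else 0) - ?c k"
    have "partial l f \<in> ?J" for l unfolding gradient_ideal_def by (intro ideal_gen_base rangeI)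
    then have w: "?w \<in> ?J" by (intro is_idealD(5)[OF J] is_ideal_mult[OF J])
    have "eval_at v (?c k) = (if j = k then 1 else 0)" if "k \<noteq> i" for k
      using b[of j k] j that by (simp add: eval_at_sum hess)
    then have r: "?r k \<in> ?M" for k by simp
    have "?w = (\<Sum>l\<in>?S. \<Sum>k\<in>?S. Const (b j l) * a l k * z k)"
      by (subst a) (simp only: sum_distrib_left mult.assoc)
    also have "\<dots> = (\<Sum>k\<in>?S. ?c k * z k)" by (subst sum.swap) (simp only: sum_distrib_right)
    finally have w_eq: "?w = (\<Sum>k\<in>?S. ?c k * z k)" .
    have "(\<Sum>k\<in>?S. ?r k * z k) = (\<Sum>k\<in>?S. (if k = j then z k else 0) - ?c k * z k)"
      by (intro sum.cong) (auto simp: left_diff_distrib)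
    also have "\<dots> = z j - ?w" using j by (simp only: sum_subtractf w_eq) simp
    finally have "z j = ?w + (\<Sum>k\<in>?S. ?r k * z k)" by simp
    then show ?thesis
      by (intro bexI[of _ ?w] exI[of _ ?r] conjI allI) (rule r, assumption, rule w)
  qed
  have "\<exists>u. u - 1 \<in> ?M \<and> (\<forall>j\<in>?S. u * z j \<in> ?J)"
    by (rule nakayama_elimination[OF J M _ gen]) simp_all
  then obtain u where u: "u - 1 \<in> ?M" "\<forall>j\<in>?S. u * z j \<in> ?J"
    by (elim exE conjE)
  show ?thesis
  proof (intro exI[of _ u] conjI allI impI)
    show "eval_at v u = 1" using u(1) by simp
    fix q h assume "h \<in> forms q" "eval_at v h = 0"
    then obtain a where a: "h = (\<Sum>j\<in>?S. a j * z j)" using in_L by blast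
    have "u * h = (\<Sum>j\<in>?S. a j * (u * z j))" by (simp add: a sum_distrib_left mult.left_commute)
    also have "\<dots> \<in> ?J"
      by (rule is_idealD(5)[OF J], rule is_ideal_mult[OF J], rule bspec[OF u(2)])
    finally show "u * h \<in> ?J" .
  qed
qed

section \<open>Saturation\<close>

lemma ideal_power_irrelevant_mdeg:
  fixes g :: "('v, 'k::comm_ring_1) mpoly"
  assumes "g \<in> ideal_power irrelevant_ideal t" "Poly_Mapping.lookup g \<alpha> \<noteq> 0"
  shows "t \<le> mdeg \<alpha>"
proof -
  define S where "S t = {g :: ('v, 'k) mpoly. \<forall>\<alpha>. Poly_Mapping.lookup g \<alpha> \<noteq> 0 \<longrightarrow> t \<le> mdeg \<alpha>}" for t
  have S_mult: "a * b \<in> S (t + t')" if "a \<in> S t" "b \<in> S t'" for a b t t'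
    unfolding S_def
  proof safe
    fix \<alpha> assume "Poly_Mapping.lookup (a * b) \<alpha> \<noteq> 0"
    then obtain \<beta> \<gamma> where "\<alpha> = \<beta> + \<gamma>" "\<beta> \<in> Poly_Mapping.keys a" "\<gamma> \<in> Poly_Mapping.keys b"
      using keys_mult[of a b] by (auto simp: in_keys_iff)
    then show "t + t' \<le> mdeg \<alpha>"
      using that by (auto simp: S_def in_keys_iff mdeg_add add_mono)
  qed
  have ideal: "is_ideal (S t)" for t
  proof (rule self_module.subspaceI)
    show "0 \<in> S t" by (simp add: S_def)
    fix a b c :: "('v, 'k) mpoly" assume a: "a \<in> S t"
    show "a + b \<in> S t" if "b \<in> S t"
      using a that unfolding S_def mem_Collect_eq lookup_add by (metis add_0)
    have "c \<in> S 0" by (simp add: S_def)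
    from S_mult[OF this a] show "c * a \<in> S t" by simp
  qed
  have Var: "(Var i :: ('v, 'k) mpoly) \<in> S 1" for i
    by (auto simp: S_def Var_def lookup_single when_def)
  have irr: "irrelevant_ideal \<subseteq> S 1"
    unfolding irrelevant_ideal_def using Var by (intro ideal_gen_least ideal) auto
  have "ideal_power irrelevant_ideal t \<subseteq> S t" for t
  proof (induction t)
    case (Suc t)
    have "{a * b | a b. a \<in> irrelevant_ideal \<and> b \<in> ideal_power irrelevant_ideal t} \<subseteq> S (Suc t)"
      using S_mult[of _ 1 _ t] irr Suc by auto
    then show ?case by (simp add: ideal_gen_least ideal)
  qed (simp add: S_def)
  then show ?thesis using assms by (auto simp: S_def)
qed

lemma Var_power_in_ideal_power: "Var i ^ t \<in> ideal_power irrelevant_ideal t"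
proof (induction t)
  case (Suc t)
  have "Var i \<in> irrelevant_ideal" unfolding irrelevant_ideal_def by (intro ideal_gen_base rangeI)
  then show ?case using Suc by (auto intro!: ideal_gen_base)
qed simp

lemma vanishes_at_form_iff:
  fixes h :: "('v, 'k::comm_ring_1) mpoly"
  assumes "h \<in> forms q"
  shows "vanishes_at h (proj_point (\<lambda>c v i. c * v i) v) \<longleftrightarrow> eval_at v h = 0"
proof
  assume "vanishes_at h (proj_point (\<lambda>c v i. c * v i) v)"
  moreover have "v = (\<lambda>i. 1 * v i)" by simp
  ultimately show "eval_at v h = 0" unfolding vanishes_at_def proj_point_def by (metis rangeI)
qed (auto simp: vanishes_at_def proj_point_def eval_at_form_scale[OF assms])

lemma points_ideal_1_iff:
  fixes l :: "('v, 'k::comm_ring_1) mpoly"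
  shows "l \<in> points_ideal_1 \<Gamma> \<longleftrightarrow> l \<in> forms 1 \<and> (\<forall>p\<in>\<Gamma>. vanishes_at l p)"
proof
  let ?V = "{g :: ('v, 'k) mpoly. \<forall>p\<in>\<Gamma>. vanishes_at g p}"
  have "is_ideal ?V" by (rule self_module.subspaceI) (simp_all add: vanishes_at_def)
  then have "points_ideal \<Gamma> \<subseteq> ?V" unfolding points_ideal_def by (intro ideal_gen_least) auto
  then show "l \<in> points_ideal_1 \<Gamma> \<Longrightarrow> l \<in> forms 1 \<and> (\<forall>p\<in>\<Gamma>. vanishes_at l p)"
    by (auto simp: points_ideal_1_def)
  show "l \<in> forms 1 \<and> (\<forall>p\<in>\<Gamma>. vanishes_at l p) \<Longrightarrow> l \<in> points_ideal_1 \<Gamma>"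
    unfolding points_ideal_1_def points_ideal_def by (auto intro!: ideal_gen_base)
qed

lemma functional_eval_at: "mpoly_vs.functional (eval_at v)"
  by (simp add: mpoly_vs.functional_def)

section \<open>Hypersurfaces with independent nodes\<close>

locale nodal_hypersurface =
  fixes f :: "('n::finite, 'k::{alg_closed_field, field_char_0}) mpoly" and d :: nat
    and \<Gamma> :: "('n \<Rightarrow> 'k) set set"
  assumes f_form: "f \<in> forms d" and d_ge_3: "d \<ge> 3" and \<Gamma>_Sing: "\<Gamma> = Sing f"
    and finite_\<Gamma>: "finite \<Gamma>" and card_\<Gamma>: "card \<Gamma> < CARD('n)"
    and nodes: "\<And>p. p \<in> \<Gamma> \<Longrightarrow> is_node f p" and independent: "independent_conditions \<Gamma>"
begin

abbreviation J where "J \<equiv> gradient_ideal f"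

lemma partial_forms: "partial i f \<in> forms (d - 1)"
  using partial_form[OF f_form] .

lemma partial_in_J: "partial i f \<in> J"
  unfolding gradient_ideal_def by (intro ideal_gen_base rangeI)

lemma ideal_J: "is_ideal J" and homogeneous_J: "homogeneous J"
  using partial_forms by (auto simp: gradient_ideal_def intro!: homogeneous_ideal_gen)

text \<open>Coordinates of a node; off \<open>\<Gamma>\<close> the value is arbitrary.\<close>

definition rep :: "('n \<Rightarrow> 'k) set \<Rightarrow> 'n \<Rightarrow> 'k" where
  "rep p = (SOME v. v \<noteq> (\<lambda>_. 0) \<and> p = proj_point (\<lambda>c v i. c * v i) v)"

lemma rep:
  assumes "p \<in> \<Gamma>"
  shows "rep p \<noteq> (\<lambda>_. 0)" and "p = proj_point (\<lambda>c v i. c * v i) (rep p)"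
proof -
  have "\<exists>v. v \<noteq> (\<lambda>_. 0) \<and> p = proj_point (\<lambda>c v i. c * v i) v"
    using assms by (auto simp: \<Gamma>_Sing Sing_def coord_points_def proj_space_def)
  then have "rep p \<noteq> (\<lambda>_. 0) \<and> p = proj_point (\<lambda>c v i. c * v i) (rep p)"
    unfolding rep_def by (rule someI_ex)
  then show "rep p \<noteq> (\<lambda>_. 0)" "p = proj_point (\<lambda>c v i. c * v i) (rep p)"
    by (rule conjunct1, rule conjunct2)
qed

lemma vanishes_at_iff: "p \<in> \<Gamma> \<Longrightarrow> h \<in> forms q \<Longrightarrow> vanishes_at h p \<longleftrightarrow> eval_at (rep p) h = 0"
  using vanishes_at_form_iff[of h q "rep p"] rep(2) by simp

lemma J_vanishes:
  assumes "h \<in> J" "p \<in> \<Gamma>" "v \<in> p"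
  shows "eval_at v h = 0"
proof -
  have "is_ideal {h. eval_at v h = 0}" by (rule self_module.subspaceI) simp_all
  then have "J \<subseteq> {h. eval_at v h = 0}"
    unfolding gradient_ideal_def
    by (rule ideal_gen_least[rotated]) (use assms in \<open>auto simp: \<Gamma>_Sing Sing_def vanishes_at_def\<close>)
  then show ?thesis using assms by auto
qed

lemma critical_point_in_\<Gamma>:
  assumes "v \<noteq> (\<lambda>_. 0)" "\<And>i. eval_at v (partial i f) = 0"
  shows "proj_point (\<lambda>c v i. c * v i) v \<in> \<Gamma>"
proof -
  have "of_nat d * eval_at v f = eval_at v (of_nat d * f)"
    by (metis eval_at_Const eval_at_mult single_of_nat Const_def)
  also have "\<dots> = 0"
    unfolding euler_formula[OF f_form, symmetric] using assms(2) by (simp add: eval_at_sum)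
  finally have "eval_at v f = 0" using d_ge_3 by simp
  then show ?thesis
    using assms vanishes_at_form_iff[OF f_form] vanishes_at_form_iff[OF partial_forms]
    by (auto simp: \<Gamma>_Sing Sing_def coord_points_def proj_space_def)
qed

lemma node_unit:
  assumes "p \<in> \<Gamma>"
  obtains v u where "v \<in> p" "eval_at v u = 1"
    "\<And>q h. h \<in> forms q \<Longrightarrow> eval_at v h = 0 \<Longrightarrow> u * h \<in> J"
proof -
  obtain v i where v: "v \<in> p" "v i = 1" "nondegenerate_on {u. u i = 0} (hom_part 2 (local_equation f v i))"
    using nodes[OF assms] unfolding is_node_def by blast
  have "eval_at v (partial l f) = 0" for l by (rule J_vanishes[OF partial_in_J assms v(1)])
  from node_local_generation[OF f_form v(2) this v(3)] show ?thesis using that v(1) by blast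
qed

text \<open>
  The colon ideal of \<open>J\<close> by a form \<open>h\<close> that vanishes on \<open>\<Gamma>\<close> has no zero: outside \<open>\<Gamma>\<close> since it contains
  \<open>J\<close>, and at a node since locally \<open>J\<close> is the ideal of the point. So \<open>h\<close> is in the saturation of \<open>J\<close>.
\<close>

lemma colon_primary:
  assumes h: "h \<in> forms q" "\<And>p. p \<in> \<Gamma> \<Longrightarrow> vanishes_at h p"
  obtains N where "\<And>u m. m \<ge> N \<Longrightarrow> u \<in> forms m \<Longrightarrow> u * h \<in> J"
proof -
  let ?K = "{u. u * h \<in> J}"
  have K: "is_ideal ?K"
    using is_idealD(1,2)[OF ideal_J] is_ideal_mult[OF ideal_J]
    by (intro self_module.subspaceI) (auto simp: distrib_right mult.assoc)
  have hom: "homogeneous ?K"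
    unfolding homogeneous_def
  proof safe
    fix u m assume "u * h \<in> J"
    then have "hom_part (m + q) (u * h) \<in> J" using homogeneous_J by (auto simp: homogeneous_def)
    then show "hom_part m u * h \<in> J" by (simp add: hom_part_mult_form[OF h(1)])
  qed
  have "irrelevant_primary ?K"
  proof (rule projective_nullstellensatz[OF K hom])
    fix v assume v: "\<And>g. g \<in> ?K \<Longrightarrow> eval_at v g = 0"
    show "v = (\<lambda>_. 0)"
    proof (rule ccontr)
      assume nz: "v \<noteq> (\<lambda>_. 0)"
      have "eval_at v (partial i f) = 0" for i
        using is_ideal_mult_right[OF ideal_J partial_in_J] by (intro v) simp
      with nz have p: "proj_point (\<lambda>c v i. c * v i) v \<in> \<Gamma>" by (rule critical_point_in_\<Gamma>)
      obtain v0 u where u: "v0 \<in> proj_point (\<lambda>c v i. c * v i) v" "eval_at v0 u = 1"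
        "\<And>q h. h \<in> forms q \<Longrightarrow> eval_at v0 h = 0 \<Longrightarrow> u * h \<in> J"
        by (rule node_unit[OF p]) (rule that)
      have "eval_at v0 h = 0" using h(2)[OF p] u(1) by (simp add: vanishes_at_def)
      then have "u \<in> ?K" using u(3)[OF h(1)] by simp
      obtain c where c: "v0 = (\<lambda>i. c * v i)" using u(1) by (auto simp: proj_point_def)
      have "eval_at v0 (hom_part s u) = 0" for s
      proof -
        have "hom_part s u \<in> ?K" using hom \<open>u \<in> ?K\<close> unfolding homogeneous_def by blast
        then show ?thesis unfolding c eval_at_form_scale[OF hom_part_in_forms] by (simp add: v)
      qed
      moreover obtain B where "u = (\<Sum>s\<le>B. hom_part s u)" by (rule sum_hom_part_obtain)
      ultimately have "eval_at v0 u = 0" by (metis eval_at_sum sum.neutral)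
      then show False using u(2) by simp
    qed
  qed
  then show ?thesis using that by (auto simp: irrelevant_primary_def)
qed

lemma saturation_iff:
  assumes h: "h \<in> forms q"
  shows "h \<in> saturation J \<longleftrightarrow> (\<forall>p\<in>\<Gamma>. vanishes_at h p)"
proof
  assume "h \<in> saturation J"
  then obtain t where t: "\<And>g. g \<in> ideal_power irrelevant_ideal t \<Longrightarrow> g * h \<in> J" by (auto simp: saturation_def)
  show "\<forall>p\<in>\<Gamma>. vanishes_at h p"
  proof
    fix p assume p: "p \<in> \<Gamma>"
    obtain i where i: "rep p i \<noteq> 0" using rep(1)[OF p] by auto
    have "rep p = (\<lambda>i. 1 * rep p i)" by simp
    then have "rep p \<in> proj_point (\<lambda>c v i. c * v i) (rep p)" unfolding proj_point_def by (rule range_eqI)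
    then have "rep p \<in> p" using rep(2)[OF p] by simp
    then have "eval_at (rep p) (Var i ^ t * h) = 0"
      by (intro J_vanishes[OF t p] Var_power_in_ideal_power)
    then show "vanishes_at h p" using i by (simp add: vanishes_at_iff[OF p h])
  qed
next
  assume "\<forall>p\<in>\<Gamma>. vanishes_at h p"
  then obtain N where N: "\<And>u m. m \<ge> N \<Longrightarrow> u \<in> forms m \<Longrightarrow> u * h \<in> J"
    using colon_primary[OF h] by metis
  have "g * h \<in> J" if g: "g \<in> ideal_power irrelevant_ideal N" for g
  proof -
    obtain B where B: "g = (\<Sum>s\<le>B. hom_part s g)" by (rule sum_hom_part_obtain)
    have "hom_part s g * h \<in> J" for s
    proof (cases "s \<ge> N")
      case False
      have "hom_part s g = 0"
      proof (rule poly_mapping_eqI)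
        fix \<alpha>
        show "Poly_Mapping.lookup (hom_part s g) \<alpha> = Poly_Mapping.lookup 0 \<alpha>"
          using ideal_power_irrelevant_mdeg[OF g, of \<alpha>] False by (auto simp: lookup_hom_part)
      qed
      then show ?thesis by (simp add: is_idealD(1)[OF ideal_J])
    qed (rule N, auto)
    then have "(\<Sum>s\<le>B. hom_part s g * h) \<in> J" by (intro is_idealD(5)[OF ideal_J])
    then show ?thesis by (subst B) (simp add: sum_distrib_right)
  qed
  then show "h \<in> saturation J" by (auto simp: saturation_def)
qed

subsection \<open>Interpolation at the nodes\<close>

definition vanishing :: "('n \<Rightarrow> 'k) set set \<Rightarrow> nat \<Rightarrow> ('n, 'k) mpoly set" where
  "vanishing T q = {h \<in> forms q. \<forall>p\<in>T. eval_at (rep p) h = 0}"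

lemma points_ideal_1_eq: "points_ideal_1 \<Gamma> = vanishing \<Gamma> 1"
  using points_ideal_1_iff vanishes_at_iff by (auto simp: vanishing_def)

lemma saturation_forms_eq: "saturation J \<inter> forms q = vanishing \<Gamma> q"
  using saturation_iff vanishes_at_iff by (auto simp: vanishing_def)

lemma subspace_vanishing: "finite T \<Longrightarrow> mpoly_vs.subspace (vanishing T q)"
  and dim_vanishing_ge:
    "finite T \<Longrightarrow> mpoly_vs.dim (forms q :: ('n, 'k) mpoly set) \<le> mpoly_vs.dim (vanishing T q) + card T"
  using mpoly_vs.dim_kernels_ge[OF _ subspace_forms[of q] fin_dim_forms, of T "\<lambda>p. eval_at (rep p)"]
    functional_eval_at by (auto simp: vanishing_def)

lemma fin_dim_vanishing: "mpoly_vs.fin_dim (vanishing T q)"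
  by (rule fin_dim_subset_forms) (auto simp: vanishing_def)

lemma dim_points_ideal_1: "mpoly_vs.dim (points_ideal_1 \<Gamma>) = CARD('n) - card \<Gamma>"
  using independent card_\<Gamma> by (simp add: independent_conditions_def)

text \<open>If all linear forms that vanish at the other nodes vanished at \<open>p\<close> too, then \<open>card \<Gamma> - 1\<close> conditions would
  cut the space of linear forms down to codimension \<open>card \<Gamma>\<close>.\<close>

lemma interpolating_linear_form:
  assumes "p \<in> \<Gamma>"
  obtains l where "l \<in> forms 1" "eval_at (rep p) l \<noteq> 0" "\<And>p'. p' \<in> \<Gamma> \<Longrightarrow> p' \<noteq> p \<Longrightarrow> eval_at (rep p') l = 0"
proof -
  have "\<exists>l\<in>vanishing (\<Gamma> - {p}) 1. eval_at (rep p) l \<noteq> 0"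
  proof (rule ccontr)
    assume "\<not> ?thesis"
    then have "vanishing (\<Gamma> - {p}) 1 = vanishing \<Gamma> 1" by (auto simp: vanishing_def)
    then have "CARD('n) \<le> (CARD('n) - card \<Gamma>) + card (\<Gamma> - {p})"
      using dim_vanishing_ge[of "\<Gamma> - {p}" 1] finite_\<Gamma> dim_points_ideal_1 points_ideal_1_eq
        dim_forms_1[where 'v = 'n and 'k = 'k] by simp
    moreover have "card (\<Gamma> - {p}) < card \<Gamma>" using assms finite_\<Gamma> by (intro card_Diff1_less)
    ultimately show False using card_\<Gamma> by linarith
  qed
  then show ?thesis using that by (auto simp: vanishing_def)
qed

lemma interpolating_linear_forms:
  obtains l where "\<And>p. p \<in> \<Gamma> \<Longrightarrow> l p \<in> forms 1"
    "\<And>p. p \<in> \<Gamma> \<Longrightarrow> eval_at (rep p) (l p) \<noteq> 0"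
    "\<And>p p'. p \<in> \<Gamma> \<Longrightarrow> p' \<in> \<Gamma> \<Longrightarrow> p' \<noteq> p \<Longrightarrow> eval_at (rep p') (l p) = 0"
proof -
  have "\<forall>p\<in>\<Gamma>. \<exists>l. l \<in> forms 1 \<and> eval_at (rep p) l \<noteq> 0 \<and> (\<forall>p'\<in>\<Gamma>. p' \<noteq> p \<longrightarrow> eval_at (rep p') l = 0)"
    using interpolating_linear_form by metis
  from bchoice[OF this] obtain l where
    "\<forall>p\<in>\<Gamma>. l p \<in> forms 1 \<and> eval_at (rep p) (l p) \<noteq> 0 \<and> (\<forall>p'\<in>\<Gamma>. p' \<noteq> p \<longrightarrow> eval_at (rep p') (l p) = 0)"
    by (rule exE)
  then show ?thesis by (intro that[of l]) auto
qed

lemma linear_form_avoiding_nodes: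
  obtains x where "x \<in> forms 1" "x \<noteq> 0" "\<And>p. p \<in> \<Gamma> \<Longrightarrow> eval_at (rep p) x \<noteq> 0"
proof (cases "\<Gamma> = {}")
  case True
  obtain i :: 'n where True by blast
  have "eval_at (\<lambda>_. 1) (Var i :: ('n, 'k) mpoly) \<noteq> 0" by simp
  then have "(Var i :: ('n, 'k) mpoly) \<noteq> 0" by (metis eval_at_0)
  then show ?thesis using True by (intro that[of "Var i"]) auto
next
  case False
  obtain l where l: "\<And>p. p \<in> \<Gamma> \<Longrightarrow> l p \<in> forms 1"
    "\<And>p. p \<in> \<Gamma> \<Longrightarrow> eval_at (rep p) (l p) \<noteq> 0"
    "\<And>p p'. p \<in> \<Gamma> \<Longrightarrow> p' \<in> \<Gamma> \<Longrightarrow> p' \<noteq> p \<Longrightarrow> eval_at (rep p') (l p) = 0"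
    by (rule interpolating_linear_forms) (rule that)
  let ?x = "\<Sum>p\<in>\<Gamma>. l p"
  have x: "eval_at (rep p) ?x = eval_at (rep p) (l p)" if p: "p \<in> \<Gamma>" for p
  proof -
    have "eval_at (rep p) ?x = (\<Sum>p'\<in>\<Gamma>. if p' = p then eval_at (rep p) (l p) else 0)"
      unfolding eval_at_sum using l(3) p by (intro sum.cong) auto
    then show ?thesis using p finite_\<Gamma> by simp
  qed
  obtain p where "p \<in> \<Gamma>" using False by blast
  then have "?x \<noteq> 0" using x l(2) by fastforce
  then show ?thesis using l(1,2) x by (intro that[of ?x] forms_sum) auto
qed

text \<open>Interpolating linear forms, multiplied by powers of a linear form that vanishes at no node, interpolate
  in each positive degree. In degree \<open>0\<close> this only works without nodes.\<close>

lemma dim_vanishing: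
  assumes "q \<ge> 1 \<or> \<Gamma> = {}"
  shows "mpoly_vs.dim (vanishing \<Gamma> q) + card \<Gamma> = mpoly_vs.dim (forms q :: ('n, 'k) mpoly set)"
proof -
  obtain x where x: "x \<in> forms 1" "x \<noteq> 0" "\<And>p. p \<in> \<Gamma> \<Longrightarrow> eval_at (rep p) x \<noteq> 0"
    by (rule linear_form_avoiding_nodes) (rule that)
  have "mpoly_vs.dim (vanishing T q) + card T \<le> mpoly_vs.dim (forms q :: ('n, 'k) mpoly set)" if "finite T" "T \<subseteq> \<Gamma>" for T
    using that
  proof induction
    case empty
    then show ?case by (simp add: vanishing_def)
  next
    case (insert p T)
    then have p: "p \<in> \<Gamma>" and q: "q \<ge> 1" using assms by auto
    obtain l where l: "l \<in> forms 1" "eval_at (rep p) l \<noteq> 0"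
      "\<And>p'. p' \<in> \<Gamma> \<Longrightarrow> p' \<noteq> p \<Longrightarrow> eval_at (rep p') l = 0"
      by (rule interpolating_linear_form[OF p]) (rule that)
    have "l * x ^ (q - 1) \<in> forms (1 + (q - 1) * 1)" by (intro forms_mult forms_power l x)
    then have "l * x ^ (q - 1) \<in> vanishing T q"
      using l(3) insert q by (auto simp: vanishing_def)
    moreover have "eval_at (rep p) (l * x ^ (q - 1)) \<noteq> 0" using l(2) x(3)[OF p] by simp
    ultimately have "mpoly_vs.dim {v \<in> vanishing T q. eval_at (rep p) v = 0} < mpoly_vs.dim (vanishing T q)"
      by (intro mpoly_vs.dim_kernel_less subspace_vanishing fin_dim_vanishing functional_eval_at insert)
    moreover have "{v \<in> vanishing T q. eval_at (rep p) v = 0} = vanishing (insert p T) q"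
      by (auto simp: vanishing_def)
    ultimately show ?case using insert by simp
  qed
  from this[of \<Gamma>] show ?thesis using finite_\<Gamma> dim_vanishing_ge[of \<Gamma> q] by simp
qed

subsection \<open>The Hilbert function of the gradient ideal\<close>

text \<open>In large degrees a form is, modulo \<open>J\<close>, determined by its values at the nodes, which are
  interpolated by linear forms times a power of \<open>x\<close>.\<close>

lemma large_forms_mod_J:
  assumes x: "x \<in> forms 1" "\<And>p. p \<in> \<Gamma> \<Longrightarrow> eval_at (rep p) x \<noteq> 0"
    and prim: "irrelevant_primary (adjoin J x)"
  shows "\<exists>a\<ge>a0. \<forall>u\<in>forms (Suc a). \<exists>j\<in>J. \<exists>l. u = j + x ^ a * l"
proof -
  obtain N0 where N0: "\<And>q. q \<ge> N0 \<Longrightarrow> forms q \<subseteq> adjoin J x"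
    using prim by (auto simp: irrelevant_primary_def)
  \<comment> \<open>the degree of a linear form times \<open>x\<close> to the power \<open>N0\<close>\<close>
  define N where "N = Suc N0"
  have N: "forms q \<subseteq> adjoin J x" if "q \<ge> N" for q using that N0 by (simp add: N_def)
  have interp: "\<exists>l t. x ^ t * (u - x ^ N0 * l) \<in> J" if u: "u \<in> forms N" for u
  proof -
    obtain l where l: "\<And>p. p \<in> \<Gamma> \<Longrightarrow> l p \<in> forms 1"
      "\<And>p. p \<in> \<Gamma> \<Longrightarrow> eval_at (rep p) (l p) \<noteq> 0"
      "\<And>p p'. p \<in> \<Gamma> \<Longrightarrow> p' \<in> \<Gamma> \<Longrightarrow> p' \<noteq> p \<Longrightarrow> eval_at (rep p') (l p) = 0"
      by (rule interpolating_linear_forms) (rule that)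
    define c where "c p = eval_at (rep p) u / (eval_at (rep p) x ^ N0 * eval_at (rep p) (l p))" for p
    define L where "L = (\<Sum>p\<in>\<Gamma>. pscale (c p) (l p))"
    have L: "L \<in> forms 1" unfolding L_def by (intro forms_sum forms_pscale l)
    have "x ^ N0 * L \<in> forms (N0 * 1 + 1)" by (intro forms_mult forms_power x L)
    then have h: "u - x ^ N0 * L \<in> forms N" using u by (intro forms_diff) (simp_all add: N_def)
    have "vanishes_at (u - x ^ N0 * L) p" if p: "p \<in> \<Gamma>" for p
    proof -
      have "eval_at (rep p) L = (\<Sum>p'\<in>\<Gamma>. if p' = p then c p * eval_at (rep p) (l p) else 0)"
        unfolding L_def eval_at_sum using l(3) p by (intro sum.cong) auto
      also have "\<dots> = c p * eval_at (rep p) (l p)" using p finite_\<Gamma> by simp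
      finally show ?thesis
        using vanishes_at_iff[OF p h] l(2)[OF p] x(2)[OF p] by (simp add: c_def)
    qed
    then obtain M where M: "\<And>u' m. m \<ge> M \<Longrightarrow> u' \<in> forms m \<Longrightarrow> u' * (u - x ^ N0 * L) \<in> J"
      using colon_primary[OF h] by metis
    have "x ^ M \<in> forms M" using forms_power[OF x(1), of M] by simp
    then have "x ^ M * (u - x ^ N0 * L) \<in> J" by (rule M[OF order_refl])
    then show ?thesis by blast
  qed
  let ?A = "{\<alpha> :: 'n \<Rightarrow>\<^sub>0 nat. mdeg \<alpha> = N}"
  have "\<exists>l t. x ^ t * (Poly_Mapping.single \<alpha> 1 - x ^ N0 * l) \<in> J" if "\<alpha> \<in> ?A" for \<alpha>
    using that by (intro interp) auto
  then obtain l t where lt: "\<And>\<alpha>. \<alpha> \<in> ?A \<Longrightarrow> x ^ t \<alpha> * (Poly_Mapping.single \<alpha> 1 - x ^ N0 * l \<alpha>) \<in> J"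
    by metis
  \<comment> \<open>one exponent for all monomials of degree \<open>N\<close>\<close>
  define t0 where "t0 = (\<Sum>\<alpha>\<in>?A. t \<alpha>)"
  define a where "a = a0 + N + t0"
  have red: "x ^ (t0 + s) * (Poly_Mapping.single \<alpha> 1 - x ^ N0 * l \<alpha>) \<in> J" if \<alpha>: "\<alpha> \<in> ?A" for \<alpha> s
  proof -
    have "t \<alpha> \<le> t0" unfolding t0_def using \<alpha> finite_exponents_mdeg by (intro member_le_sum) auto
    then obtain r where r: "t0 + s = r + t \<alpha>" by (metis add.commute add.assoc le_add_diff_inverse)
    have "x ^ (t0 + s) * (Poly_Mapping.single \<alpha> 1 - x ^ N0 * l \<alpha>) =
        x ^ r * (x ^ t \<alpha> * (Poly_Mapping.single \<alpha> 1 - x ^ N0 * l \<alpha>))"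
      by (simp only: r power_add mult.assoc)
    then show ?thesis using is_ideal_mult[OF ideal_J lt[OF \<alpha>]] by simp
  qed
  show ?thesis
  proof (intro exI[of _ a] conjI ballI)
    show "a0 \<le> a" by (simp add: a_def)
    fix u :: "('n, 'k) mpoly" assume "u \<in> forms (Suc a)"
    then have "u \<in> forms (N + (t0 + Suc a0))" by (simp add: a_def add_ac)
    then obtain k w where kw: "k \<in> J" "w \<in> forms N" "u = x ^ (t0 + Suc a0) * w + k"
      using form_reduce_adjoin[OF ideal_J homogeneous_J x(1) N] by metis
    let ?c = "Poly_Mapping.lookup w"
    have w: "w = (\<Sum>\<alpha>\<in>?A. Const (?c \<alpha>) * Poly_Mapping.single \<alpha> 1)"
      by (subst form_eq_sum_single[OF kw(2)]) (simp flip: single_eq_Const_times)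
    let ?L = "\<Sum>\<alpha>\<in>?A. Const (?c \<alpha>) * l \<alpha>"
    have "x ^ (t0 + Suc a0) * (w - x ^ N0 * ?L) =
        (\<Sum>\<alpha>\<in>?A. Const (?c \<alpha>) * (x ^ (t0 + Suc a0) * (Poly_Mapping.single \<alpha> 1 - x ^ N0 * l \<alpha>)))"
      by (subst w) (simp add: sum_distrib_left right_diff_distrib sum_subtractf mult.left_commute)
    also have "\<dots> \<in> J"
      by (rule is_idealD(5)[OF ideal_J], rule is_ideal_mult[OF ideal_J], rule red)
    finally have "x ^ (t0 + Suc a0) * (w - x ^ N0 * ?L) + k \<in> J" by (intro is_idealD(2)[OF ideal_J] kw(1))
    moreover have "u = (x ^ (t0 + Suc a0) * (w - x ^ N0 * ?L) + k) + x ^ a * ?L"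
    proof -
      have "x ^ a = x ^ (t0 + Suc a0) * x ^ N0" by (simp add: a_def N_def power_add mult_ac)
      then show ?thesis by (simp only: kw(3)) (simp add: algebra_simps)
    qed
    ultimately show "\<exists>j\<in>J. \<exists>l. u = j + x ^ a * l" by blast
  qed
qed

lemma hilbert_gradient_ideal: "hilbert J (CARD('n) * (d - 2) - 1) = CARD('n)"
proof -
  obtain x where x: "x \<in> forms 1" "x \<noteq> 0" "\<And>p. p \<in> \<Gamma> \<Longrightarrow> eval_at (rep p) x \<noteq> 0"
    by (rule linear_form_avoiding_nodes) (rule that)
  have zero: "v = (\<lambda>_. 0)" if v: "\<And>i. eval_at v (partial i f) = 0" "eval_at v x = 0" for v
  proof (rule ccontr)
    assume nz: "v \<noteq> (\<lambda>_. 0)"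
    let ?p = "proj_point (\<lambda>c v i. c * v i) v"
    have p: "?p \<in> \<Gamma>" using nz v(1) by (rule critical_point_in_\<Gamma>)
    have "vanishes_at x ?p" using vanishes_at_form_iff[OF x(1)] v(2) by simp
    then show False using vanishes_at_iff[OF p x(1)] x(3)[OF p] by simp
  qed
  have e: "d - 1 \<ge> 2" using d_ge_3 by simp
  obtain g i0 where g: "parameter_system g i0 x (d - 1)"
    "adjoin (ideal_gen (g ` (UNIV - {i0}))) (g i0) = ideal_gen (range (\<lambda>i. partial i f))"
    by (rule parameter_system_exists[where f = "\<lambda>i. partial i f", OF partial_forms e x(1,2) zero]) (assumption, assumption, rule that)
  interpret ps: parameter_system g i0 x "d - 1" by (rule g(1))
  have J: "adjoin ps.G (g i0) = J" using g(2) by (simp add: ps.G_def gradient_ideal_def)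
  have "irrelevant_primary (adjoin J x)"
  proof (rule projective_nullstellensatz)
    show "is_ideal (adjoin J x)" by (rule is_ideal_adjoin[OF ideal_J])
    show "homogeneous (adjoin J x)" by (rule homogeneous_adjoin[OF ideal_J homogeneous_J x(1)])
    fix v assume v: "\<And>h. h \<in> adjoin J x \<Longrightarrow> eval_at v h = 0"
    show "v = (\<lambda>_. 0)"
    proof (rule zero)
      show "eval_at v (partial i f) = 0" for i using partial_in_J adjoin_superset by (intro v) blast
      show "eval_at v x = 0" by (intro v adjoin_self[OF ideal_J])
    qed
  qed
  then have "hilbert (adjoin ps.G (g i0)) (CARD('n) * (d - 1 - 1) - 1) = CARD('n)"
    using x by (intro ps.hilbert_adjoin_below_top, unfold J) (rule large_forms_mod_J)
  moreover have "d - 1 - 1 = d - 2" by simp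
  ultimately show ?thesis by (simp only: J)
qed

end

section \<open>Quotient spaces\<close>

context vector_space_count
begin

lemma coset_eq_iff:
  assumes "subspace W"
  shows "coset W x = coset W y \<longleftrightarrow> x - y \<in> W"
proof
  assume "coset W x = coset W y"
  moreover have "x \<in> coset W x" unfolding coset_def using subspace_0[OF assms] by force
  ultimately obtain w where "x = y + w" "w \<in> W" by (auto simp: coset_def)
  then show "x - y \<in> W" by simp
next
  assume xy: "x - y \<in> W"
  have "coset W x \<subseteq> coset W y" if "x - y \<in> W" for x y
  proof
    fix z assume "z \<in> coset W x"
    then obtain w where w: "w \<in> W" "z = x + w" by (auto simp: coset_def)
    then have "z = y + ((x - y) + w)" by simp
    moreover have "(x - y) + w \<in> W" using subspace_add[OF assms that w(1)] .
    ultimately show "z \<in> coset W y" unfolding coset_def by blast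
  qed
  from this[OF xy] this[of y x] show "coset W x = coset W y"
    using subspace_neg[OF assms xy] by auto
qed

lemma finsum_quotient_space:
  assumes W: "subspace W" and V: "subspace V" and "finite T"
    and "\<And>j. j \<in> T \<Longrightarrow> \<gamma> j \<in> V" "\<And>j. j \<in> T \<Longrightarrow> F j = coset W (\<gamma> j)"
  shows "(\<Oplus>\<^bsub>quotient_space scale V W\<^esub>j\<in>T. a j \<odot>\<^bsub>quotient_space scale V W\<^esub> F j) =
    coset W (\<Sum>j\<in>T. scale (a j) (\<gamma> j))"
proof -
  let ?Q = "quotient_space scale V W"
  interpret Q: vectorspace class_ring ?Q by (rule vectorspace_quotient_space[OF W V])
  have smult: "c \<odot>\<^bsub>?Q\<^esub> coset W x = coset W (scale c x)" for c x
    using quotient_space_coset_scale[OF W] by (simp add: quotient_space_def)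
  have add: "coset W x \<oplus>\<^bsub>?Q\<^esub> coset W y = coset W (x + y)" for x y
    using quotient_space_coset_add[OF W] by (simp add: quotient_space_def)
  have carr: "coset W x \<in> carrier ?Q" if "x \<in> V" for x using that by (simp add: quotient_space_def)
  show ?thesis using assms(3-5)
  proof (induction T)
    case empty
    have "coset W 0 = \<zero>\<^bsub>?Q\<^esub>" by (simp add: quotient_space_def coset_def)
    then show ?case by (simp only: Q.finsum_empty sum.empty)
  next
    case (insert j T)
    have "(\<lambda>j. a j \<odot>\<^bsub>?Q\<^esub> F j) \<in> T \<rightarrow> carrier ?Q" "a j \<odot>\<^bsub>?Q\<^esub> F j \<in> carrier ?Q"
      using insert.prems by (auto simp: smult carr subspace_scale[OF V])
    then have "(\<Oplus>\<^bsub>?Q\<^esub>j\<in>insert j T. a j \<odot>\<^bsub>?Q\<^esub> F j) =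
        a j \<odot>\<^bsub>?Q\<^esub> F j \<oplus>\<^bsub>?Q\<^esub> (\<Oplus>\<^bsub>?Q\<^esub>j\<in>T. a j \<odot>\<^bsub>?Q\<^esub> F j)"
      using insert.hyps by (intro Q.finsum_insert)
    then show ?case using insert by (simp add: smult add)
  qed
qed

lemma dim_quotient_space:
  assumes V: "subspace V" "fin_dim V" and W: "subspace W" "W \<subseteq> V"
  shows "vectorspace.dim class_ring (quotient_space scale V W) = dim V - dim W"
proof -
  let ?Q = "quotient_space scale V W"
  interpret Q: vectorspace class_ring ?Q by (rule vectorspace_quotient_space[OF W(1) V(1)])
  have carr: "carrier ?Q = coset W ` V" by (simp add: quotient_space_def)
  obtain C where C: "finite C" "C \<subseteq> V" "card C + dim W = dim V"
    "\<And>v. v \<in> V \<Longrightarrow> \<exists>r. v - (\<Sum>c\<in>C. scale (r c) c) \<in> W"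
    "\<And>r c. (\<Sum>c\<in>C. scale (r c) c) \<in> W \<Longrightarrow> c \<in> C \<Longrightarrow> r c = 0"
    by (rule complement_basis[OF V W]) (rule that)
  have inj: "inj_on (coset W) C"
  proof (rule inj_onI, rule ccontr)
    fix x y assume xy: "x \<in> C" "y \<in> C" "coset W x = coset W y" "x \<noteq> y"
    define u where "u z = (if z = x then 1 else if z = y then -1 else 0 :: 'a)" for z
    have "(\<Sum>z\<in>C. scale (u z) z) = (\<Sum>z\<in>{x,y}. scale (u z) z)"
      using xy C(1) by (intro sum.mono_neutral_right) (auto simp: u_def)
    also have "\<dots> = x - y" using xy by (simp add: u_def)
    finally have "(\<Sum>z\<in>C. scale (u z) z) \<in> W" using xy(3) coset_eq_iff[OF W(1)] by simp
    from C(5)[OF this xy(1)] show False by (simp add: u_def)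
  qed
  let ?A = "coset W ` C"
  define g where "g = inv_into C (coset W)"
  have g: "g X \<in> C" "X = coset W (g X)" if "X \<in> ?A" for X
    using that by (auto simp: g_def inv_into_into f_inv_into_f)
  have g_coset: "g (coset W c) = c" if "c \<in> C" for c using that inj by (simp add: g_def)
  have lincomb: "Q.lincomb a ?A = coset W (\<Sum>c\<in>C. scale (a (coset W c)) c)" for a
  proof -
    have "Q.lincomb a ?A = coset W (\<Sum>X\<in>?A. scale (a X) (g X))"
      unfolding Q.lincomb_def by (rule finsum_quotient_space[OF W(1) V(1)]) (use C g in auto)
    then show ?thesis using inj by (simp add: sum.reindex g_coset)
  qed
  have "Q.basis ?A"
  proof (subst Q.basis_criterion)
    show "finite ?A" using C(1) by simp
    show "?A \<subseteq> carrier ?Q" using C(2) by (auto simp: carr)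
    show "\<forall>v. v \<in> carrier ?Q \<longrightarrow> (\<exists>!a. a \<in> ?A \<rightarrow>\<^sub>E carrier class_ring \<and> Q.lincomb a ?A = v)"
    proof (intro allI impI)
      fix X assume "X \<in> carrier ?Q"
      then obtain v where v: "v \<in> V" "X = coset W v" by (auto simp: carr)
      obtain r where r: "v - (\<Sum>c\<in>C. scale (r c) c) \<in> W" using C(4)[OF v(1)] by blast
      show "\<exists>!a. a \<in> ?A \<rightarrow>\<^sub>E carrier class_ring \<and> Q.lincomb a ?A = X"
      proof (rule ex1I[of _ "restrict (\<lambda>Y. r (g Y)) ?A"], intro conjI)
        show "restrict (\<lambda>Y. r (g Y)) ?A \<in> ?A \<rightarrow>\<^sub>E carrier class_ring" by auto
        have "(\<Sum>c\<in>C. scale (restrict (\<lambda>Y. r (g Y)) ?A (coset W c)) c) = (\<Sum>c\<in>C. scale (r c) c)"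
          by (intro sum.cong) (simp_all add: g_coset)
        then show "Q.lincomb (restrict (\<lambda>Y. r (g Y)) ?A) ?A = X"
          unfolding lincomb v(2) using r coset_eq_iff[OF W(1)] by metis
        fix a assume a: "a \<in> ?A \<rightarrow>\<^sub>E carrier class_ring \<and> Q.lincomb a ?A = X"
        have "v - (\<Sum>c\<in>C. scale (a (coset W c)) c) \<in> W"
          using a v(2) coset_eq_iff[OF W(1)] by (metis lincomb)
        from subspace_diff[OF W(1) r this]
        have "(\<Sum>c\<in>C. scale (a (coset W c) - r c) c) \<in> W"
          by (simp add: scale_left_diff_distrib sum_subtractf)
        from C(5)[OF this] have "a (coset W c) = r c" if "c \<in> C" for c using that by force
        then show "a = restrict (\<lambda>Y. r (g Y)) ?A"
          using a by (intro ext) (auto simp: g_coset PiE_def extensional_def)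
      qed
    qed
  qed
  then have "Q.dim = card ?A" using C(1) by (intro Q.dim_basis) auto
  then show ?thesis using C(3) inj by (simp add: card_image)
qed

lemma quotient_basis_representation:
  fixes s :: nat
  assumes V: "subspace V" and W: "subspace W"
    and basis: "vectorspace.basis class_ring (quotient_space scale V W) (c ` {..<s})" and inj: "inj_on c {..<s}"
  obtains \<gamma> where "\<And>j. j < s \<Longrightarrow> \<gamma> j \<in> V \<and> c j = coset W (\<gamma> j)"
    "\<And>v. v \<in> V \<Longrightarrow> \<exists>y. v - (\<Sum>j<s. scale (y j) (\<gamma> j)) \<in> W"
proof -
  let ?Q = "quotient_space scale V W" and ?A = "c ` {..<s}"
  interpret Q: vectorspace class_ring ?Q by (rule vectorspace_quotient_space[OF W V])
  have carr: "carrier ?Q = coset W ` V" by (simp add: quotient_space_def)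
  have A: "?A \<subseteq> carrier ?Q" using basis by (simp add: Q.basis_def)
  then have "\<forall>j\<in>{..<s}. \<exists>x. x \<in> V \<and> c j = coset W x" by (auto simp: carr)
  from bchoice[OF this] obtain \<gamma> where \<gamma>: "\<forall>j\<in>{..<s}. \<gamma> j \<in> V \<and> c j = coset W (\<gamma> j)" by (rule exE)
  show ?thesis
  proof (rule that[of \<gamma>])
    show "\<gamma> j \<in> V \<and> c j = coset W (\<gamma> j)" if "j < s" for j using \<gamma> that by simp
    fix v assume "v \<in> V"
    then have "coset W v \<in> carrier ?Q" by (simp add: carr)
    moreover have "\<forall>X. X \<in> carrier ?Q \<longrightarrow> (\<exists>!a. a \<in> ?A \<rightarrow>\<^sub>E carrier class_ring \<and> Q.lincomb a ?A = X)"
      by (rule iffD1[OF Q.basis_criterion[OF _ A] basis]) simp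
    ultimately have "\<exists>!a. a \<in> ?A \<rightarrow>\<^sub>E carrier class_ring \<and> Q.lincomb a ?A = coset W v" by simp
    then obtain a where a: "Q.lincomb a ?A = coset W v" by (elim ex1E conjE)
    define h where "h = inv_into {..<s} c"
    have h: "h (c j) = j" if "j < s" for j using that inj by (simp add: h_def)
    have "Q.lincomb a ?A = coset W (\<Sum>X\<in>?A. scale (a X) (\<gamma> (h X)))"
      unfolding Q.lincomb_def by (rule finsum_quotient_space[OF W V]) (use \<gamma> h in auto)
    also have "(\<Sum>X\<in>?A. scale (a X) (\<gamma> (h X))) = (\<Sum>j<s. scale (a (c j)) (\<gamma> j))"
      using inj h by (simp add: sum.reindex)
    finally have "v - (\<Sum>j<s. scale (a (c j)) (\<gamma> j)) \<in> W"
      using a coset_eq_iff[OF W] by metis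
    then show "\<exists>y. v - (\<Sum>j<s. scale (y j) (\<gamma> j)) \<in> W" by (rule exI[of _ "\<lambda>j. a (c j)"])
  qed
qed

end

section \<open>Powers of a general linear combination\<close>

lemma coefficients_mult:
  fixes p q :: "('w, ('v, 'k::comm_ring_1) mpoly) mpoly"
  assumes "\<And>\<alpha>. Poly_Mapping.lookup p \<alpha> \<in> A" "\<And>\<alpha>. Poly_Mapping.lookup q \<alpha> \<in> B"
    and AB: "\<And>a b. a \<in> A \<Longrightarrow> b \<in> B \<Longrightarrow> a * b \<in> C"
    and C: "0 \<in> C" "\<And>a b. a \<in> C \<Longrightarrow> b \<in> C \<Longrightarrow> a + b \<in> C"
  shows "Poly_Mapping.lookup (p * q) \<gamma> \<in> C"
proof -
  have sum: "sum h T \<in> C" if "\<And>t. t \<in> T \<Longrightarrow> h t \<in> C" for h :: "'i \<Rightarrow> ('v, 'k) mpoly" and T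
    using that by (induction T rule: infinite_finite_induct) (auto intro: C)
  have "p * q = (\<Sum>\<alpha>\<in>Poly_Mapping.keys p. Poly_Mapping.single \<alpha> (Poly_Mapping.lookup p \<alpha>)) *
      (\<Sum>\<beta>\<in>Poly_Mapping.keys q. Poly_Mapping.single \<beta> (Poly_Mapping.lookup q \<beta>))"
    by (simp only: poly_mapping_eq_sum_single[symmetric])
  also have "\<dots> = (\<Sum>\<alpha>\<in>Poly_Mapping.keys p. \<Sum>\<beta>\<in>Poly_Mapping.keys q.
      Poly_Mapping.single (\<alpha> + \<beta>) (Poly_Mapping.lookup p \<alpha> * Poly_Mapping.lookup q \<beta>))"
    by (simp only: sum_product mult_single)
  finally have "Poly_Mapping.lookup (p * q) \<gamma> = (\<Sum>\<alpha>\<in>Poly_Mapping.keys p. \<Sum>\<beta>\<in>Poly_Mapping.keys q.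
      if \<alpha> + \<beta> = \<gamma> then Poly_Mapping.lookup p \<alpha> * Poly_Mapping.lookup q \<beta> else 0)"
    by (simp only: lookup_sum lookup_single when_def)
  also have "\<dots> \<in> C" by (intro sum) (auto intro: AB C assms(1,2))
  finally show ?thesis .
qed

text \<open>The \<open>m\<close>-th power of a combination of the \<open>b i\<close> with indeterminate coefficients. Specialising the
  indeterminates to \<open>t\<close> recovers the powers of all combinations.\<close>

definition generic_power :: "nat \<Rightarrow> (nat \<Rightarrow> ('v, 'k::comm_ring_1) mpoly) \<Rightarrow> nat \<Rightarrow> (nat, ('v, 'k) mpoly) mpoly" where
  "generic_power s b m = (\<Sum>i<s. Const (b i) * Var i) ^ m"

lemma generic_power_form: "generic_power s b m \<in> forms m"
proof -
  have "Const (b i) * Var i \<in> forms (0 + 1)" for i by (intro forms_mult Const_in_forms Var_in_forms)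
  then have "(\<Sum>i<s. Const (b i) * Var i) \<in> forms 1" by (intro forms_sum) simp
  from forms_power[OF this, of m] show ?thesis by (simp add: generic_power_def)
qed

lemma generic_power_keys:
  fixes b :: "nat \<Rightarrow> ('v, 'k::comm_ring_1) mpoly"
  assumes "\<alpha> \<in> Poly_Mapping.keys (generic_power s b m)"
  shows "Poly_Mapping.keys \<alpha> \<subseteq> {..<s}"
proof -
  let ?S = "{p :: (nat, ('v, 'k) mpoly) mpoly. \<forall>\<alpha>\<in>Poly_Mapping.keys p. Poly_Mapping.keys \<alpha> \<subseteq> {..<s}}"
  have mult: "p * q \<in> ?S" if "p \<in> ?S" "q \<in> ?S" for p q
  proof safe
    fix \<alpha> x assume "\<alpha> \<in> Poly_Mapping.keys (p * q)" and x: "x \<in> Poly_Mapping.keys \<alpha>"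
    then obtain \<beta> \<gamma> where "\<alpha> = \<beta> + \<gamma>" "\<beta> \<in> Poly_Mapping.keys p" "\<gamma> \<in> Poly_Mapping.keys q"
      using keys_mult[of p q] by blast
    then show "x < s" using that x keys_add[of \<beta> \<gamma>] by blast
  qed
  have termS: "Const (b i) * Var i \<in> ?S" if "i < s" for i
    using that by (intro mult) (auto simp: Const_def Var_def split: if_splits)
  have sumS: "sum h T \<in> ?S" if "\<And>t. t \<in> T \<Longrightarrow> h t \<in> ?S" for h :: "nat \<Rightarrow> (nat, ('v, 'k) mpoly) mpoly" and T
    using that
  proof (induction T rule: infinite_finite_induct)
    case (insert t T)
    then show ?case using keys_add[of "h t" "sum h T"] by fastforce
  qed auto
  have lin: "(\<Sum>i<s. Const (b i) * Var i) \<in> ?S" by (rule sumS, rule termS) simp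
  have "generic_power s b m \<in> ?S"
    unfolding generic_power_def
  proof (induction m)
    case (Suc m)
    then show ?case unfolding power_Suc by (rule mult[OF lin])
  qed (simp add: keys_one)
  then show ?thesis using assms by blast
qed

lemma generic_power_specialise:
  fixes b :: "nat \<Rightarrow> ('v, 'k::field) mpoly"
  shows "(\<Sum>i<s. pscale (t i) (b i)) ^ m = (\<Sum>\<alpha>\<in>Poly_Mapping.keys (generic_power s b m).
    pscale (\<Prod>i\<in>Poly_Mapping.keys \<alpha>. t i ^ Poly_Mapping.lookup \<alpha> i) (Poly_Mapping.lookup (generic_power s b m) \<alpha>))"
proof -
  have prod: "Const (prod h T) = (\<Prod>i\<in>T. Const (h i))" for h :: "nat \<Rightarrow> 'k" and T
    by (induction T rule: infinite_finite_induct) (simp_all add: Const_mult)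
  have "(\<Sum>i<s. pscale (t i) (b i)) ^ m = eval_at (\<lambda>i. Const (t i)) (generic_power s b m)"
    by (simp add: generic_power_def eval_at_sum pscale_def mult.commute)
  also have "\<dots> = (\<Sum>\<alpha>\<in>Poly_Mapping.keys (generic_power s b m). Poly_Mapping.lookup (generic_power s b m) \<alpha> *
      Const (\<Prod>i\<in>Poly_Mapping.keys \<alpha>. t i ^ Poly_Mapping.lookup \<alpha> i))"
    by (simp add: eval_at_def insertion_via_def prod Const_power)
  finally show ?thesis by (simp add: pscale_def mult.commute)
qed

context nodal_hypersurface
begin

lemma generic_power_coefficients:
  assumes b: "\<And>i. i < s \<Longrightarrow> b i \<in> points_ideal_1 \<Gamma>" and m: "m \<ge> 1 \<or> \<Gamma> = {}"
  shows "Poly_Mapping.lookup (generic_power s b m) \<alpha> \<in> vanishing \<Gamma> m"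
proof -
  let ?U = "\<lambda>m. {h \<in> forms m. m \<ge> 1 \<longrightarrow> (\<forall>p\<in>\<Gamma>. eval_at (rep p) h = 0)} :: ('n, 'k) mpoly set"
  have lin: "Poly_Mapping.lookup (\<Sum>i<s. Const (b i) * Var i) \<alpha> \<in> vanishing \<Gamma> 1" for \<alpha>
  proof -
    have "Poly_Mapping.lookup (\<Sum>i<s. Const (b i) * Var i) \<alpha> =
        (\<Sum>i<s. b i * Poly_Mapping.lookup (Var i) \<alpha>)" by (simp add: lookup_sum)
    also have "\<dots> \<in> vanishing \<Gamma> 1"
    proof (rule mpoly_vs.subspace_sum[OF subspace_vanishing[OF finite_\<Gamma>]])
      fix i assume "i \<in> {..<s}"
      then have "b i \<in> vanishing \<Gamma> 1" using b[of i] points_ideal_1_eq by simp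
      moreover have "0 \<in> vanishing \<Gamma> 1" by (rule mpoly_vs.subspace_0[OF subspace_vanishing[OF finite_\<Gamma>]])
      ultimately show "b i * Poly_Mapping.lookup (Var i) \<alpha> \<in> vanishing \<Gamma> 1"
        by (auto simp: Var_def lookup_single when_def)
    qed
    finally show ?thesis .
  qed
  have "Poly_Mapping.lookup (generic_power s b m) \<alpha> \<in> ?U m" for \<alpha>
  proof (induction m arbitrary: \<alpha>)
    case 0
    then show ?case by (auto simp: generic_power_def lookup_one when_def)
  next
    case (Suc m)
    have "Poly_Mapping.lookup ((\<Sum>i<s. Const (b i) * Var i) * generic_power s b m) \<alpha> \<in> ?U (Suc m)"
    proof (rule coefficients_mult[OF lin Suc])
      fix g h assume "g \<in> vanishing \<Gamma> 1" "h \<in> ?U m"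
      then show "g * h \<in> ?U (Suc m)" using forms_mult[of g 1 h m] by (simp add: vanishing_def)
    qed auto
    then show ?case by (simp add: generic_power_def)
  qed
  then show ?thesis using m by (auto simp: vanishing_def)
qed

text \<open>The coefficients of the generic power lie in the saturation of \<open>J\<close>. Their coordinates modulo \<open>J\<close>, with
  respect to the given basis, are the coefficients of the forms \<open>F j\<close>.\<close>

lemma phi_coordinates_exist:
  assumes m: "m \<ge> 1 \<or> \<Gamma> = {}" and b: "family_basis s b (points_ideal_1 \<Gamma>)"
    and c: "family_basis_record s c (jacobian_piece f m)"
  shows "\<exists>F. phi_coordinates f m s b c F"
proof -
  let ?V = "vanishing \<Gamma> m" and ?W = "gradient_piece f m" and ?G = "generic_power s b m"
  let ?N = "quotient_space pscale ?V ?W"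
  have N: "jacobian_piece f m = ?N" by (simp add: jacobian_piece_def saturation_forms_eq)
  have V: "mpoly_vs.subspace ?V" by (rule subspace_vanishing[OF finite_\<Gamma>])
  have W: "mpoly_vs.subspace ?W"
    unfolding gradient_piece_def by (rule subspace_ideal_forms[OF ideal_J])
  have bI: "b i \<in> points_ideal_1 \<Gamma>" if "i < s" for i
    using b that mpoly_vs.span_base[of "b i" "b ` {..<s}"] by (auto simp: family_basis_def)
  have cb: "vectorspace.basis class_ring ?N (c ` {..<s})" "inj_on c {..<s}"
    using c by (simp_all add: family_basis_record_def N)
  obtain \<gamma> where \<gamma>: "\<And>j. j < s \<Longrightarrow> \<gamma> j \<in> ?V \<and> c j = coset ?W (\<gamma> j)"
    "\<And>v. v \<in> ?V \<Longrightarrow> \<exists>y. v - (\<Sum>j<s. pscale (y j) (\<gamma> j)) \<in> ?W"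
    by (rule mpoly_vs.quotient_basis_representation[OF V W cb]) (rule that)
  have "\<exists>y. Poly_Mapping.lookup ?G \<alpha> - (\<Sum>j<s. pscale (y j) (\<gamma> j)) \<in> ?W" for \<alpha>
    by (rule \<gamma>(2)[OF generic_power_coefficients[OF bI m]])
  then obtain y where y: "\<And>\<alpha>. Poly_Mapping.lookup ?G \<alpha> - (\<Sum>j<s. pscale (y \<alpha> j) (\<gamma> j)) \<in> ?W" by metis
  define F where "F j = (\<Sum>\<alpha>\<in>Poly_Mapping.keys ?G. Poly_Mapping.single \<alpha> (y \<alpha> j))" for j
  have F_keys: "Poly_Mapping.keys (F j) \<subseteq> Poly_Mapping.keys ?G" for j
    by (auto simp: F_def in_keys_iff lookup_sum lookup_single when_def split: if_splits)
  have "phi_coordinates f m s b c F"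
    unfolding phi_coordinates_def Let_def N
  proof (intro conjI allI impI ballI)
    fix j
    show "F j \<in> forms m" using F_keys generic_power_form[of s b m] by (auto simp: forms_def)
    show "Poly_Mapping.keys \<alpha> \<subseteq> {..<s}" if "\<alpha> \<in> Poly_Mapping.keys (F j)" for \<alpha>
      using that F_keys generic_power_keys[of \<alpha> s b m] by blast
  next
    fix t :: "nat \<Rightarrow> 'k"
    let ?t = "\<lambda>\<alpha>. \<Prod>i\<in>Poly_Mapping.keys \<alpha>. t i ^ Poly_Mapping.lookup \<alpha> i"
    have "(\<Sum>j<s. pscale (eval_at t (F j)) (\<gamma> j)) =
        (\<Sum>\<alpha>\<in>Poly_Mapping.keys ?G. pscale (?t \<alpha>) (\<Sum>j<s. pscale (y \<alpha> j) (\<gamma> j)))"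
      unfolding F_def eval_at_sum eval_at_single mpoly_vs.scale_sum_left mpoly_vs.scale_sum_right
      by (subst sum.swap) (simp add: mult.commute)
    then have "(\<Sum>i<s. pscale (t i) (b i)) ^ m - (\<Sum>j<s. pscale (eval_at t (F j)) (\<gamma> j)) =
        (\<Sum>\<alpha>\<in>Poly_Mapping.keys ?G. pscale (?t \<alpha>)
          (Poly_Mapping.lookup ?G \<alpha> - (\<Sum>j<s. pscale (y \<alpha> j) (\<gamma> j))))"
      by (simp add: generic_power_specialise mpoly_vs.scale_right_diff_distrib sum_subtractf)
    also have "\<dots> \<in> ?W" by (intro mpoly_vs.subspace_sum[OF W] mpoly_vs.subspace_scale[OF W] y)
    finally have "coset ?W ((\<Sum>i<s. pscale (t i) (b i)) ^ m) = coset ?W (\<Sum>j<s. pscale (eval_at t (F j)) (\<gamma> j))"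
      using mpoly_vs.coset_eq_iff[OF W] by blast
    also have "\<dots> = (\<Oplus>\<^bsub>?N\<^esub>j\<in>{..<s}. eval_at t (F j) \<odot>\<^bsub>?N\<^esub> c j)"
      using \<gamma>(1) by (intro mpoly_vs.finsum_quotient_space[OF W V, symmetric]) auto
    finally show "coset ?W ((\<Sum>i<s. pscale (t i) (b i)) ^ m) =
        (\<Oplus>\<^bsub>?N\<^esub>j\<in>{..<s}. eval_at t (F j) \<odot>\<^bsub>?N\<^esub> c j)" .
  qed
  then show ?thesis by blast
qed

section \<open>The Veronese-avoiding property\<close>

lemma power_in_J_vanishes:
  assumes l: "l \<in> forms 1" "l ^ m \<in> J"
  shows "l \<in> points_ideal_1 \<Gamma>"
  unfolding points_ideal_1_iff
proof (intro conjI ballI l(1))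
  fix p assume "p \<in> \<Gamma>"
  then have "eval_at v l ^ m = 0" if "v \<in> p" for v using J_vanishes[OF l(2)] that by simp
  then show "vanishes_at l p" by (auto simp: vanishes_at_def)
qed

lemma linear_form_power_nonzero:
  fixes l :: "('n, 'k) mpoly"
  assumes "l \<in> forms 1" "l \<noteq> 0"
  shows "l ^ m \<noteq> 0"
proof
  assume "l ^ m = 0"
  obtain \<xi> where \<xi>: "l = (\<Sum>i\<in>UNIV. Const (\<xi> i) * Var i)" "\<And>v. eval_at v l = (\<Sum>i\<in>UNIV. \<xi> i * v i)"
    by (rule eval_at_linear_form[OF assms(1)]) (rule that)
  have "\<xi> i = 0" for i
  proof -
    let ?v = "\<lambda>j. if j = i then 1 else 0 :: 'k"
    have "eval_at ?v l = \<xi> i" by (simp add: \<xi>(2) if_distrib cong: if_cong)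
    moreover have "eval_at ?v l ^ m = 0" using \<open>l ^ m = 0\<close> by (metis eval_at_0 eval_at_power)
    ultimately show ?thesis by simp
  qed
  then show False using \<xi>(1) assms(2) by simp
qed

lemma proj_point_self: "v \<in> proj_point pscale v"
  unfolding proj_point_def by (rule range_eqI[of _ _ 1]) (simp add: pscale_def)

text \<open>The condition on the codimension always holds. A linear form that defines a point in the intersection
  has its power in \<open>J\<close>, so it vanishes at the nodes.\<close>

lemma veronese_avoiding_iff:
  assumes m: "m = CARD('n) * (d - 2) - 1"
  shows "veronese_avoiding d f \<longleftrightarrow> \<not> (\<exists>l\<in>points_ideal_1 \<Gamma>. l \<noteq> 0 \<and> l ^ m \<in> gradient_piece f m)"
proof -
  have "proj_codim (forms m) (gradient_piece f m) = CARD('n)"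
    using hilbert_gradient_ideal by (simp add: hilbert_def gradient_piece_def m)
  then have "veronese_avoiding d f \<longleftrightarrow> PP (gradient_piece f m) \<inter> veronese m = {}"
    by (simp add: veronese_avoiding_def Let_def m)
  also have "\<dots> \<longleftrightarrow> \<not> (\<exists>l\<in>points_ideal_1 \<Gamma>. l \<noteq> 0 \<and> l ^ m \<in> gradient_piece f m)"
  proof
    assume empty: "PP (gradient_piece f m) \<inter> veronese m = {}"
    show "\<not> (\<exists>l\<in>points_ideal_1 \<Gamma>. l \<noteq> 0 \<and> l ^ m \<in> gradient_piece f m)"
    proof
      assume "\<exists>l\<in>points_ideal_1 \<Gamma>. l \<noteq> 0 \<and> l ^ m \<in> gradient_piece f m"
      then obtain l where l: "l \<in> forms 1" "l \<noteq> 0" "l ^ m \<in> gradient_piece f m"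
        by (auto simp: points_ideal_1_iff)
      have "proj_point pscale (l ^ m) \<in> PP (gradient_piece f m)"
        using l(3) linear_form_power_nonzero[OF l(1,2)] by (auto simp: proj_space_def)
      moreover have "proj_point pscale (l ^ m) \<in> veronese m" using l(1,2) by (auto simp: veronese_def)
      ultimately show False using empty by blast
    qed
  next
    assume none: "\<not> (\<exists>l\<in>points_ideal_1 \<Gamma>. l \<noteq> 0 \<and> l ^ m \<in> gradient_piece f m)"
    show "PP (gradient_piece f m) \<inter> veronese m = {}"
    proof (rule ccontr)
      assume "PP (gradient_piece f m) \<inter> veronese m \<noteq> {}"
      then obtain h l where hl: "h \<in> gradient_piece f m" "l \<in> forms 1" "l \<noteq> 0"
        "proj_point pscale h = proj_point pscale (l ^ m)"
        by (auto simp: proj_space_def veronese_def)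
      then have "l ^ m \<in> proj_point pscale h" using proj_point_self by metis
      then obtain a where "l ^ m = pscale a h" by (auto simp: proj_point_def)
      then have lm: "l ^ m \<in> gradient_piece f m"
        using hl(1) is_ideal_pscale[OF ideal_J] by (auto simp: gradient_piece_def)
      then have "l \<in> points_ideal_1 \<Gamma>"
        using power_in_J_vanishes[OF hl(2)] by (auto simp: gradient_piece_def)
      then show False using none hl(3) lm by blast
    qed
  qed
  finally show ?thesis .
qed

text \<open>The exponent \<open>m\<close> can only be \<open>0\<close> for a single variable, and then there is no node.\<close>

lemma exponent_positive: "CARD('n) * (d - 2) - 1 \<ge> 1 \<or> \<Gamma> = {}"
proof (cases "\<Gamma> = {}")
  case False
  then have "card \<Gamma> \<ge> 1" using finite_\<Gamma> by (simp add: Suc_leI card_gt_0_iff)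
  then have "CARD('n) \<ge> 2" using card_\<Gamma> by linarith
  moreover have "d - 2 \<ge> 1" using d_ge_3 by simp
  ultimately have "2 * 1 \<le> CARD('n) * (d - 2)" by (rule mult_le_mono)
  then have "CARD('n) * (d - 2) - 1 \<ge> 1" by linarith
  then show ?thesis by (rule disjI1)
qed simp

lemma dim_jacobian_piece:
  assumes m: "m = CARD('n) * (d - 2) - 1"
  shows "vectorspace.dim class_ring (jacobian_piece f m) = CARD('n) - card \<Gamma>"
proof -
  have W: "mpoly_vs.subspace (J \<inter> forms m)" by (rule subspace_ideal_forms[OF ideal_J])
  have sub: "J \<inter> forms m \<subseteq> vanishing \<Gamma> m"
  proof
    fix h assume h: "h \<in> J \<inter> forms m"
    then have "h \<in> saturation J"
      using is_ideal_mult[OF ideal_J] by (auto simp: saturation_def)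
    then show "h \<in> vanishing \<Gamma> m" using h by (simp flip: saturation_forms_eq)
  qed
  have "vectorspace.dim class_ring (jacobian_piece f m) =
      mpoly_vs.dim (vanishing \<Gamma> m) - mpoly_vs.dim (J \<inter> forms m)"
    unfolding jacobian_piece_def saturation_forms_eq gradient_piece_def
    by (rule mpoly_vs.dim_quotient_space[OF subspace_vanishing[OF finite_\<Gamma>] fin_dim_vanishing W sub])
  moreover have "mpoly_vs.dim (vanishing \<Gamma> m) + card \<Gamma> = mpoly_vs.dim (forms m :: ('n, 'k) mpoly set)"
    using dim_vanishing[of m] exponent_positive m by simp
  moreover have "mpoly_vs.dim (J \<inter> forms m) + CARD('n) = mpoly_vs.dim (forms m :: ('n, 'k) mpoly set)"
    using dim_plus_hilbert[of J m] hilbert_gradient_ideal m by simp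
  ultimately show ?thesis using card_\<Gamma> by linarith
qed

lemma everywhere_defined_iff:
  assumes m: "m \<ge> 1 \<or> \<Gamma> = {}"
  shows "everywhere_defined (phi f \<Gamma> m) (PP (points_ideal_1 \<Gamma>)) \<longleftrightarrow>
    \<not> (\<exists>l\<in>points_ideal_1 \<Gamma>. l \<noteq> 0 \<and> l ^ m \<in> gradient_piece f m)"
proof -
  let ?W = "gradient_piece f m"
  have W: "mpoly_vs.subspace ?W"
    unfolding gradient_piece_def by (rule subspace_ideal_forms[OF ideal_J])
  have carr: "coset ?W (l ^ m) \<in> carrier (jacobian_piece f m)" if l: "l \<in> points_ideal_1 \<Gamma>" for l
  proof -
    have "l \<in> forms 1" "\<And>p. p \<in> \<Gamma> \<Longrightarrow> eval_at (rep p) l = 0"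
      using l by (simp_all add: points_ideal_1_eq vanishing_def)
    then have "l ^ m \<in> vanishing \<Gamma> m"
      using m forms_power[of l 1 m] by (auto simp: vanishing_def)
    then show ?thesis by (simp add: jacobian_piece_def quotient_space_def saturation_forms_eq)
  qed
  have zero: "coset ?W (l ^ m) = \<zero>\<^bsub>jacobian_piece f m\<^esub> \<longleftrightarrow> l ^ m \<in> ?W" for l
  proof -
    have "\<zero>\<^bsub>jacobian_piece f m\<^esub> = coset ?W 0"
      by (simp add: jacobian_piece_def quotient_space_def coset_def)
    then show ?thesis using mpoly_vs.coset_eq_iff[OF W, of "l ^ m" 0] by simp
  qed
  have dom: "Domain (phi f \<Gamma> m) = {proj_point pscale l | l. l \<in> points_ideal_1 \<Gamma> \<and> l \<noteq> 0 \<and> l ^ m \<notin> ?W}"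
    unfolding phi_def Let_def using carr zero by auto
  show ?thesis
  proof
    assume ed: "everywhere_defined (phi f \<Gamma> m) (PP (points_ideal_1 \<Gamma>))"
    show "\<not> (\<exists>l\<in>points_ideal_1 \<Gamma>. l \<noteq> 0 \<and> l ^ m \<in> ?W)"
    proof
      assume "\<exists>l\<in>points_ideal_1 \<Gamma>. l \<noteq> 0 \<and> l ^ m \<in> ?W"
      then obtain l where l: "l \<in> points_ideal_1 \<Gamma>" "l \<noteq> 0" "l ^ m \<in> ?W" by blast
      then have "proj_point pscale l \<in> Domain (phi f \<Gamma> m)"
        using ed by (auto simp: everywhere_defined_def proj_space_def)
      then obtain l' where l': "proj_point pscale l = proj_point pscale l'" "l' ^ m \<notin> ?W"
        unfolding dom by blast
      then have "l' \<in> proj_point pscale l" using proj_point_self by metis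
      then obtain a where "l' = pscale a l" by (auto simp: proj_point_def)
      then have "l' ^ m = pscale (a ^ m) (l ^ m)" by (simp add: pscale_def power_mult_distrib Const_power)
      then show False using l'(2) mpoly_vs.subspace_scale[OF W l(3)] by simp
    qed
  next
    assume "\<not> (\<exists>l\<in>points_ideal_1 \<Gamma>. l \<noteq> 0 \<and> l ^ m \<in> ?W)"
    then show "everywhere_defined (phi f \<Gamma> m) (PP (points_ideal_1 \<Gamma>))"
      unfolding everywhere_defined_def dom proj_space_def by blast
  qed
qed

end

theorem theorem2p21:
  fixes f :: "('n::finite, 'k::{alg_closed_field, field_char_0}) mpoly"
    and d r m :: nat
    and \<Gamma> :: "('n \<Rightarrow> 'k) set set"
  assumes "f \<in> forms d" and "squarefree f" and "d \<ge> 3"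
    and "\<Gamma> = Sing f" and "finite \<Gamma>" and "r = card \<Gamma>" and "r < CARD('n)"
    and "\<forall>p\<in>\<Gamma>. is_node f p"
    and "independent_conditions \<Gamma>"
    and "m = CARD('n) * (d - 2) - 1"
  shows "(veronese_avoiding d f \<longleftrightarrow>
            \<not> (\<exists>l\<in>points_ideal_1 \<Gamma>. l \<noteq> 0 \<and> l ^ m \<in> gradient_piece f m)) \<and>
         (\<not> (\<exists>l\<in>points_ideal_1 \<Gamma>. l \<noteq> 0 \<and> l ^ m \<in> gradient_piece f m) \<longleftrightarrow>
            everywhere_defined (phi f \<Gamma> m) (PP (points_ideal_1 \<Gamma>))) \<and>
         mpoly_vs.dim (points_ideal_1 \<Gamma>) = CARD('n) - r \<and>
         vectorspace.dim class_ring (jacobian_piece f m) = CARD('n) - r \<and>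
         (\<forall>b c. family_basis (CARD('n) - r) b (points_ideal_1 \<Gamma>) \<longrightarrow>
                family_basis_record (CARD('n) - r) c (jacobian_piece f m) \<longrightarrow>
                (\<exists>F. phi_coordinates f m (CARD('n) - r) b c F))"
proof -
  interpret nodal_hypersurface f d \<Gamma>
    using assms by unfold_locales auto
  have m: "m \<ge> 1 \<or> \<Gamma> = {}" using exponent_positive assms(10) by simp
  show ?thesis
    unfolding assms(6)
    using veronese_avoiding_iff[OF assms(10)] everywhere_defined_iff[OF m] dim_points_ideal_1
      dim_jacobian_piece[OF assms(10)] phi_coordinates_exist[OF m]
    by blast
qed

end
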